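(* Suppose that $\mathscr{A}$ is a set of positive integers and that $|\mathscr{A} \bmod p| \leq \frac12(p+1)$ for all sufficiently large primes $p$. Then one of the following holds: (i) there is a rational quadratic $\psi$ such that all except finitely many elements of $\mathscr{A}$ are contained in $\psi(\mathbb{Q})$; (ii) for each integer $k$ there are arbitrarily large values of $X$ such that $|\mathscr{A}[X]| < X^{1/2}/\log^k X$; (iii) given any rational quadratic $\psi$, for all $X$ we have $|\mathscr{A}[X]\cap\psi(\mathbb{Q})| \leq X^{1/4+o_\psi(1)}$ (i.e. for every $\eta>0$ one has $|\mathscr{A}[X]\cap\psi(\mathbb{Q})| \le X^{1/4+\eta}$ for all $X$ sufficiently large in terms of $\psi$ and $\eta$).
   Context: A rational quadratic is a polynomial of degree $2$ with rational coefficients; $\psi(\mathbb{Q})$ is its set of values at rational arguments. $\mathscr{A}[X] := \mathscr{A}\cap\{1,\dots,X\}$; $|\mathscr{A}\bmod p|$ is the number of residue classes mod $p$ occupied by $\mathscr{A}$. *)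

theory Defs
  imports Complex_Main "HOL-Computational_Algebra.Computational_Algebra"
begin

definition rational_quadratic :: "rat poly \<Rightarrow> bool" where
  "rational_quadratic \<psi> \<longleftrightarrow> degree \<psi> = 2"

(* The natural numbers lying in \<psi>(\<rat>). *)
definition rational_values :: "rat poly \<Rightarrow> nat set" where
  "rational_values \<psi> = {n. of_nat n \<in> range (poly \<psi>)}"

definition truncation :: "nat set \<Rightarrow> nat \<Rightarrow> nat set" where
  "truncation A X = A \<inter> {1..X}"

definition residue_classes :: "nat set \<Rightarrow> nat \<Rightarrow> nat set" where
  "residue_classes A p = (\<lambda>a. a mod p) ` A"

end

theory Submission
  imports Defs "HOL-Real_Asymp.Real_Asymp" "HOL-Analysis.Summation_Tests" "HOL-Analysis.Harmonic_Numbers"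
    "HOL-Analysis.Convex" "HOL-Number_Theory.Number_Theory"
begin

text \<open>Completing the square, membership of \<open>n\<close> in \<open>\<psi>(\<rat>)\<close> means that \<open>\<alpha> n + \<beta>\<close> is a square, for some
  integers \<open>\<alpha>\<close> and \<open>\<beta>\<close>; accordingly \<open>A\<close> splits into squares and non-squares. Suppose that (i) and
  (iii) fail for this \<open>\<psi>\<close>. There are then infinitely many non-squares. A non-square \<open>m\<close> takes a class away
  from the squares modulo every prime with \<open>(m/p) = -1\<close>, so Brun's sieve with arbitrarily many of them
  bounds the number of squares up to \<open>X\<close> by \<open>sqrt X / log\<^sup>k X\<close>. If moreover there are more than
  \<open>X powr (1/4 + \<eta>)\<close> squares up to \<open>X\<close>, Gallagher's larger sieve shows that they occupy more than \<open>p/4\<close> classes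
  on average, which leaves fewer than \<open>p/4\<close> classes of non-residues for the non-squares. As at least half
  of the non-squares are non-residues on average over \<open>p\<close>, a weighted larger sieve bounds their number
  by \<open>X powr (1/2 - \<rho>)\<close>, and (ii) follows.

  The statement on average non-residues only needs upper bounds for sums of \<open>(m/p) log p / p\<close>. If \<open>m\<close> has
  a small squarefree part, the larger sieve in \<open>\<rat>(sqrt m)\<close> provides one, uniformly in \<open>m\<close> and without any
  information on \<open>L(1, \<chi>)\<close>. Large squarefree parts that violate it are rare, by quadratic reciprocity and
  orthogonality applied to a high power of the prime sum, and each of them accounts for few \<open>m\<close>.\<close>

section \<open>Sums over primes and the larger sieve\<close>

text \<open>Everything is measured against the threshold of the larger sieve. The roots of the
  squares lie below about \<open>sqrt X\<close>; if the squares filled \<open>p/4\<close> classes,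
  the roots would fill at most \<open>p/2\<close>, and the sieve would stop at about
  \<open>X powr (1/4)\<close> of them. Non-squares up to \<open>X\<close> in \<open>p/2\<close>
  classes stop at \<open>X powr (1/2)\<close>. At both thresholds the main terms cancel, so a gain
  has to come from a small multiple of \<open>ln X\<close>. This is why the sieve is kept as an
  inequality for the number of collisions: class counts and character sums enter it linearly and can
  be averaged over \<open>p\<close>. An excess of \<open>\<eta>\<close> over the exponent 1/4
  produces a gain of order \<open>\<eta>\<^sup>2 * ln X\<close> for the non-squares. The obstacle is
  a character equal to 1 at nearly all primes of the range, which would hide the non-squares among
  the residues. The sieve in \<open>\<rat>(sqrt m)\<close> loses \<open>2 * ln m\<close>, which is
  harmless only when \<open>m\<close> is a small power of \<open>X\<close>; this forces a separate
  argument for large squarefree parts.\<close>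

definition collisions :: "('i \<Rightarrow> 'c) \<Rightarrow> 'i set \<Rightarrow> nat" where
  "collisions f I = card {(i, j). i \<in> I \<and> j \<in> I \<and> f i = f j}"

text \<open>Double counting: a pair of distinct elements collides with total weight at most
  \<open>L\<close>, and the diagonal contributes \<open>card I\<close> for each index. The index
  type is left free because the indices will be primes on some occasions and prime ideals of a
  quadratic field on another.\<close>

lemma larger_sieve:
  fixes f :: "'p \<Rightarrow> 'i \<Rightarrow> 'c" and w :: "'p \<Rightarrow> real" and L :: real
  assumes "finite I" "finite P" "L \<ge> 0"
    and le: "\<And>i j. i \<in> I \<Longrightarrow> j \<in> I \<Longrightarrow> i \<noteq> j \<Longrightarrow> (\<Sum>p\<in>{p\<in>P. f p i = f p j}. w p) \<le> L"
  shows "(\<Sum>p\<in>P. w p * collisions (f p) I) \<le> (card I)\<^sup>2 * L + card I * (\<Sum>p\<in>P. w p)"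
proof -
  have coll: "real (collisions (f p) I) = (\<Sum>i\<in>I. \<Sum>j\<in>I. if f p i = f p j then 1 else 0)" for p
  proof -
    have "{(i, j). i \<in> I \<and> j \<in> I \<and> f p i = f p j} = (SIGMA i:I. {j\<in>I. f p i = f p j})" by auto
    then show ?thesis
      using assms(1) by (simp add: collisions_def sum.If_cases Int_def)
  qed
  have "(\<Sum>p\<in>P. w p * collisions (f p) I)
      = (\<Sum>p\<in>P. \<Sum>i\<in>I. \<Sum>j\<in>I. if f p i = f p j then w p else 0)"
    by (simp add: coll sum_distrib_left if_distrib cong: if_cong)
  also have "\<dots> = (\<Sum>i\<in>I. \<Sum>p\<in>P. \<Sum>j\<in>I. if f p i = f p j then w p else 0)"
    by (rule sum.swap)
  also have "\<dots> = (\<Sum>i\<in>I. \<Sum>j\<in>I. \<Sum>p\<in>P. if f p i = f p j then w p else 0)"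
    by (intro sum.cong refl sum.swap)
  also have "\<dots> \<le> (\<Sum>i\<in>I. \<Sum>j\<in>I. L + (if i = j then (\<Sum>p\<in>P. w p) else 0))"
  proof (intro sum_mono)
    fix i j assume ij: "i \<in> I" "j \<in> I"
    have "(\<Sum>p\<in>P. if f p i = f p j then w p else 0) = (\<Sum>p\<in>{p\<in>P. f p i = f p j}. w p)"
      using assms(2) by (simp add: sum.If_cases Int_def)
    then show "(\<Sum>p\<in>P. if f p i = f p j then w p else 0) \<le> L + (if i = j then (\<Sum>p\<in>P. w p) else 0)"
      using le[OF ij] \<open>L \<ge> 0\<close> by (cases "i = j") auto
  qed
  also have "\<dots> = (card I)\<^sup>2 * L + card I * (\<Sum>p\<in>P. w p)"
    using assms(1) by (simp add: sum.distrib power2_eq_square algebra_simps)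
  finally show ?thesis .
qed

text \<open>With \<open>N v\<close> elements in class \<open>v\<close>, this is the sum of
  \<open>(N v - l v)\<^sup>2 \<ge> 0\<close> over the classes. It is Cauchy-Schwarz with the optimal
  class size replaced by an arbitrary guess \<open>l\<close>; for a constant guess the bound is
  linear in the number of occupied classes.\<close>

lemma collisions_ge:
  fixes l :: "'c \<Rightarrow> real"
  assumes "finite I" "finite V" "f ` I \<subseteq> V"
  shows "(\<Sum>i\<in>I. 2 * l (f i)) - (\<Sum>v\<in>V. (l v)\<^sup>2) \<le> collisions f I"
proof -
  define N where "N = (\<lambda>v. real (card {i\<in>I. f i = v}))"
  have "{(i, j). i \<in> I \<and> j \<in> I \<and> f i = f j} = (\<Union>v\<in>V. {i\<in>I. f i = v} \<times> {i\<in>I. f i = v})"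
    using assms(3) by auto
  then have "real (collisions f I) = real (card (\<Union>v\<in>V. {i\<in>I. f i = v} \<times> {i\<in>I. f i = v}))"
    by (simp add: collisions_def)
  also have "\<dots> = (\<Sum>v\<in>V. (N v)\<^sup>2)"
    using assms by (subst card_UN_disjoint) (auto simp: N_def power2_eq_square card_cartesian_product)
  finally have 1: "real (collisions f I) = (\<Sum>v\<in>V. (N v)\<^sup>2)" .
  have "(\<Sum>i\<in>I. 2 * l (f i)) = (\<Sum>v\<in>V. \<Sum>i\<in>{i\<in>I. f i = v}. 2 * l (f i))"
    using assms by (subst sum.group) auto
  also have "\<dots> = (\<Sum>v\<in>V. 2 * N v * l v)"
    by (intro sum.cong) (auto simp: N_def)
  finally have 2: "(\<Sum>i\<in>I. 2 * l (f i)) = (\<Sum>v\<in>V. 2 * N v * l v)" .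
  have "0 \<le> (\<Sum>v\<in>V. (N v - l v)\<^sup>2)" by (intro sum_nonneg) auto
  also have "\<dots> = (\<Sum>v\<in>V. (N v)\<^sup>2) + (\<Sum>v\<in>V. (l v)\<^sup>2) - (\<Sum>v\<in>V. 2 * N v * l v)"
    by (simp add: power2_diff sum.distrib sum_subtractf)
  finally show ?thesis using 1 2 by simp
qed

text \<open>The uniform guess \<open>card I / \<nu>\<close> in \<open>collisions_ge\<close>.\<close>

lemma collisions_ge_card:
  assumes "finite I" "finite V" "f ` I \<subseteq> V" "card V \<le> (\<nu>::real)" "\<nu> > 0"
  shows "(card I)\<^sup>2 / \<nu> \<le> collisions f I"
proof -
  have "2 * (card I)\<^sup>2 / \<nu> - card V * (card I / \<nu>)\<^sup>2 \<le> collisions f I"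
    using collisions_ge[OF assms(1-3), of "\<lambda>_. card I / \<nu>"] by (simp add: power2_eq_square mult_ac)
  moreover have "card V * (card I / \<nu>)\<^sup>2 \<le> \<nu> * (card I / \<nu>)\<^sup>2"
    using assms(4) by (intro mult_right_mono) auto
  moreover have "\<nu> * (card I / \<nu>)\<^sup>2 = (card I)\<^sup>2 / \<nu>"
    using assms(5) by (simp add: power2_eq_square)
  ultimately show ?thesis by simp
qed

section \<open>Prime divisors of an integer and Chebyshev's upper bound\<close>

lemma prod_prime_powers_dvd:
  fixes N :: nat
  assumes "finite P" "\<And>p. p \<in> P \<Longrightarrow> prime p" "\<And>p. p \<in> P \<Longrightarrow> p ^ e p dvd N"
  shows "(\<Prod>p\<in>P. p ^ e p) dvd N"
  using assms
proof (induction P)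
  case (insert p P)
  have "coprime (p ^ e p) (\<Prod>p\<in>P. p ^ e p)"
  proof (rule prod_coprime_right)
    fix q assume "q \<in> P"
    then have "coprime p q" using insert by (intro primes_coprime) auto
    then show "coprime (p ^ e p) (q ^ e q)" by simp
  qed
  then show ?case using insert by (simp add: divides_mult)
qed auto

text \<open>The exponents serve norms from \<open>\<rat>(sqrt m)\<close>, where both prime ideals
  above \<open>p\<close> may divide and then contribute \<open>p\<^sup>2\<close>.\<close>

lemma sum_ln_prime_powers_le:
  fixes N :: nat
  assumes "finite P" "\<And>p. p \<in> P \<Longrightarrow> prime p" "\<And>p. p \<in> P \<Longrightarrow> p ^ e p dvd N" "N > 0"
  shows "(\<Sum>p\<in>P. real (e p) * ln (real p)) \<le> ln (real N)"
proof -
  have pos: "0 < (\<Prod>p\<in>P. p ^ e p)" using assms(2) by (auto intro!: prod_pos simp: prime_gt_0_nat)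
  have "(\<Sum>p\<in>P. real (e p) * ln (real p)) = (\<Sum>p\<in>P. ln (real (p ^ e p)))"
    using assms(2) by (intro sum.cong) (auto simp: ln_realpow prime_gt_0_nat)
  also have "\<dots> = ln (\<Prod>p\<in>P. real (p ^ e p))"
    using assms(1,2) by (subst ln_prod) (auto simp: prime_gt_0_nat)
  also have "\<dots> = ln (real (\<Prod>p\<in>P. p ^ e p))" by simp
  also have "\<dots> \<le> ln (real N)"
    using prod_prime_powers_dvd[OF assms(1-3)] pos assms(4)
    by (subst ln_le_cancel_iff) (auto simp del: of_nat_prod dest: dvd_imp_le)
  finally show ?thesis .
qed

lemma sum_ln_primes_le:
  fixes N :: nat
  assumes "finite P" "\<And>p. p \<in> P \<Longrightarrow> prime p" "\<And>p. p \<in> P \<Longrightarrow> p dvd N" "N > 0"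
  shows "(\<Sum>p\<in>P. ln (real p)) \<le> ln (real N)"
  using sum_ln_prime_powers_le[of P "\<lambda>_. 1" N] assms by simp

definition primes_in :: "nat \<Rightarrow> nat \<Rightarrow> nat set" where
  "primes_in a b = {p. prime p \<and> a < p \<and> p \<le> b}"

lemma finite_primes_in [simp, intro]: "finite (primes_in a b)"
  by (rule finite_subset[of _ "{..b}"]) (auto simp: primes_in_def)

lemma primes_inD:
  assumes "p \<in> primes_in a b"
  shows "prime p" "a < p" "p \<le> b" "0 < p" "2 \<le> p" "ln (real p) > 0"
  using assms prime_ge_2_nat[of p] by (auto simp: primes_in_def)

lemma primes_in_split:
  assumes "a \<le> b" "b \<le> c"
  shows "primes_in a c = primes_in a b \<union> primes_in b c" "primes_in a b \<inter> primes_in b c = {}"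
  using assms by (auto simp: primes_in_def)

lemma sum_primes_in_split:
  assumes "a \<le> b" "b \<le> c"
  shows "sum f (primes_in a c) = sum f (primes_in a b) + (sum f (primes_in b c) :: real)"
  using primes_in_split[OF assms] by (simp add: sum.union_disjoint)

text \<open>Erdos's argument: for \<open>n = 2 * m + 1\<close> the primes above \<open>m + 1\<close>
  divide a middle binomial coefficient, which is at most \<open>4 ^ m\<close> because it occurs
  twice in a row with sum \<open>2 ^ (2 * m + 1)\<close>.\<close>

lemma primorial_le: "\<Prod>(primes_in 0 n) \<le> 4 ^ n"
proof (induction n rule: less_induct)
  case (less n)
  consider "n \<le> 1" | "n = 2" | "n > 2" "even n" | m where "n = 2 * m + 1" "m \<ge> 1"
    by (metis One_nat_def Suc_eq_plus1 leI le_eq_less_or_eq less_2_cases_iff less_one mult_0_right nat_less_le oddE)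
  then show ?case
  proof cases
    case 1
    then have "primes_in 0 n = {}" by (auto simp: primes_in_def dest: prime_ge_2_nat)
    then show ?thesis by simp
  next
    case 2
    have "primes_in 0 2 = {2}" by (auto simp: primes_in_def dest: prime_ge_2_nat)
    then show ?thesis using 2 by simp
  next
    case 3
    have "primes_in 0 n = primes_in 0 (n - 1)"
    proof -
      have "\<not> prime n" using 3 prime_odd_nat[of n] by auto
      then have "p \<le> n - 1" if "p \<le> n" "prime p" for p
        using that by (cases "p = n") auto
      then show ?thesis by (auto simp: primes_in_def)
    qed
    then have "\<Prod>(primes_in 0 n) \<le> 4 ^ (n - 1)" using less.IH[of "n - 1"] 3 by simp
    also have "\<dots> \<le> 4 ^ n" by (rule power_increasing) auto
    finally show ?thesis .
  next
    case 4
    let ?B = "(2 * m + 1) choose m"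
    have "2 * ?B = ((2 * m + 1) choose m) + ((2 * m + 1) choose (m + 1))"
      using binomial_symmetric[of m "2 * m + 1"] by simp
    also have "\<dots> = (\<Sum>k\<in>{m, m + 1}. (2 * m + 1) choose k)" by simp
    also have "\<dots> \<le> (\<Sum>k\<le>2 * m + 1. (2 * m + 1) choose k)"
      by (rule sum_mono2) auto
    also have "\<dots> = 2 ^ (2 * m + 1)" by (rule choose_row_sum)
    finally have B: "?B \<le> 4 ^ m" by (simp add: power_mult)
    have "p dvd ?B" if "p \<in> primes_in (m + 1) n" for p
    proof -
      have p: "prime p" "m + 1 < p" "p \<le> n" using that by (auto simp: primes_in_def)
      have "fact m * fact (m + 1) * ?B = fact n"
        using binomial_fact_lemma[of m "2 * m + 1"] 4 by simp
      moreover have "p dvd fact n" using p by (simp add: prime_dvd_fact_iff)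
      moreover have "\<not> p dvd fact m" "\<not> p dvd fact (m + 1)" using p by (simp_all only: prime_dvd_fact_iff)
      ultimately show ?thesis using p(1) by (metis prime_dvd_mult_iff)
    qed
    then have "(\<Prod>p\<in>primes_in (m + 1) n. p ^ 1) dvd ?B"
      using primes_inD(1) by (intro prod_prime_powers_dvd) (auto simp del: binomial_Suc_Suc)
    then have "\<Prod>(primes_in (m + 1) n) dvd ?B" by simp
    then have "\<Prod>(primes_in (m + 1) n) \<le> ?B"
      by (rule dvd_imp_le) (simp add: zero_less_binomial_iff)
    then have 1: "\<Prod>(primes_in (m + 1) n) \<le> 4 ^ m" using B by simp
    have "\<Prod>(primes_in 0 n) = \<Prod>(primes_in 0 (m + 1)) * \<Prod>(primes_in (m + 1) n)"
      using primes_in_split[of 0 "m + 1" n] 4 by (simp add: prod.union_disjoint)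
    also have "\<dots> \<le> 4 ^ (m + 1) * 4 ^ m"
      using less.IH[of "m + 1"] 4 1 by (intro mult_le_mono) auto
    also have "\<dots> = 4 ^ n" using 4 by (simp add: power_add[symmetric] mult_2)
    finally show ?thesis .
  qed
qed

abbreviation theta :: "nat \<Rightarrow> nat \<Rightarrow> real" where
  "theta a b \<equiv> \<Sum>p\<in>primes_in a b. ln (real p)"

lemma sum_ln_primes_in_le: "theta a n \<le> ln 4 * real n"
proof -
  have "theta a n \<le> theta 0 n"
    by (rule sum_mono2) (auto simp: primes_in_def Suc_leI prime_gt_0_nat)
  also have "\<dots> = ln (real (\<Prod>(primes_in 0 n)))"
    by (simp add: primes_inD(4) ln_prod)
  also have "\<dots> \<le> ln (real (4 ^ n))"
    using primorial_le[of n] primes_inD(4) by (subst ln_le_cancel_iff) (auto simp del: of_nat_prod of_nat_power intro!: prod_pos)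
  also have "\<dots> = ln 4 * real n" by (simp add: ln_realpow)
  finally show ?thesis .
qed

lemma mod_eq_imp_dvd_diff_nat:
  assumes "i mod p = j mod (p::nat)"
  shows "p dvd nat \<bar>int i - int j\<bar>"
proof -
  have "int i mod int p = int j mod int p" using assms by (simp add: zmod_int[symmetric])
  then have "int p dvd \<bar>int i - int j\<bar>" by (simp add: mod_eq_dvd_iff)
  then show ?thesis using int_dvd_int_iff[of p "nat \<bar>int i - int j\<bar>"] by simp
qed

text \<open>Distinct values differ by a nonzero integer of size at most \<open>Z\<close>, and the
  logarithms of its prime divisors add up to at most \<open>ln Z\<close>. The condition
  \<open>Q \<le> card I\<close> lets Chebyshev's bound reduce the diagonal to the term with
  \<open>ln 4\<close>.\<close>

lemma larger_sieve_primes: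
  fixes f :: "'i \<Rightarrow> nat" and Z :: real
  assumes I: "finite I" "inj_on f I" "\<And>i. i \<in> I \<Longrightarrow> f i \<le> Z" and Z: "Z \<ge> 1" and Q: "Q \<le> card I"
  shows "(\<Sum>p\<in>primes_in a Q. ln (real p) * collisions (\<lambda>i. f i mod p) I) \<le> (real (card I))\<^sup>2 * (ln Z + ln 4)"
proof -
  have "(\<Sum>p\<in>primes_in a Q. ln (real p) * collisions (\<lambda>i. f i mod p) I)
     \<le> (card I)\<^sup>2 * ln Z + card I * theta a Q"
  proof (rule larger_sieve)
    fix i j assume ij: "i \<in> I" "j \<in> I" "i \<noteq> j"
    then have ne: "f i \<noteq> f j" using I(2) by (auto simp: inj_on_def)
    then have "(\<Sum>p\<in>{p\<in>primes_in a Q. f i mod p = f j mod p}. ln (real p)) \<le> ln (real (nat \<bar>int (f i) - int (f j)\<bar>))"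
      by (intro sum_ln_primes_le) (auto dest: primes_inD mod_eq_imp_dvd_diff_nat)
    also have "\<dots> \<le> ln Z"
    proof (subst ln_le_cancel_iff)
      have "real (nat \<bar>int (f i) - int (f j)\<bar>) = \<bar>real (f i) - real (f j)\<bar>" by simp
      also have "\<dots> \<le> Z" using I(3)[OF ij(1)] I(3)[OF ij(2)] by simp
      finally show "real (nat \<bar>int (f i) - int (f j)\<bar>) \<le> Z" .
    qed (use ne Z in auto)
    finally show "(\<Sum>p\<in>{p\<in>primes_in a Q. f i mod p = f j mod p}. ln (real p)) \<le> ln Z" .
  qed (use I(1) Z in auto)
  moreover have "theta a Q \<le> ln 4 * real (card I)"
    by (rule order_trans[OF sum_ln_primes_in_le]) (use Q in auto)
  then have "card I * theta a Q \<le> card I * (ln 4 * real (card I))"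
    by (rule mult_left_mono) simp
  ultimately show ?thesis by (simp add: algebra_simps power2_eq_square)
qed

section \<open>Mertens' estimates for the sum of \<open>ln p / p\<close>\<close>

abbreviation lw :: "nat \<Rightarrow> real" where "lw p \<equiv> ln (real p) / real p"

abbreviation lw_sum :: "nat \<Rightarrow> nat \<Rightarrow> real" where
  "lw_sum a b \<equiv> \<Sum>p\<in>primes_in a b. lw p"

text \<open>The larger sieve read backwards: \<open>{..<n}\<close> meets at most \<open>p\<close>
  classes modulo \<open>p\<close>, so it has at least \<open>n\<^sup>2 / p\<close> collisions, and
  the upper bound for collisions becomes one for the prime sum.\<close>

lemma mertens_upper:
  assumes "n \<ge> 1"
  shows "lw_sum a n \<le> ln (real n) + ln 4"
proof -
  have 1: "(\<Sum>p\<in>primes_in a n. ln (real p) * collisions (\<lambda>i. i mod p) {..<n}) \<le> n\<^sup>2 * (ln n + ln 4)"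
    using larger_sieve_primes[of "{..<n}" "\<lambda>i. i" "real n" n a] assms by simp
  have "lw_sum a n * n\<^sup>2
      = (\<Sum>p\<in>primes_in a n. ln (real p) * ((card {..<n})\<^sup>2 / real p))"
    by (simp add: sum_distrib_right)
  also have "\<dots> \<le> (\<Sum>p\<in>primes_in a n. ln (real p) * collisions (\<lambda>i. i mod p) {..<n})"
  proof (intro sum_mono mult_left_mono)
    fix p assume p: "p \<in> primes_in a n"
    show "(card {..<n})\<^sup>2 / real p \<le> collisions (\<lambda>i. i mod p) {..<n}"
      using primes_inD[OF p] by (intro collisions_ge_card[where V = "{..<p}"]) auto
  qed (auto dest: primes_inD)
  finally have "lw_sum a n * n\<^sup>2 \<le> (ln n + ln 4) * n\<^sup>2"
    using 1 by (simp add: mult.commute)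
  then show ?thesis using assms by (simp add: mult_le_cancel_right)
qed

lemma ln_fact_ge:
  assumes "n \<ge> 1"
  shows "real n * ln (real n) - real n \<le> ln (fact n)"
  using assms
proof (induction n rule: nat_induct_at_least)
  case (Suc n)
  have "real n * (ln (real n + 1) - ln (real n)) = real n * ln (1 + 1 / real n)"
    using Suc ln_div[of "real n + 1" "real n"] by (simp add: add_divide_distrib)
  also have "\<dots> \<le> real n * (1 / real n)"
    using Suc by (intro mult_left_mono ln_add_one_self_le_self) auto
  finally have "real n * (ln (real n + 1) - ln (real n)) \<le> 1" using Suc by simp
  moreover have "ln (fact (Suc n)) = ln (real n + 1) + ln (fact n)"
    by (simp add: ln_mult add.commute)
  ultimately show ?case using Suc.IH by (simp add: algebra_simps)
qed auto

text \<open>Legendre's formula: the multiplicity counts the \<open>i \<ge> 1\<close> with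
  \<open>p ^ i dvd k\<close>, and the quotients \<open>n / p ^ i\<close> form a geometric
  series.\<close>

lemma sum_multiplicity_le:
  assumes "prime p"
  shows "real (\<Sum>k=1..n. multiplicity p k) \<le> real n / (real p - 1)"
proof -
  have p2: "p \<ge> 2" using assms by (simp add: prime_ge_2_nat)
  have mult: "multiplicity p k = card {i\<in>{1..n}. p ^ i dvd k}" if "k \<in> {1..n}" for k
  proof -
    have "{i\<in>{1..n}. p ^ i dvd k} = {1..multiplicity p k}"
    proof -
      have "i \<le> n" if "i \<le> multiplicity p k" for i
      proof -
        have "p ^ i dvd k" using that by (rule multiplicity_dvd')
        then have "p ^ i \<le> n" using \<open>k \<in> {1..n}\<close> by (auto dest: dvd_imp_le)
        moreover have "i < p ^ i" using p2 by (intro power_gt_expt) auto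
        ultimately show ?thesis by simp
      qed
      moreover have "i \<le> multiplicity p k" if "p ^ i dvd k" for i
        using that \<open>k \<in> {1..n}\<close> p2 by (intro multiplicity_geI) auto
      ultimately show ?thesis using multiplicity_dvd' by auto
    qed
    then show ?thesis by simp
  qed
  have "(\<Sum>k=1..n. multiplicity p k) = (\<Sum>k=1..n. card {i\<in>{1..n}. p ^ i dvd k})"
    by (intro sum.cong refl mult)
  also have "\<dots> = (\<Sum>i=1..n. card {k\<in>{1..n}. p ^ i dvd k})"
    using sum_multicount_gen[of "{1..n}" "{1..n}" "\<lambda>k i. p ^ i dvd k" "\<lambda>i. card {k\<in>{1..n}. p ^ i dvd k}"]
    by simp
  also have "real \<dots> \<le> (\<Sum>i=1..n. real n * (1 / real p) ^ i)"
  proof (subst of_nat_sum, intro sum_mono)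
    fix i
    have "{k\<in>{1..n}. p ^ i dvd k} \<subseteq> (\<lambda>j. p ^ i * j) ` {1..n div p ^ i}"
      using p2 by (auto elim!: dvdE simp: less_eq_div_iff_mult_less_eq mult.commute intro!: imageI)
    then have "card {k\<in>{1..n}. p ^ i dvd k} \<le> card ((\<lambda>j. p ^ i * j) ` {1..n div p ^ i})"
      by (intro card_mono) auto
    also have "\<dots> \<le> n div p ^ i"
      using card_image_le[of "{1..n div p ^ i}" "\<lambda>j. p ^ i * j"] by simp
    finally have "card {k\<in>{1..n}. p ^ i dvd k} \<le> n div p ^ i" .
    then have "real (card {k\<in>{1..n}. p ^ i dvd k}) \<le> real n / real (p ^ i)"
      using of_nat_div_le_of_nat[of n "p ^ i", where 'a = real] by linarith
    then show "real (card {k\<in>{1..n}. p ^ i dvd k}) \<le> real n * (1 / real p) ^ i"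
      by (simp add: power_one_over)
  qed
  also have "\<dots> \<le> real n / (real p - 1)"
  proof -
    have "(\<Sum>i=1..n. (1 / real p) ^ i) * (real p - 1) = 1 - (1 / real p) ^ n"
    proof (induction n)
      case (Suc n)
      have "(1 / real p) ^ Suc n * (real p - 1) = (1 / real p) ^ n - (1 / real p) ^ Suc n"
        using p2 by (simp add: field_simps)
      then show ?case using Suc by (simp add: distrib_right)
    qed auto
    also have "\<dots> \<le> 1" by simp
    finally have "(\<Sum>i=1..n. (1 / real p) ^ i) \<le> 1 / (real p - 1)"
      using p2 by (simp add: pos_le_divide_eq)
    then have "real n * (\<Sum>i=1..n. (1 / real p) ^ i) \<le> real n * (1 / (real p - 1))"
      by (intro mult_left_mono) auto
    then show ?thesis by (simp add: sum_distrib_left)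
  qed
  finally show ?thesis .
qed

lemma ln_fact_eq_sum_primes:
  "ln (fact n :: real) = (\<Sum>p\<in>primes_in 0 n. real (\<Sum>k=1..n. multiplicity p k) * ln (real p))"
proof -
  have "ln (fact n :: real) = (\<Sum>k=1..n. ln (real k))"
    by (induction n) (simp_all add: ln_mult add.commute)
  also have "\<dots> = (\<Sum>k=1..n. \<Sum>p\<in>primes_in 0 n. real (multiplicity p k) * ln (real p))"
  proof (intro sum.cong refl)
    fix k assume k: "k \<in> {1..n}"
    have "real k = (\<Prod>p\<in>prime_factors k. real p ^ multiplicity p k)"
      using arg_cong[OF prod_prime_factors[of k], of real] k by simp
    then have "ln (real k) = ln (\<Prod>p\<in>prime_factors k. real p ^ multiplicity p k)" by simp
    also have "\<dots> = (\<Sum>p\<in>prime_factors k. real (multiplicity p k) * ln (real p))"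
      by (subst ln_prod) (auto simp: ln_realpow in_prime_factors_iff prime_gt_0_nat)
    also have "\<dots> = (\<Sum>p\<in>primes_in 0 n. real (multiplicity p k) * ln (real p))"
    proof (rule sum.mono_neutral_left)
      show "prime_factors k \<subseteq> primes_in 0 n"
        using k by (auto simp: primes_in_def in_prime_factors_iff prime_gt_0_nat dest!: dvd_imp_le)
      show "\<forall>p\<in>primes_in 0 n - prime_factors k. real (multiplicity p k) * ln (real p) = 0"
        using k by (auto simp: primes_in_def in_prime_factors_iff not_dvd_imp_multiplicity_0)
    qed auto
    finally show "ln (real k) = (\<Sum>p\<in>primes_in 0 n. real (multiplicity p k) * ln (real p))" .
  qed
  also have "\<dots> = (\<Sum>p\<in>primes_in 0 n. \<Sum>k=1..n. real (multiplicity p k) * ln (real p))"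
    by (rule sum.swap)
  finally show ?thesis by (simp add: sum_distrib_right)
qed

lemma summable_ln_over_mult: "summable (\<lambda>k. ln (real k) / (real k * (real k - 1)))"
proof (rule summable_comparison_test_bigo)
  show "summable (\<lambda>k. norm (real k powr (-3/2)))"
    by (simp add: summable_real_powr_iff)
  show "(\<lambda>k. ln (real k) / (real k * (real k - 1))) \<in> O(\<lambda>k. real k powr (-3/2))"
    by real_asymp
qed

text \<open>Compare Stirling's lower bound for \<open>ln (fact n)\<close> with its prime
  factorization; replacing \<open>1 / (p - 1)\<close> by \<open>1 / p\<close> costs a convergent
  sum.\<close>

lemma mertens_lower:
  obtains C where "C > 0" "\<And>n. n \<ge> 1 \<Longrightarrow> ln (real n) - C \<le> lw_sum 0 n"
proof -
  define T where "T = (\<Sum>k. ln (real k) / (real k * (real k - 1)))"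
  have nonneg: "0 \<le> ln (real k) / (real k * (real k - 1))" for k
    by (cases "k = 0") auto
  have "ln (real n) - (1 + \<bar>T\<bar>) \<le> lw_sum 0 n" if n: "n \<ge> 1" for n
  proof -
    have "real n * ln (real n) - real n \<le> ln (fact n)" by (rule ln_fact_ge[OF n])
    also have "\<dots> = (\<Sum>p\<in>primes_in 0 n. real (\<Sum>k=1..n. multiplicity p k) * ln (real p))"
      by (rule ln_fact_eq_sum_primes)
    also have "\<dots> \<le> (\<Sum>p\<in>primes_in 0 n. real n / (real p - 1) * ln (real p))"
      using primes_inD by (intro sum_mono mult_right_mono sum_multiplicity_le) (auto simp: less_imp_le)
    also have "\<dots> = real n * (\<Sum>p\<in>primes_in 0 n. lw p + ln (real p) / (real p * (real p - 1)))"
      unfolding sum_distrib_left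
    proof (intro sum.cong refl)
      fix p assume "p \<in> primes_in 0 n"
      then have "p \<ge> 2" by (rule primes_inD)
      then have "real p - 1 > 0" "real p > 0" by auto
      then show "real n / (real p - 1) * ln (real p)
         = real n * (lw p + ln (real p) / (real p * (real p - 1)))"
        by (simp add: divide_simps) (simp add: algebra_simps)
    qed
    finally have "real n * (ln (real n) - 1) \<le> real n * (\<Sum>p\<in>primes_in 0 n. lw p + ln (real p) / (real p * (real p - 1)))"
      by (simp add: algebra_simps)
    then have "ln (real n) - 1 \<le> (\<Sum>p\<in>primes_in 0 n. lw p + ln (real p) / (real p * (real p - 1)))"
      using n by (simp add: mult_le_cancel_left)
    moreover have "(\<Sum>p\<in>primes_in 0 n. ln (real p) / (real p * (real p - 1))) \<le> T"
      unfolding T_def using nonneg summable_ln_over_mult by (intro sum_le_suminf) auto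
    ultimately show ?thesis by (simp add: sum.distrib)
  qed
  then show ?thesis using that[of "1 + \<bar>T\<bar>"] by auto
qed

lemma mertens_lower_from:
  obtains C where "\<And>n. n \<ge> 1 \<Longrightarrow> ln (real n) - C \<le> lw_sum a n"
proof -
  obtain C where C: "\<And>n. n \<ge> 1 \<Longrightarrow> ln (real n) - C \<le> lw_sum 0 n"
    using mertens_lower by blast
  have "ln (real n) - (C + lw_sum 0 a) \<le> lw_sum a n" if "n \<ge> 1" for n
  proof -
    have "lw_sum 0 n \<le> (\<Sum>p\<in>primes_in 0 a \<union> primes_in a n. lw p)"
      by (intro sum_mono2) (auto simp: primes_in_def)
    also have "\<dots> = lw_sum 0 a + lw_sum a n"
      by (intro sum.union_disjoint) (auto simp: primes_in_def)
    finally show ?thesis using C[OF that] by simp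
  qed
  then show ?thesis by (rule that)
qed

section \<open>Quadratic characters at primes\<close>

definition qchar :: "nat \<Rightarrow> nat \<Rightarrow> real" where
  "qchar m p = real_of_int (Legendre (int m) (int p))"

abbreviation qsum :: "nat \<Rightarrow> nat \<Rightarrow> nat \<Rightarrow> real" where
  "qsum m a b \<equiv> \<Sum>p\<in>primes_in a b. qchar m p * lw p"

lemma qchar_range: "qchar m p \<in> {-1, 0, 1}"
  by (simp add: qchar_def Legendre_def)

lemma qchar_bounds: "-1 \<le> qchar m p" "qchar m p \<le> 1"
  using qchar_range[of m p] by auto

lemma qchar_eq_0_iff: "qchar m p = 0 \<longleftrightarrow> p dvd m"
  by (simp add: qchar_def Legendre_def cong_0_iff)

text \<open>Modulo \<open>p\<close> the form splits into the factors \<open>X - r * Y\<close> and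
  \<open>X + r * Y\<close>, one for each prime ideal above \<open>p\<close>. If both vanish, then
  \<open>p\<close> divides \<open>X\<close> and \<open>Y\<close>, because \<open>p\<close> is odd
  and does not divide \<open>m\<close>, and the form is divisible by
  \<open>p\<^sup>2\<close>.\<close>

lemma prime_pow_dvd_norm_form:
  fixes X Y r :: int and p m :: nat
  assumes p: "prime p" "p > 2" "\<not> p dvd m" and r: "[r\<^sup>2 = int m] (mod int p)"
  shows "p ^ card {s\<in>{1, -1}. int p dvd X - s * r * Y} dvd nat \<bar>X\<^sup>2 - int m * Y\<^sup>2\<bar>"
proof -
  let ?S = "{s\<in>{1, -1}. int p dvd X - s * r * Y}"
  have "int p dvd r\<^sup>2 - int m" using r by (simp add: cong_iff_dvd_diff)
  then have "int p dvd (r\<^sup>2 - int m) * Y\<^sup>2" by simp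
  moreover have "X\<^sup>2 - int m * Y\<^sup>2 = (X - 1 * r * Y) * (X - (-1) * r * Y) + (r\<^sup>2 - int m) * Y\<^sup>2"
    by (simp add: algebra_simps power2_eq_square)
  ultimately have one: "int p dvd X\<^sup>2 - int m * Y\<^sup>2" if "int p dvd X - s * r * Y" "s \<in> {1, -1}" for s
    using that by (metis (no_types, lifting) dvd_add dvd_mult dvd_mult2 insertE singletonD)
  have pi: "prime (int p)" using p by simp
  consider "?S = {1, -1}" | "?S = {}" | s where "?S = {s}" by auto
  then have "int p ^ card ?S dvd X\<^sup>2 - int m * Y\<^sup>2"
  proof cases
    case 1
    then have d: "int p dvd X - 1 * r * Y" "int p dvd X - (-1) * r * Y" by blast+
    have "int p dvd (X - 1 * r * Y) + (X - (-1) * r * Y)" using d by (rule dvd_add)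
    then have "int p dvd 2 * X" by simp
    moreover have "\<not> int p dvd 2" using p(2) by (auto dest: zdvd_imp_le)
    ultimately have X: "int p dvd X" using pi by (simp add: prime_dvd_mult_iff)
    have "int p dvd X - r * Y" using d(1) by simp
    with X have "int p dvd X - (X - r * Y)" by (rule dvd_diff)
    moreover have "X - (X - r * Y) = r * Y" by simp
    ultimately have "int p dvd r * Y" by (simp only:)
    moreover have "\<not> int p dvd r"
    proof
      assume "int p dvd r"
      then have "int p dvd r\<^sup>2" by (simp add: power2_eq_square)
      then have "int p dvd r\<^sup>2 - (r\<^sup>2 - int m)" using \<open>int p dvd r\<^sup>2 - int m\<close> by (rule dvd_diff)
      then show False using p(3) by simp
    qed
    ultimately have Y: "int p dvd Y" using pi by (simp add: prime_dvd_mult_iff)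
    have "(int p)\<^sup>2 dvd X\<^sup>2 - int m * Y\<^sup>2" using X Y by (intro dvd_diff dvd_mult dvd_power_same)
    moreover have "card ?S = 2" unfolding 1 by simp
    ultimately show ?thesis by simp
  next
    case 2
    show ?thesis unfolding 2 by simp
  next
    case (3 s)
    then have "s \<in> ?S" by simp
    then show ?thesis using 3 one[of s] by simp
  qed
  then have "int (p ^ card ?S) dvd \<bar>X\<^sup>2 - int m * Y\<^sup>2\<bar>" by simp
  then show ?thesis using int_dvd_int_iff[of "p ^ card ?S" "nat \<bar>X\<^sup>2 - int m * Y\<^sup>2\<bar>"] by simp
qed

lemma norm_form_nonzero:
  fixes X Y :: int and m :: nat
  assumes "\<And>c. m \<noteq> c\<^sup>2" "(X, Y) \<noteq> (0, 0)"
  shows "X\<^sup>2 - int m * Y\<^sup>2 \<noteq> 0"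
proof
  assume eq: "X\<^sup>2 - int m * Y\<^sup>2 = 0"
  show False
  proof (cases "Y = 0")
    case False
    have "Y\<^sup>2 dvd X\<^sup>2" using eq by simp
    then have "Y dvd X" by simp
    then obtain q where "X = Y * q" by (elim dvdE)
    then have "q\<^sup>2 = int m" using eq False by (simp add: power_mult_distrib)
    then have "int ((nat \<bar>q\<bar>)\<^sup>2) = int m" by simp
    then have "m = (nat \<bar>q\<bar>)\<^sup>2" by (simp only: of_nat_eq_iff)
    then show False using assms(1) by blast
  qed (use eq assms in auto)
qed

text \<open>The larger sieve applied to the points of a box, reduced modulo the prime ideals
  \<open>(p, x - r y)\<close> of \<open>\<rat>(sqrt m)\<close>: a difference of two points lying in several of these ideals has large
  norm.\<close>

lemma sum_split_primes_le:
  fixes m K :: nat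
  assumes m: "m > 0" "\<And>c. m \<noteq> c\<^sup>2" and K: "K \<ge> 1"
  defines "G \<equiv> {p\<in>primes_in 2 (K\<^sup>2). \<not> p dvd m \<and> QuadRes (int p) (int m)}"
  shows "(\<Sum>p\<in>G. 2 * lw p) \<le> ln (real m) + ln (real (K\<^sup>2)) + 2 * ln 4"
proof -
  have finG: "finite G" by (auto simp: G_def)
  have "\<exists>r. p \<in> G \<longrightarrow> [r\<^sup>2 = int m] (mod int p)" for p
    by (auto simp: G_def QuadRes_def)
  then obtain r where r: "\<And>p. p \<in> G \<Longrightarrow> [(r p)\<^sup>2 = int m] (mod int p)" by metis
  define I where "I = {..<K} \<times> {..<K}"
  define P where "P = G \<times> {1, -1::int}"
  \<comment> \<open>The sign \<open>s\<close> selects one of the two ideals above \<open>p\<close>.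
    Although the box has two dimensions, each reduction takes at most \<open>p\<close>
    values.\<close>
  define f where "f = (\<lambda>(p, s) (x, y). (int x - s * r p * int y) mod int p)"
  define w where "w = (\<lambda>(p, s::int). ln (real p))"
  have cardI: "card I = K\<^sup>2" by (simp add: I_def power2_eq_square)
  have w_sum: "(\<Sum>p\<in>P. w p * g (fst p)) = (\<Sum>p\<in>G. 2 * ln (real p) * g p)" for g :: "nat \<Rightarrow> real"
    unfolding P_def w_def
    by (subst sum.cartesian_product') (auto intro!: sum.cong)
  have Gprime: "prime p" "p > 2" "\<not> p dvd m" "0 < ln (real p)" "p > 0" if "p \<in> G" for p
    using that by (auto simp: G_def dest: primes_inD)
  have "1 \<le> m * K\<^sup>2" using m(1) K by simp
  then have L0: "0 \<le> ln (real (m * K\<^sup>2))" by (simp only: ln_ge_zero of_nat_mono[of 1, simplified])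
  have "(\<Sum>p\<in>P. w p * collisions (f p) I) \<le> (card I)\<^sup>2 * ln (real (m * K\<^sup>2)) + card I * (\<Sum>p\<in>P. w p)"
  proof (rule larger_sieve)
    fix i j assume ij: "i \<in> I" "j \<in> I" "i \<noteq> j"
    obtain x y x' y' where eq: "i = (x, y)" "j = (x', y')" by (cases i, cases j)
    define X Y where "X = int x - int x'" and "Y = int y - int y'"
    have XY: "(X, Y) \<noteq> (0, 0)" using ij(3) by (auto simp: eq X_def Y_def)
    have b: "\<bar>X\<bar> \<le> int K" "\<bar>Y\<bar> \<le> int K" using ij by (auto simp: eq I_def X_def Y_def)
    define e where "e = (\<lambda>p. card {s\<in>{1, -1}. int p dvd X - s * r p * Y})"
    define N where "N = nat \<bar>X\<^sup>2 - int m * Y\<^sup>2\<bar>"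
    have N0: "N > 0" using norm_form_nonzero[OF m(2) XY] by (simp add: N_def)
    have iff: "f (p, s) i = f (p, s) j \<longleftrightarrow> int p dvd X - s * r p * Y" for p s
    proof -
      have "(int x - s * r p * int y) - (int x' - s * r p * int y') = X - s * r p * Y"
        by (simp add: X_def Y_def algebra_simps)
      then show ?thesis by (simp add: f_def eq mod_eq_dvd_iff)
    qed
    have "{p\<in>P. f p i = f p j} = (SIGMA p:G. {s\<in>{1, -1}. int p dvd X - s * r p * Y})"
      by (auto simp: P_def iff)
    then have "(\<Sum>p\<in>{p\<in>P. f p i = f p j}. w p)
        = (\<Sum>p\<in>G. \<Sum>s\<in>{s\<in>{1, -1}. int p dvd X - s * r p * Y}. ln (real p))"
      using finG by (subst sum.Sigma) (auto simp: w_def)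
    also have "\<dots> = (\<Sum>p\<in>G. real (e p) * ln (real p))" by (simp add: e_def)
    also have "\<dots> \<le> ln (real N)"
    proof (rule sum_ln_prime_powers_le[OF finG])
      fix p assume "p \<in> G"
      then show "p ^ e p dvd N" "prime p"
        unfolding e_def N_def using Gprime r prime_pow_dvd_norm_form by blast+
    qed (rule N0)
    \<comment> \<open>The two nonnegative terms of the norm are subtracted, so it is bounded by the
      larger of them.\<close>
    also have "\<dots> \<le> ln (real (m * K\<^sup>2))"
    proof -
      have "X\<^sup>2 \<le> (int K)\<^sup>2" "Y\<^sup>2 \<le> (int K)\<^sup>2" using b abs_le_square_iff[of X "int K"] abs_le_square_iff[of Y "int K"] by auto
      moreover have "(int K)\<^sup>2 \<le> int m * (int K)\<^sup>2" using m(1) by (simp add: mult_le_cancel_right1)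
      moreover have "int m * Y\<^sup>2 \<le> int m * (int K)\<^sup>2" using calculation(2) by (intro mult_left_mono) auto
      moreover have "0 \<le> int m * Y\<^sup>2" "0 \<le> X\<^sup>2" by auto
      ultimately have "\<bar>X\<^sup>2 - int m * Y\<^sup>2\<bar> \<le> int m * (int K)\<^sup>2" by linarith
      then have "N \<le> m * K\<^sup>2" unfolding N_def by (simp add: nat_le_iff)
      then show ?thesis using N0 m(1) K by (subst ln_le_cancel_iff) (auto simp del: of_nat_mult of_nat_power)
    qed
    finally show "(\<Sum>p\<in>{p\<in>P. f p i = f p j}. w p) \<le> ln (real (m * K\<^sup>2))" .
  qed (use finG L0 in \<open>auto simp: I_def P_def\<close>)
  moreover have "(\<Sum>p\<in>P. w p * ((real (card I))\<^sup>2 / real (fst p))) \<le> (\<Sum>p\<in>P. w p * collisions (f p) I)"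
  proof (intro sum_mono mult_left_mono)
    fix p assume p: "p \<in> P"
    then have g: "fst p > 0" "0 < ln (real (fst p))" using Gprime by (auto simp: P_def)
    show "0 \<le> w p" using g by (simp add: w_def case_prod_beta)
    have "real ((card I)\<^sup>2) / real (fst p) \<le> collisions (f p) I"
      using g by (intro collisions_ge_card[where V = "{0..<int (fst p)}"]) (auto simp: f_def I_def case_prod_beta)
    then show "(real (card I))\<^sup>2 / real (fst p) \<le> collisions (f p) I" by simp
  qed
  moreover have "(\<Sum>p\<in>P. w p) \<le> 2 * (ln 4 * K\<^sup>2)"
  proof -
    have "(\<Sum>p\<in>P. w p) = 2 * (\<Sum>p\<in>G. ln (real p))"
      using w_sum[of "\<lambda>_. 1"] by (simp add: sum_distrib_left)
    moreover have "(\<Sum>p\<in>G. ln (real p)) \<le> theta 2 (K\<^sup>2)"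
      by (rule sum_mono2) (auto simp: G_def intro: less_imp_le primes_inD)
    ultimately show ?thesis using sum_ln_primes_in_le[of 2 "K\<^sup>2"] by simp
  qed
  ultimately have "(\<Sum>p\<in>G. 2 * ln (real p) * ((real (card I))\<^sup>2 / real p))
      \<le> (card I)\<^sup>2 * ln (real (m * K\<^sup>2)) + card I * (2 * (ln 4 * K\<^sup>2))"
    using w_sum[of "\<lambda>p. (real (card I))\<^sup>2 / real p"] mult_left_mono[of "sum w P" "2 * (ln 4 * K\<^sup>2)" "real (card I)"] by simp
  also have "\<dots> = (real (card I))\<^sup>2 * (ln (real m) + ln (real (K\<^sup>2)) + 2 * ln 4)"
    using m K by (simp add: cardI ln_mult algebra_simps power2_eq_square)
  finally have "(real (card I))\<^sup>2 * (\<Sum>p\<in>G. 2 * lw p)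
     \<le> (real (card I))\<^sup>2 * (ln (real m) + ln (real (K\<^sup>2)) + 2 * ln 4)"
    by (simp add: sum_distrib_left mult_ac)
  then show ?thesis using K by (simp add: cardI mult_le_cancel_left_pos del: of_nat_power)
qed

text \<open>The factor \<open>1 + qchar m p\<close> is 2 at odd split primes, which the sieve in
  \<open>\<rat>(sqrt m)\<close> controls, 0 at inert ones, and 1 at the divisors of
  \<open>m\<close>, which contribute at most \<open>ln m\<close>. Compared with Mertens' lower bound
  this says that the sum of \<open>qchar m p * lw p\<close> is at most
  \<open>2 * ln m + O(1)\<close>, however long the range.\<close>

lemma sum_qchar_le:
  fixes m n :: nat
  assumes m: "m > 0" "\<And>c. m \<noteq> c\<^sup>2" and n: "n \<ge> 1"
  shows "(\<Sum>p\<in>primes_in 0 n. (1 + qchar m p) * lw p) \<le> ln (real n) + 2 * ln (real m) + 4 * ln 4"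
proof -
  \<comment> \<open>The side of the box: \<open>K\<^sup>2\<close> has to reach \<open>n\<close> to
    cover all primes, and exceeds it at most by a factor 4, which costs one
    \<open>ln 4\<close>.\<close>
  define K where "K = nat \<lceil>sqrt (real n)\<rceil>"
  have sq1: "sqrt (real n) \<ge> 1" using n by simp
  have Kr: "real K \<ge> sqrt (real n)" "real K \<le> sqrt (real n) + 1" unfolding K_def using sq1 by linarith+
  then have K1: "K \<ge> 1" using sq1 by linarith
  have Kr2: "real K \<le> 2 * sqrt (real n)" using Kr(2) sq1 by linarith
  have "(sqrt (real n))\<^sup>2 \<le> (real K)\<^sup>2" using Kr(1) by (intro power_mono) auto
  then have "real n \<le> real (K\<^sup>2)" by simp
  then have nK: "n \<le> K\<^sup>2" by (simp only: of_nat_le_iff)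
  have "(real K)\<^sup>2 \<le> (2 * sqrt (real n))\<^sup>2" using Kr2 by (intro power_mono) auto
  then have Kn: "real (K\<^sup>2) \<le> 4 * real n" by (simp add: power_mult_distrib)
  define G where "G = {p\<in>primes_in 2 (K\<^sup>2). \<not> p dvd m \<and> QuadRes (int p) (int m)}"
  have "(\<Sum>p\<in>primes_in 0 n. (1 + qchar m p) * lw p)
     \<le> (\<Sum>p\<in>primes_in 0 n. (if p \<in> G then 2 * lw p else 0) + (if p dvd m then ln (real p) else 0) + (if p = 2 then ln 2 else 0))"
  proof (intro sum_mono)
    fix p assume p: "p \<in> primes_in 0 n"
    have lp: "lw p \<ge> 0" "lw p \<le> ln (real p)" "ln (real p) > 0" using primes_inD[OF p] by (auto simp: field_simps mult_le_cancel_left1)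
    have up: "(1 + qchar m p) * lw p \<le> 2 * lw p" using qchar_bounds[of m p] lp by (intro mult_right_mono) auto
    consider "p dvd m" | "\<not> p dvd m" "p = 2" | "p \<in> G" "\<not> p dvd m" | "p \<notin> G" "\<not> p dvd m" "p \<noteq> 2" by blast
    then show "(1 + qchar m p) * lw p \<le> (if p \<in> G then 2 * lw p else 0) + (if p dvd m then ln (real p) else 0) + (if p = 2 then ln 2 else 0)"
    proof cases
      case 1
      then have "qchar m p = 0" by (simp add: qchar_eq_0_iff)
      then show ?thesis using 1 lp by (simp add: G_def)
    next
      case 2
      have "(1 + qchar m p) * lw p \<le> ln 2" using up 2 by simp
      then show ?thesis using 2 lp by (auto simp: G_def)
    next
      case 3
      then show ?thesis using up by auto
    next
      case 4
      then have "\<not> QuadRes (int p) (int m)" using primes_inD[OF p] p nK by (auto simp: G_def primes_in_def)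
      then have "qchar m p = -1" using 4 by (simp add: qchar_def Legendre_def cong_0_iff)
      then show ?thesis using 4 by simp
    qed
  qed
  also have "\<dots> = (\<Sum>p\<in>primes_in 0 n. if p \<in> G then 2 * lw p else 0) + (\<Sum>p\<in>primes_in 0 n. if p dvd m then ln (real p) else 0)
      + (\<Sum>p\<in>primes_in 0 n. if p = 2 then ln 2 else 0)" by (simp add: sum.distrib)
  also have "(\<Sum>p\<in>primes_in 0 n. if p \<in> G then 2 * lw p else 0) = (\<Sum>p\<in>primes_in 0 n \<inter> G. 2 * lw p)"
    by (simp only: sum.inter_restrict[OF finite_primes_in])
  also have "\<dots> \<le> (\<Sum>p\<in>G. 2 * lw p)"
    by (rule sum_mono2) (auto simp: G_def dest: primes_inD)
  also have "\<dots> \<le> ln (real m) + ln (real (K\<^sup>2)) + 2 * ln 4"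
    unfolding G_def by (rule sum_split_primes_le[OF m K1])
  also have "ln (real (K\<^sup>2)) \<le> ln 4 + ln (real n)"
  proof -
    have "ln (real (K\<^sup>2)) \<le> ln (4 * real n)" using Kn K1 n by (subst ln_le_cancel_iff) auto
    then show ?thesis using n by (simp add: ln_mult)
  qed
  also have "(\<Sum>p\<in>primes_in 0 n. if p dvd m then ln (real p) else 0) = (\<Sum>p\<in>{p\<in>primes_in 0 n. p dvd m}. ln (real p))"
    by (simp add: sum.inter_filter)
  also have "\<dots> \<le> ln (real m)"
    by (rule sum_ln_primes_le) (auto simp: m dest: primes_inD)
  also have "(\<Sum>p\<in>primes_in 0 n. if p = 2 then ln 2 else 0) \<le> ln (4::real)"
    by (simp add: sum.delta)
  finally show ?thesis by simp
qed

text \<open>Up to \<open>z ^ 4\<close> the sum of \<open>(1 - qchar m p) * lw p\<close> is at least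
  \<open>4 * ln z - O(1)\<close>, and the primes up to \<open>z\<close> account for at most
  \<open>2 * ln z + O(1)\<close> of it; an exponent above 2 is what makes the window rich enough. In
  the window a non-residue contributes \<open>2 * lw p \<le> 8 * ln z / p\<close>, whence the 1/8.
  Since the bound does not depend on \<open>z\<close>, disjoint windows can be stacked.\<close>

lemma sum_nonresidues_window:
  fixes m :: nat
  assumes m: "m > 0" "\<And>c. m \<noteq> c\<^sup>2"
  shows "\<forall>\<^sub>F z in sequentially. 1/8 \<le> (\<Sum>p\<in>{p\<in>primes_in z (z^4). qchar m p = -1}. 1 / real p)"
proof -
  obtain C where C: "C > 0" "\<And>n. n \<ge> 1 \<Longrightarrow> ln (real n) - C \<le> lw_sum 0 n"
    using mertens_lower by blast
  define B where "B = 2 * ln (real m) + 6 * ln 4 + 2 * C"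
  have "\<forall>\<^sub>F z in sequentially. ln (real z) \<ge> B"
    by real_asymp
  moreover have "\<forall>\<^sub>F z in sequentially. z \<ge> max m 2" by (rule eventually_ge_at_top)
  ultimately show ?thesis
  proof eventually_elim
    case (elim z)
    let ?c = "\<lambda>p. (1 - qchar m p) * lw p"
    have z: "z \<ge> 1" "z ^ 4 \<ge> 1" "z \<le> z ^ 4" "ln (real (z ^ 4)) = 4 * ln (real z)" "ln (real z) > 0" "z \<ge> m"
      using elim by (auto simp: ln_realpow self_le_power)
    define S1 S2 where "S1 = lw_sum 0 (z^4)" and "S2 = (\<Sum>p\<in>primes_in 0 (z^4). (1 + qchar m p) * lw p)"
    have "(\<Sum>p\<in>primes_in 0 (z^4). ?c p) = 2 * S1 - S2"
      by (simp add: S1_def S2_def sum_distrib_left algebra_simps sum.distrib sum_subtractf add_divide_distrib diff_divide_distrib)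
    moreover have "\<dots> \<ge> 2 * (4 * ln (real z) - C) - (4 * ln (real z) + 2 * ln (real m) + 4 * ln 4)"
      using C(2)[OF z(2)] sum_qchar_le[OF m z(2)] unfolding z(4) S1_def[symmetric] S2_def[symmetric] by argo
    moreover have "(\<Sum>p\<in>primes_in 0 z. ?c p) \<le> 2 * (ln (real z) + ln 4)"
    proof -
      have "(\<Sum>p\<in>primes_in 0 z. ?c p) \<le> (\<Sum>p\<in>primes_in 0 z. 2 * lw p)"
      proof (intro sum_mono mult_right_mono)
        fix p assume "p \<in> primes_in 0 z"
        then show "0 \<le> lw p" by (auto dest: primes_inD)
        show "1 - qchar m p \<le> 2" using qchar_bounds(1)[of m p] by simp
      qed
      also have "\<dots> = 2 * lw_sum 0 z" by (simp add: sum_distrib_left)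
      finally show ?thesis using mertens_upper[OF z(1), of 0] by argo
    qed
    moreover have "(\<Sum>p\<in>primes_in 0 (z^4). ?c p) = (\<Sum>p\<in>primes_in 0 z. ?c p) + (\<Sum>p\<in>primes_in z (z^4). ?c p)"
      using z by (intro sum_primes_in_split) auto
    ultimately have "2 * ln (real z) - B \<le> (\<Sum>p\<in>primes_in z (z^4). ?c p)"
      unfolding B_def by (simp add: algebra_simps)
    then have "ln (real z) \<le> (\<Sum>p\<in>primes_in z (z^4). ?c p)" using elim by simp
    also have "\<dots> \<le> (\<Sum>p\<in>primes_in z (z^4). if qchar m p = -1 then 8 * ln (real z) * (1 / real p) else 0)"
    proof (intro sum_mono)
      fix p assume p: "p \<in> primes_in z (z^4)"
      have "\<not> p dvd m" using primes_inD[OF p] z(6) m(1) by (auto dest: dvd_imp_le)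
      then have "qchar m p = 1 \<or> qchar m p = -1" using qchar_range[of m p] qchar_eq_0_iff[of m p] by auto
      moreover have "ln (real p) \<le> 4 * ln (real z)"
        unfolding z(4)[symmetric] using primes_inD[OF p] z(1) by (subst ln_le_cancel_iff) (auto simp del: of_nat_power)
      ultimately show "?c p \<le> (if qchar m p = -1 then 8 * ln (real z) * (1 / real p) else 0)"
        by (auto intro!: divide_right_mono)
    qed
    also have "\<dots> = (\<Sum>p\<in>{p\<in>primes_in z (z^4). qchar m p = -1}. 8 * ln (real z) * (1 / real p))"
      by (simp only: sum.inter_filter[OF finite_primes_in])
    also have "\<dots> = 8 * ln (real z) * (\<Sum>p\<in>{p\<in>primes_in z (z^4). qchar m p = -1}. 1 / real p)"
      by (simp add: sum_distrib_left)
    finally have "ln (real z) * 1 \<le> ln (real z) * (8 * (\<Sum>p\<in>{p\<in>primes_in z (z^4). qchar m p = -1}. 1 / real p))"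
      by (simp add: mult_ac)
    then show ?case using z(5) by (subst (asm) mult_le_cancel_left_pos) auto
  qed
qed

section \<open>Brun's sieve\<close>

definition esym :: "('a \<Rightarrow> real) \<Rightarrow> 'a set \<Rightarrow> nat \<Rightarrow> real" where
  "esym x P i = (\<Sum>T\<in>{T\<in>Pow P. card T = i}. prod x T)"

lemma esym_0 [simp]: "finite P \<Longrightarrow> esym x P 0 = 1"
proof -
  assume "finite P"
  then have "{T\<in>Pow P. card T = 0} = {{}}" by (auto simp: card_eq_0_iff dest: finite_subset)
  then show ?thesis by (simp add: esym_def)
qed

lemma esym_empty: "esym x {} i = (if i = 0 then 1 else 0)"
proof -
  have eq: "{T\<in>Pow {}. card T = i} = (if i = 0 then {{}} else {})" by auto
  show ?thesis unfolding esym_def eq by simp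
qed

lemma esym_insert:
  assumes "finite P" "a \<notin> P"
  shows "esym x (insert a P) (Suc i) = esym x P (Suc i) + x a * esym x P i"
proof -
  have fin: "finite T" if "T \<subseteq> P" for T using assms(1) that finite_subset by blast
  have eq: "{T\<in>Pow (insert a P). card T = Suc i} = {T\<in>Pow P. card T = Suc i} \<union> insert a ` {T\<in>Pow P. card T = i}"
    (is "?L = ?R")
  proof (intro equalityI subsetI)
    fix T assume T: "T \<in> ?L"
    then have finT: "finite T" using assms(1) by (auto dest: finite_subset)
    show "T \<in> ?R"
    proof (cases "a \<in> T")
      case True
      then have "T = insert a (T - {a})" "card (T - {a}) = i" "T - {a} \<subseteq> P" using T finT by auto
      then show ?thesis by blast
    next
      case False
      then show ?thesis using T by auto
    qed
  next
    fix T assume "T \<in> ?R"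
    then show "T \<in> ?L"
    proof
      assume "T \<in> insert a ` {T\<in>Pow P. card T = i}"
      then obtain S where S: "S \<subseteq> P" "card S = i" "T = insert a S" by auto
      then have "a \<notin> S" "finite S" using assms fin by auto
      then show ?thesis using S by auto
    qed auto
  qed
  have inj: "inj_on (insert a) {T\<in>Pow P. card T = i}"
    using assms(2) by (intro inj_onI) (metis (no_types, lifting) CollectD PowD insert_ident subset_iff)
  have "esym x (insert a P) (Suc i) = esym x P (Suc i) + (\<Sum>T\<in>insert a ` {T\<in>Pow P. card T = i}. prod x T)"
    unfolding esym_def eq using assms by (intro sum.union_disjoint) auto
  also have "(\<Sum>T\<in>insert a ` {T\<in>Pow P. card T = i}. prod x T) = (\<Sum>T\<in>{T\<in>Pow P. card T = i}. x a * prod x T)"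
    unfolding sum.reindex[OF inj] o_def
  proof (intro sum.cong refl)
    fix T assume "T \<in> {T\<in>Pow P. card T = i}"
    then have "a \<notin> T" "finite T" using assms fin by auto
    then show "prod x (insert a T) = x a * prod x T" by simp
  qed
  finally show ?thesis by (simp add: esym_def sum_distrib_left)
qed

lemma power_Suc_bernoulli:
  fixes s x :: real
  assumes "0 \<le> s" "0 \<le> x"
  shows "s ^ Suc i + real (Suc i) * x * s ^ i \<le> (s + x) ^ Suc i"
proof (induction i)
  case (Suc i)
  have "s ^ Suc (Suc i) + real (Suc (Suc i)) * x * s ^ Suc i
      \<le> (s + x) * (s ^ Suc i + real (Suc i) * x * s ^ i)"
    using assms by (simp add: algebra_simps)
  also have "\<dots> \<le> (s + x) * (s + x) ^ Suc i"
    using Suc assms by (intro mult_left_mono) auto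
  finally show ?case by simp
qed auto

text \<open>Expanding the power produces each product over \<open>i\<close> distinct indices
  \<open>i!\<close> times; in the induction this count is replaced by
  \<open>power_Suc_bernoulli\<close>.\<close>

lemma esym_le:
  assumes "finite P" "\<And>a. a \<in> P \<Longrightarrow> 0 \<le> x a"
  shows "esym x P i \<le> (\<Sum>a\<in>P. x a) ^ i / fact i"
  using assms
proof (induction P arbitrary: i)
  case empty
  then show ?case by (cases i) (auto simp: esym_empty)
next
  case (insert a P)
  show ?case
  proof (cases i)
    case 0
    then show ?thesis using insert by simp
  next
    case (Suc j)
    let ?s = "\<Sum>a\<in>P. x a"
    have s: "?s \<ge> 0" "x a \<ge> 0" using insert by (auto intro: sum_nonneg)
    have "esym x (insert a P) i = esym x P (Suc j) + x a * esym x P j"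
      using insert Suc by (simp add: esym_insert)
    also have "\<dots> \<le> ?s ^ Suc j / fact (Suc j) + x a * (?s ^ j / fact j)"
      using insert s by (intro add_mono mult_left_mono insert.IH) auto
    also have "\<dots> = (?s ^ Suc j + real (Suc j) * x a * ?s ^ j) / fact (Suc j)"
      unfolding add_divide_distrib by (simp del: power_Suc of_nat_Suc)
    also have "\<dots> \<le> (?s + x a) ^ Suc j / fact (Suc j)"
      using power_Suc_bernoulli[OF s, of j] by (intro divide_right_mono) auto
    finally show ?thesis using insert Suc by (simp add: add.commute)
  qed
qed

text \<open>Inclusion-exclusion for the product of the \<open>1 - x a\<close>, truncated at depth
  \<open>r\<close>.\<close>

definition alt_esym :: "('a \<Rightarrow> real) \<Rightarrow> 'a set \<Rightarrow> nat \<Rightarrow> real" where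
  "alt_esym x P r = (\<Sum>i\<le>r. (-1) ^ i * esym x P i)"

lemma alt_esym_insert:
  assumes "finite P" "a \<notin> P"
  shows "alt_esym x (insert a P) (Suc r) = alt_esym x P (Suc r) - x a * alt_esym x P r"
  unfolding alt_esym_def
  by (simp only: sum.atMost_Suc_shift esym_insert[OF assms])
     (use assms in \<open>simp add: algebra_simps sum.distrib sum_distrib_left sum_subtractf sum_negf\<close>)

text \<open>Bonferroni's inequalities, in a form valid for arbitrary weights in \<open>[0, 1]\<close>: it will be used
  both for the indicator functions and for the densities.\<close>

lemma bonferroni:
  assumes "finite P" "\<And>a. a \<in> P \<Longrightarrow> 0 \<le> x a \<and> x a \<le> 1"
  shows "0 \<le> (-1) ^ r * (alt_esym x P r - (\<Prod>a\<in>P. 1 - x a)) \<and>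
    (-1) ^ r * (alt_esym x P r - (\<Prod>a\<in>P. 1 - x a)) \<le> esym x P (Suc r)"
  using assms
proof (induction P arbitrary: r)
  case empty
  have "alt_esym x {} r = 1" unfolding alt_esym_def by (induction r) (auto simp: esym_empty)
  then show ?case by (simp add: esym_empty)
next
  case (insert a P)
  have xa: "0 \<le> x a" "x a \<le> 1" using insert by auto
  let ?Q = "\<Prod>a\<in>P. 1 - x a"
  have prod: "(\<Prod>a\<in>insert a P. 1 - x a) = ?Q - x a * ?Q" using insert by (simp add: algebra_simps)
  have Q01: "0 \<le> ?Q" "?Q \<le> 1" using insert by (auto intro!: prod_nonneg prod_le_1)
  show ?case
  proof (cases r)
    case 0
    have IH: "0 \<le> 1 - ?Q" "1 - ?Q \<le> esym x P (Suc 0)"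
      using insert.IH[of 0] insert by (auto simp: alt_esym_def)
    have "x a * ?Q \<le> x a" "0 \<le> x a * ?Q" using xa Q01 by (auto intro: mult_left_le)
    then have "0 \<le> 1 - (?Q - x a * ?Q)" "1 - (?Q - x a * ?Q) \<le> esym x P (Suc 0) + x a"
      using IH Q01 by linarith+
    then show ?thesis using 0 insert(1,2) unfolding prod by (simp add: alt_esym_def esym_insert)
  next
    case (Suc q)
    define u v where "u = (-1) ^ Suc q * (alt_esym x P (Suc q) - ?Q)" and "v = (-1) ^ q * (alt_esym x P q - ?Q)"
    have IH: "0 \<le> u" "u \<le> esym x P (Suc (Suc q))" "0 \<le> v" "v \<le> esym x P (Suc q)"
      using insert.IH[of "Suc q"] insert.IH[of q] insert unfolding u_def v_def by auto
    have "(-1) ^ r * (alt_esym x (insert a P) r - (\<Prod>a\<in>insert a P. 1 - x a)) = u + x a * v"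
      unfolding Suc alt_esym_insert[OF insert(1,2)] prod u_def v_def by (simp add: algebra_simps)
    moreover have "x a * v \<le> x a * esym x P (Suc q)" using IH xa by (intro mult_left_mono) auto
    moreover have "0 \<le> x a * v" using IH xa by simp
    ultimately show ?thesis using IH Suc insert by (simp add: esym_insert)
  qed
qed

section \<open>Counting integers in residue classes, and the sieve bounds\<close>

lemma card_residue_class:
  assumes "q > 0"
  shows "\<bar>real (card {n\<in>{..<N}. [n = a] (mod q)}) - real N / real q\<bar> \<le> 1"
proof -
  define r where "r = a mod q"
  have r: "r < q" using assms by (simp add: r_def)
  have "{n\<in>{..<N}. [n = a] (mod q)} = (\<lambda>j. r + q * j) ` {j. r + q * j < N}"
  proof (intro equalityI subsetI)
    fix n assume "n \<in> {n\<in>{..<N}. [n = a] (mod q)}"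
    then have n: "n < N" "n mod q = r" by (auto simp: cong_def r_def)
    then have "n = r + q * (n div q)" by (metis mod_mult_div_eq add.commute)
    then show "n \<in> (\<lambda>j. r + q * j) ` {j. r + q * j < N}" using n(1) by auto
  qed (auto simp: cong_def r_def)
  moreover have "inj_on (\<lambda>j. r + q * j) {j. r + q * j < N}" using assms by (auto intro!: inj_onI)
  ultimately have c: "card {n\<in>{..<N}. [n = a] (mod q)} = card {j. r + q * j < N}" by (simp add: card_image)
  have "\<bar>real (card {j. r + q * j < N}) - real N / real q\<bar> \<le> 1"
  proof (cases "r < N")
    case True
    have "{j. r + q * j < N} = {.. (N - 1 - r) div q}"
      using True assms by (auto simp: less_eq_div_iff_mult_less_eq mult.commute)
    then have "card {j. r + q * j < N} = Suc ((N - 1 - r) div q)" by simp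
    moreover have "real ((N - 1 - r) div q) * real q + real ((N - 1 - r) mod q) = real N - 1 - real r"
    proof -
      have "real ((N - 1 - r) div q * q + (N - 1 - r) mod q) = real (N - 1 - r)"
        by (simp only: div_mult_mod_eq)
      also have "\<dots> = real N - 1 - real r" using True by (simp add: of_nat_diff)
      finally show ?thesis by (simp only: of_nat_add of_nat_mult)
    qed
    moreover have "real ((N - 1 - r) mod q) \<le> real q - 1" using assms mod_less_divisor[of q "N - 1 - r"] by linarith
    ultimately have "real (card {j. r + q * j < N}) * real q \<le> real N + real q" "real N - real q \<le> real (card {j. r + q * j < N}) * real q"
      using r by (simp_all add: algebra_simps)
    then show ?thesis using assms by (simp add: abs_le_iff field_simps)
  next
    case False
    then have "{j. r + q * j < N} = {}" by auto
    then show ?thesis using False r assms by (simp add: field_simps)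
  qed
  then show ?thesis by (simp only: c)
qed

text \<open>The Chinese remainder theorem, one prime at a time. The class \<open>a\<close> modulo
  \<open>q\<close> carries the conditions imposed so far, and each final class modulo the full
  product costs an error of at most 1.\<close>

lemma card_residue_conditions:
  fixes \<Omega> :: "nat \<Rightarrow> nat set"
  assumes "finite T" "\<And>p. p \<in> T \<Longrightarrow> prime p" "\<And>p. p \<in> T \<Longrightarrow> \<Omega> p \<subseteq> {..<p}"
    and "q > 0" "\<And>p. p \<in> T \<Longrightarrow> coprime q p"
  shows "\<bar>real (card {n\<in>{..<N}. [n = a] (mod q) \<and> (\<forall>p\<in>T. n mod p \<in> \<Omega> p)})
      - real N / real q * (\<Prod>p\<in>T. real (card (\<Omega> p)) / real p)\<bar> \<le> (\<Prod>p\<in>T. real (card (\<Omega> p)))"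
  using assms
proof (induction T arbitrary: q a)
  case empty
  then show ?case using card_residue_class[of q N a] by simp
next
  case (insert p T)
  have p: "prime p" "p > 0" "coprime q p" using insert by (auto simp: prime_gt_0_nat)
  have fin: "finite (\<Omega> p)" using insert by (meson finite_lessThan finite_subset insertI1)
  define R \<pi> where "R = (\<Prod>p\<in>T. real (card (\<Omega> p)) / real p)" and "\<pi> = (\<Prod>p\<in>T. real (card (\<Omega> p)))"
  have "\<exists>c. [c = a] (mod q) \<and> [c = b] (mod p)" for b
    using binary_chinese_remainder_nat[OF p(3)] by blast
  then obtain c where c: "\<And>b. [c b = a] (mod q)" "\<And>b. [c b = b] (mod p)" by metis
  have comb: "[n = a] (mod q) \<and> [n = b] (mod p) \<longleftrightarrow> [n = c b] (mod (q * p))" for n b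
  proof
    assume "[n = a] (mod q) \<and> [n = b] (mod p)"
    then have "[n = c b] (mod q)" "[n = c b] (mod p)" using c by (metis cong_sym cong_trans)+
    then show "[n = c b] (mod (q * p))" using p(3) by (rule coprime_cong_mult_nat)
  next
    assume "[n = c b] (mod (q * p))"
    then have "[n = c b] (mod q)" "[n = c b] (mod p)"
      using cong_modulus_mult_nat[of n "c b" q p] cong_modulus_mult_nat[of n "c b" p q] by (simp_all add: mult.commute)
    then show "[n = a] (mod q) \<and> [n = b] (mod p)" using c by (metis cong_trans)
  qed
  define S where "S = (\<lambda>b. {n\<in>{..<N}. [n = c b] (mod (q * p)) \<and> (\<forall>p\<in>T. n mod p \<in> \<Omega> p)})"
  have IH: "\<bar>real (card (S b)) - real N / real (q * p) * R\<bar> \<le> \<pi>" for b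
    unfolding S_def R_def \<pi>_def using insert p
    by (intro insert.IH) (auto intro: primes_coprime)
  have "{n\<in>{..<N}. [n = a] (mod q) \<and> (\<forall>p\<in>insert p T. n mod p \<in> \<Omega> p)} = (\<Union>b\<in>\<Omega> p. S b)"
  proof (intro equalityI subsetI)
    fix n assume n: "n \<in> {n\<in>{..<N}. [n = a] (mod q) \<and> (\<forall>p\<in>insert p T. n mod p \<in> \<Omega> p)}"
    then have "n \<in> S (n mod p)" using comb[of n "n mod p"] by (auto simp: S_def cong_def)
    then show "n \<in> (\<Union>b\<in>\<Omega> p. S b)" using n by blast
  next
    fix n assume "n \<in> (\<Union>b\<in>\<Omega> p. S b)"
    then obtain b where b: "b \<in> \<Omega> p" "n \<in> S b" by blast
    moreover have "b < p" using b(1) insert.prems(2)[of p] by auto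
    ultimately show "n \<in> {n\<in>{..<N}. [n = a] (mod q) \<and> (\<forall>p\<in>insert p T. n mod p \<in> \<Omega> p)}"
      using comb[of n b] by (auto simp: S_def cong_def)
  qed
  moreover have "card (\<Union>b\<in>\<Omega> p. S b) = (\<Sum>b\<in>\<Omega> p. card (S b))"
  proof (rule card_UN_disjoint)
    show "\<forall>i\<in>\<Omega> p. \<forall>j\<in>\<Omega> p. i \<noteq> j \<longrightarrow> S i \<inter> S j = {}"
    proof (intro ballI impI)
      fix i j assume ij: "i \<in> \<Omega> p" "j \<in> \<Omega> p" "i \<noteq> j"
      then have "i < p" "j < p" using insert.prems(2)[of p] by auto
      then have "\<not> [i = j] (mod p)" using ij by (simp add: cong_def)
      then show "S i \<inter> S j = {}" using comb by (auto simp: S_def) (metis cong_sym cong_trans)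
    qed
  qed (auto simp: fin S_def)
  ultimately have eq: "real (card {n\<in>{..<N}. [n = a] (mod q) \<and> (\<forall>p\<in>insert p T. n mod p \<in> \<Omega> p)}) = (\<Sum>b\<in>\<Omega> p. real (card (S b)))"
    by simp
  have "(\<Sum>b\<in>\<Omega> p. real (card (S b))) - real N / real q * (real (card (\<Omega> p)) / real p * R)
      = (\<Sum>b\<in>\<Omega> p. real (card (S b)) - real N / real (q * p) * R)"
    by (simp add: sum_subtractf)
  also have "\<bar>\<dots>\<bar> \<le> (\<Sum>b\<in>\<Omega> p. \<pi>)"
    by (rule order_trans[OF sum_abs]) (intro sum_mono IH)
  finally show ?case using insert(1,2) unfolding eq by (simp add: R_def \<pi>_def)
qed

lemma sum_le_power:
  fixes s :: real
  assumes "0 \<le> s"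
  shows "(\<Sum>i\<le>r. s ^ i) \<le> (1 + s) ^ r"
proof -
  have "(\<Sum>i\<le>r. s ^ i) \<le> (\<Sum>i\<le>r. real (r choose i) * s ^ i)"
  proof (intro sum_mono)
    fix i assume "i \<in> {..r}"
    then have "1 \<le> r choose i" by (simp add: Suc_leI zero_less_binomial_iff)
    then have "1 * s ^ i \<le> real (r choose i) * s ^ i" using assms by (intro mult_right_mono) auto
    then show "s ^ i \<le> real (r choose i) * s ^ i" by simp
  qed
  also have "\<dots> = (s + 1) ^ r" by (simp add: binomial_ring)
  finally show ?thesis by (simp add: add.commute)
qed

text \<open>Brun's pure sieve. \<open>bonferroni\<close> enters twice: for the indicator functions,
  with even \<open>r\<close>, to bound the sifted set from above; and for the densities, to return
  from the truncated sum to the product at the cost of one symmetric function of degree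
  \<open>r + 1\<close>.\<close>

theorem brun_sieve:
  fixes \<Omega> :: "nat \<Rightarrow> nat set"
  assumes P: "finite P" "\<And>p. p \<in> P \<Longrightarrow> prime p" "\<And>p. p \<in> P \<Longrightarrow> \<Omega> p \<subseteq> {..<p}" and r: "even r"
  defines "H \<equiv> \<Sum>p\<in>P. real (card (\<Omega> p)) / real p"
  shows "real (card {n\<in>{..<N}. \<forall>p\<in>P. n mod p \<notin> \<Omega> p})
     \<le> real N * (exp (- H) + H ^ Suc r / fact (Suc r)) + (1 + (\<Sum>p\<in>P. real (card (\<Omega> p)))) ^ r"
proof -
  define y where "y = (\<lambda>n p. if n mod p \<in> \<Omega> p then 1 else (0::real))"
  define x where "x = (\<lambda>p. real (card (\<Omega> p)) / real p)"
  define \<omega> where "\<omega> = (\<lambda>p. real (card (\<Omega> p)))"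
  have x01: "0 \<le> x p \<and> x p \<le> 1" if "p \<in> P" for p
  proof -
    have "card (\<Omega> p) \<le> p" using card_mono[OF _ P(3)[OF that]] by simp
    then show ?thesis using P(2)[OF that] by (auto simp: x_def prime_gt_0_nat)
  qed
  have es: "(\<Sum>n<N. esym (y n) P i) \<in> {real N * esym x P i - esym \<omega> P i .. real N * esym x P i + esym \<omega> P i}" for i
  proof -
    have "(\<Sum>n<N. esym (y n) P i) = (\<Sum>T\<in>{T\<in>Pow P. card T = i}. \<Sum>n<N. prod (y n) T)"
      unfolding esym_def by (rule sum.swap)
    moreover have "\<bar>(\<Sum>n<N. prod (y n) T) - real N * prod x T\<bar> \<le> prod \<omega> T" if "T \<in> {T\<in>Pow P. card T = i}" for T
    proof -
      have T: "T \<subseteq> P" "finite T" using that P(1) by (auto dest: finite_subset)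
      have "prod (y n) T = (if \<forall>p\<in>T. n mod p \<in> \<Omega> p then 1 else 0)" for n
        using T(2) by (auto simp: y_def)
      then have "(\<Sum>n<N. prod (y n) T) = real (card {n\<in>{..<N}. \<forall>p\<in>T. n mod p \<in> \<Omega> p})"
        by (simp add: sum.If_cases Int_def)
      then show ?thesis
        using card_residue_conditions[of T \<Omega> 1 N 0] T P by (auto simp: x_def \<omega>_def subset_iff)
    qed
    then have "\<bar>(\<Sum>T\<in>{T\<in>Pow P. card T = i}. (\<Sum>n<N. prod (y n) T) - real N * prod x T)\<bar> \<le> (\<Sum>T\<in>{T\<in>Pow P. card T = i}. prod \<omega> T)"
      by (intro order_trans[OF sum_abs] sum_mono) auto
    ultimately show ?thesis by (auto simp: esym_def sum_subtractf sum_distrib_left abs_le_iff)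
  qed
  have "real (card {n\<in>{..<N}. \<forall>p\<in>P. n mod p \<notin> \<Omega> p}) = (\<Sum>n<N. \<Prod>p\<in>P. 1 - y n p)"
  proof -
    have "(\<Prod>p\<in>P. 1 - y n p) = (if \<forall>p\<in>P. n mod p \<notin> \<Omega> p then 1 else 0)" for n
      using P(1) by (auto simp: y_def)
    then show ?thesis by (simp add: sum.If_cases Int_def)
  qed
  also have "\<dots> \<le> (\<Sum>n<N. alt_esym (y n) P r)"
    using bonferroni[OF P(1), of "y _" r] r by (intro sum_mono) (auto simp: y_def)
  also have "\<dots> = (\<Sum>i\<le>r. (-1) ^ i * (\<Sum>n<N. esym (y n) P i))"
    unfolding alt_esym_def by (subst sum.swap) (simp add: sum_distrib_left)
  also have "\<dots> \<le> (\<Sum>i\<le>r. real N * ((-1) ^ i * esym x P i) + esym \<omega> P i)"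
  proof (intro sum_mono)
    fix i show "(-1) ^ i * (\<Sum>n<N. esym (y n) P i) \<le> real N * ((-1) ^ i * esym x P i) + esym \<omega> P i"
      using es[of i] by (cases "even i") auto
  qed
  also have "\<dots> = real N * alt_esym x P r + (\<Sum>i\<le>r. esym \<omega> P i)"
    by (simp add: alt_esym_def sum.distrib sum_distrib_left)
  also have "\<dots> \<le> real N * (exp (- H) + H ^ Suc r / fact (Suc r)) + (1 + (\<Sum>p\<in>P. real (card (\<Omega> p)))) ^ r"
  proof (intro add_mono mult_left_mono)
    have "alt_esym x P r \<le> (\<Prod>a\<in>P. 1 - x a) + esym x P (Suc r)"
      using bonferroni[OF P(1), of x r] x01 r by simp
    also have "(\<Prod>a\<in>P. 1 - x a) \<le> (\<Prod>a\<in>P. exp (- x a))"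
      using x01 exp_ge_add_one_self[of "- x _"] by (intro prod_mono) (auto simp: algebra_simps)
    also have "(\<Prod>a\<in>P. exp (- x a)) = exp (- H)"
      using P(1) by (simp add: H_def x_def exp_sum flip: sum_negf)
    also have "esym x P (Suc r) \<le> H ^ Suc r / fact (Suc r)"
      using esym_le[OF P(1), of x "Suc r"] x01 by (simp add: H_def x_def del: fact_Suc power_Suc)
    finally show "alt_esym x P r \<le> exp (- H) + H ^ Suc r / fact (Suc r)" by simp
    have s: "0 \<le> (\<Sum>p\<in>P. \<omega> p)" by (intro sum_nonneg) (auto simp: \<omega>_def)
    have "(\<Sum>i\<le>r. esym \<omega> P i) \<le> (\<Sum>i\<le>r. (\<Sum>p\<in>P. \<omega> p) ^ i)"
    proof (intro sum_mono)
      fix i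
      have "esym \<omega> P i \<le> (\<Sum>p\<in>P. \<omega> p) ^ i / fact i" using esym_le[OF P(1), of \<omega> i] by (simp add: \<omega>_def)
      also have "\<dots> \<le> (\<Sum>p\<in>P. \<omega> p) ^ i / 1" using s fact_ge_1[of i] by (intro divide_left_mono) auto
      finally show "esym \<omega> P i \<le> (\<Sum>p\<in>P. \<omega> p) ^ i" by simp
    qed
    also have "\<dots> \<le> (1 + (\<Sum>p\<in>P. \<omega> p)) ^ r" using s by (rule sum_le_power)
    finally show "(\<Sum>i\<le>r. esym \<omega> P i) \<le> (1 + (\<Sum>p\<in>P. real (card (\<Omega> p)))) ^ r" by (simp add: \<omega>_def)
  qed auto
  finally show ?thesis .
qed

lemma fact_ge_exp: "(real n / exp 1) ^ n \<le> fact n"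
proof (cases "n = 0")
  case False
  have "ln ((real n / exp 1) ^ n) = real n * ln (real n) - real n"
    using False by (simp add: ln_realpow ln_div algebra_simps)
  also have "\<dots> \<le> ln (fact n)" using False by (intro ln_fact_ge) auto
  finally show ?thesis using False by (subst (asm) ln_le_cancel_iff) auto
qed simp

text \<open>The 6 is 4 from \<open>ln (z ^ 4)\<close> plus 2 from
  \<open>ln 4 = 2 * ln 2 \<le> 2 * ln z\<close>.\<close>

lemma sum_inverse_primes_window_le:
  assumes "z \<ge> 2"
  shows "(\<Sum>p\<in>primes_in z (z ^ 4). 1 / real p) \<le> 6"
proof -
  have z: "ln (real z) > 0" "ln (real (z ^ 4)) = 4 * ln (real z)" using assms by (auto simp: ln_realpow)
  have "ln (real z) * (\<Sum>p\<in>primes_in z (z ^ 4). 1 / real p) \<le> lw_sum z (z ^ 4)"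
    unfolding sum_distrib_left
  proof (intro sum_mono)
    fix p assume "p \<in> primes_in z (z ^ 4)"
    from primes_inD[OF this] have "ln (real z) \<le> ln (real p)" "real p > 0" using assms by auto
    then show "ln (real z) * (1 / real p) \<le> lw p" by (simp add: divide_right_mono)
  qed
  also have "\<dots> \<le> 4 * ln (real z) + ln 4"
    using mertens_upper[of "z ^ 4" z] assms z by simp
  also have "ln 4 = 2 * ln (2::real)" using ln_realpow[of 2 2] by simp
  also have "4 * ln (real z) + 2 * ln 2 \<le> ln (real z) * 6" using assms by simp
  finally show ?thesis using z(1) by (simp add: mult_le_cancel_left_pos)
qed

text \<open>This makes \<open>4 ^ t\<close> at most \<open>ln Y powr (3/4)\<close> for
  \<open>t \<le> ln (ln Y) / 2\<close>, so that the sifting limit \<open>Z ^ 4 ^ t\<close> stays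
  below every power of \<open>Y\<close>.\<close>

lemma ln_4_le: "ln (4::real) \<le> 3/2"
proof -
  have "ln (4::real) = 2 * ln 2" using ln_realpow[of 2 2] by simp
  then show ?thesis using ln_2_less_1 ln2_le_25_over_36 by simp
qed

text \<open>Stacking \<open>t\<close> consecutive windows gives a total density between
  \<open>\<kappa> * t\<close> and \<open>6 * W * t\<close>. With \<open>t\<close> about
  \<open>ln (ln Y) / 2\<close> the main term \<open>exp (- \<kappa> * t)\<close> is about
  \<open>ln Y powr (- \<kappa> / 2)\<close>; the condition on \<open>\<kappa>\<close> thus provides
  one logarithm more than claimed, which absorbs the constants. The bound \<open>W\<close> keeps the
  truncation depth proportional to \<open>t\<close>, hence the remainder small.\<close>

lemma sieve_log_power:
  fixes C :: "nat set" and \<Omega> :: "nat \<Rightarrow> nat set" and k W :: nat and \<kappa> :: real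
  assumes \<Omega>: "\<And>p. prime p \<Longrightarrow> p > p1 \<Longrightarrow> \<Omega> p \<subseteq> {..<p} \<and> card (\<Omega> p) \<le> W \<and> (\<forall>c\<in>C. c mod p \<notin> \<Omega> p)"
    and win: "\<forall>\<^sub>F z in sequentially. \<kappa> \<le> (\<Sum>p\<in>primes_in z (z ^ 4). real (card (\<Omega> p)) / real p)"
    and \<kappa>: "\<kappa> \<ge> 2 * real k + 2" and W: "W \<ge> 1"
  shows "\<forall>\<^sub>F Y in sequentially. real (card (C \<inter> {..<Y})) \<le> real Y / ln (real Y) ^ k"
proof -
  obtain Z1 where Z1: "\<And>z. z \<ge> Z1 \<Longrightarrow> \<kappa> \<le> (\<Sum>p\<in>primes_in z (z ^ 4). real (card (\<Omega> p)) / real p)"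
    using win by (auto simp: eventually_sequentially)
  define Z where "Z = max (max Z1 p1) 2"
  have Z: "Z \<ge> Z1" "Z \<ge> p1" "Z \<ge> 2" by (auto simp: Z_def)
  define P where "P = (\<lambda>t. primes_in Z (Z ^ (4 ^ t)))"
  define H where "H = (\<lambda>t. \<Sum>p\<in>P t. real (card (\<Omega> p)) / real p)"
  have Zmono: "Z \<le> Z ^ (4 ^ t)" for t using Z by (intro self_le_power) auto
  have \<Omega>': "\<Omega> p \<subseteq> {..<p}" "card (\<Omega> p) \<le> W" "\<And>c. c \<in> C \<Longrightarrow> c mod p \<notin> \<Omega> p" if "p \<in> primes_in a b" "a \<ge> Z" for p a b
    using \<Omega>[of p] that Z by (auto simp: primes_in_def)
  have H_Suc: "H (Suc t) = H t + (\<Sum>p\<in>primes_in (Z ^ 4 ^ t) ((Z ^ 4 ^ t) ^ 4). real (card (\<Omega> p)) / real p)" for t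
  proof -
    have eq: "Z ^ 4 ^ Suc t = (Z ^ 4 ^ t) ^ 4" by (simp add: power_mult[symmetric] mult.commute)
    have "Z ^ 4 ^ t \<le> (Z ^ 4 ^ t) ^ 4" using Z by (intro self_le_power) auto
    with Zmono[of t] show ?thesis unfolding H_def P_def eq by (rule sum_primes_in_split)
  qed
  have "P 0 = {}" by (auto simp: P_def primes_in_def)
  then have H0: "H 0 = 0" by (simp add: H_def)
  have H_ge: "\<kappa> * t \<le> H t" for t
  proof (induction t)
    case (Suc t)
    then show ?case using Z1[of "Z ^ 4 ^ t"] Zmono[of t] Z by (simp add: H_Suc distrib_left del: power_Suc)
  qed (simp add: H0)
  have H_le: "H t \<le> 6 * W * t" for t
  proof (induction t)
    case (Suc t)
    have "(\<Sum>p\<in>primes_in (Z ^ 4 ^ t) ((Z ^ 4 ^ t) ^ 4). real (card (\<Omega> p)) / real p)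
      \<le> (\<Sum>p\<in>primes_in (Z ^ 4 ^ t) ((Z ^ 4 ^ t) ^ 4). real W * (1 / real p))"
      using \<Omega>'(2) Zmono[of t] by (intro sum_mono) (auto intro!: divide_right_mono)
    also have "\<dots> \<le> real W * 6"
      unfolding sum_distrib_left[symmetric] using Zmono[of t] Z
      by (intro mult_left_mono sum_inverse_primes_window_le) auto
    finally show ?case using Suc by (simp add: H_Suc algebra_simps del: power_Suc)
  qed (simp add: H0)
  have H_nonneg: "0 \<le> H t" for t unfolding H_def by (intro sum_nonneg) auto
  have count: "real (card (C \<inter> {..<Y})) \<le> real Y * (2 * exp (- \<kappa> * t)) + ((1 + W) * real Z ^ 4 ^ t) ^ (50 * W * t)" for Y t
  proof -
    \<comment> \<open>Even, and at least \<open>exp 2 * H t\<close>, since \<open>exp 2 < 8\<close>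
      and \<open>8 * 6 < 50\<close>. Then the truncation term, estimated by Stirling, is at most
      \<open>exp (- (r + 1))\<close>.\<close>
    define r where "r = 50 * W * t"
    have "C \<inter> {..<Y} \<subseteq> {n\<in>{..<Y}. \<forall>p\<in>P t. n mod p \<notin> \<Omega> p}"
      using \<Omega>'(3) by (auto simp: P_def)
    then have "real (card (C \<inter> {..<Y})) \<le> real (card {n\<in>{..<Y}. \<forall>p\<in>P t. n mod p \<notin> \<Omega> p})"
      by (intro of_nat_mono card_mono) auto
    also have "\<dots> \<le> real Y * (exp (- H t) + H t ^ Suc r / fact (Suc r)) + (1 + (\<Sum>p\<in>P t. real (card (\<Omega> p)))) ^ r"
      unfolding H_def
      by (rule brun_sieve) (use \<Omega>'(1) in \<open>auto simp: P_def r_def dest: primes_inD\<close>)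
    also have "\<dots> \<le> real Y * (exp (- \<kappa> * t) + exp (- \<kappa> * t)) + ((1 + W) * real Z ^ 4 ^ t) ^ r"
    proof (intro add_mono mult_left_mono power_mono)
      show "exp (- H t) \<le> exp (- \<kappa> * t)" using H_ge[of t] by simp
      have "exp 1 * (exp 1 * H t) \<le> 50 * W * t"
      proof -
        have "exp (1::real) * exp 1 \<le> (272/100) * (272/100)"
          using e_less_272 by (intro mult_mono) auto
        then have "exp (1::real) * exp 1 \<le> 8" by simp
        then have "(exp 1 * exp 1) * H t \<le> 8 * real (6 * W * t)"
          using H_le[of t] H_nonneg[of t] by (intro mult_mono) auto
        then have "exp 1 * (exp 1 * H t) \<le> 48 * (real W * real t)" by (simp add: mult.assoc)
        also have "\<dots> \<le> 50 * (real W * real t)" by (rule mult_right_mono) auto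
        finally show ?thesis by simp
      qed
      then have "exp 1 * (exp 1 * H t) \<le> real (Suc r)" by (simp add: r_def)
      then have "exp (-1) * (exp 1 * (exp 1 * H t)) \<le> exp (-1) * real (Suc r)" by (intro mult_left_mono) auto
      then have "exp 1 * H t \<le> exp (-1) * real (Suc r)" by (simp add: mult.assoc[symmetric] exp_add[symmetric] del: of_nat_Suc)
      then have "exp 1 * H t / real (Suc r) \<le> exp (-1)" by (simp only: pos_divide_le_eq of_nat_0_less_iff zero_less_Suc)
      then have "(exp 1 * H t / real (Suc r)) ^ Suc r \<le> exp (-1) ^ Suc r"
        using H_nonneg[of t] by (intro power_mono) auto
      also have "\<dots> = exp (- real (Suc r))" by (simp add: exp_of_nat_mult[symmetric] del: power_Suc of_nat_Suc)
      also have "\<dots> \<le> exp (- \<kappa> * t)"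
      proof -
        have "\<kappa> * t \<le> 6 * W * t" using H_ge[of t] H_le[of t] by linarith
        also have "\<dots> \<le> real (Suc r)" by (simp add: r_def)
        finally show ?thesis by simp
      qed
      finally have e: "(exp 1 * H t / real (Suc r)) ^ Suc r \<le> exp (- \<kappa> * t)" .
      have "H t ^ Suc r / fact (Suc r) \<le> H t ^ Suc r / (real (Suc r) / exp 1) ^ Suc r"
        using fact_ge_exp[of "Suc r"] H_nonneg[of t] by (intro divide_left_mono) auto
      also have "\<dots> = (exp 1 * H t / real (Suc r)) ^ Suc r" by (simp only: power_divide[symmetric] divide_divide_eq_right mult.commute)
      finally show "H t ^ Suc r / fact (Suc r) \<le> exp (- \<kappa> * t)" using e by linarith
      have "(\<Sum>p\<in>P t. real (card (\<Omega> p))) \<le> (\<Sum>p\<in>P t. real W)"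
        using \<Omega>'(2) by (intro sum_mono) (auto simp: P_def)
      also have "\<dots> = W * real (card (P t))" by simp
      also have "\<dots> \<le> W * real Z ^ 4 ^ t"
      proof (intro mult_left_mono)
        have "card (P t) \<le> card {1..Z ^ 4 ^ t}" by (intro card_mono) (auto simp: P_def primes_in_def Suc_le_eq prime_gt_0_nat)
        then show "real (card (P t)) \<le> real Z ^ 4 ^ t" by (simp flip: of_nat_power)
      qed auto
      moreover have "1 \<le> real Z ^ 4 ^ t" using Z by (intro one_le_power) auto
      ultimately show "1 + (\<Sum>p\<in>P t. real (card (\<Omega> p))) \<le> (1 + W) * real Z ^ 4 ^ t" by (simp add: algebra_simps)
      show "0 \<le> 1 + (\<Sum>p\<in>P t. real (card (\<Omega> p)))" by (simp add: sum_nonneg add_nonneg_nonneg)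
    qed auto
    finally show ?thesis by (simp add: r_def)
  qed
  define U V where "U = real W" and "V = ln (real Z)"
  have UV: "U > 0" "V > 0" using W Z by (auto simp: U_def V_def)
  have \<kappa>0: "\<kappa> > 0" using \<kappa> by linarith
  have "\<forall>\<^sub>F Y::nat in sequentially. 25 * U * ln (ln (real Y)) * (ln (1 + U) + ln (real Y) powr (3/4) * V) \<le> ln (real Y) / 2"
    using UV by real_asymp
  moreover have "\<forall>\<^sub>F Y::nat in sequentially. 2 * exp \<kappa> * (real Y / ln (real Y) powr (real k + 1)) \<le> real Y / ln (real Y) powr (real k) / 2"
    using UV \<kappa>0 by real_asymp
  moreover have "\<forall>\<^sub>F Y::nat in sequentially. real Y powr (1/2) \<le> real Y / ln (real Y) powr (real k) / 2"
    by real_asymp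
  moreover have "\<forall>\<^sub>F Y::nat in sequentially. ln (ln (real Y)) > 2"
    by real_asymp
  moreover have "\<forall>\<^sub>F Y::nat in sequentially. ln (real Y) > 1"
    by real_asymp
  moreover have "\<forall>\<^sub>F Y::nat in sequentially. Y > 1"
    by (rule eventually_gt_at_top)
  ultimately show ?thesis
  proof eventually_elim
    case (elim Y)
    define l where "l = ln (ln (real Y))"
    define t where "t = nat \<lfloor>l / 2\<rfloor>"
    have l: "l > 2" "exp l = ln (real Y)" using elim by (auto simp: l_def)
    have t: "real t \<le> l / 2" "real t \<ge> l / 2 - 1" using l unfolding t_def by linarith+
    have lnY: "ln (real Y) > 0" using elim by linarith
    have A: "real Y * (2 * exp (- \<kappa> * t)) \<le> real Y / ln (real Y) powr (real k) / 2"
    proof -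
      have "- \<kappa> * t \<le> - \<kappa> * (l / 2 - 1)" using t(2) \<kappa>0 by (simp add: mult_left_mono)
      also have "\<dots> = \<kappa> - (\<kappa> / 2) * l" by (simp add: algebra_simps)
      also have "\<dots> \<le> \<kappa> - (real k + 1) * l" using \<kappa> l by (simp add: mult_right_mono)
      finally have "exp (- \<kappa> * t) \<le> exp (\<kappa> - (real k + 1) * l)" by simp
      also have "\<dots> = exp \<kappa> / ln (real Y) powr (real k + 1)"
        using lnY by (simp add: exp_diff powr_def l_def)
      finally have "real Y * (2 * exp (- \<kappa> * t)) \<le> real Y * (2 * (exp \<kappa> / ln (real Y) powr (real k + 1)))"
        by (intro mult_left_mono) auto
      then show ?thesis using elim(2) by (simp add: mult_ac)
    qed
    \<comment> \<open>The logarithm of the remainder is of order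
      \<open>ln (ln Y) * ln Y powr (3/4)\<close>, which is below \<open>ln Y / 2\<close>.\<close>
    have B: "((1 + W) * real Z ^ 4 ^ t) ^ (50 * W * t) \<le> real Y powr (1/2)"
    proof -
      have "(4::real) ^ t = exp (real t * ln 4)" by (simp add: exp_of_nat_mult)
      also have "\<dots> \<le> exp (l / 2 * (3/2))" using t(1) ln_4_le l by (subst exp_le_cancel_iff) (intro mult_mono, auto)
      also have "\<dots> = ln (real Y) powr (3/4)" using lnY by (simp add: powr_def l_def)
      finally have t4: "(4::real) ^ t \<le> ln (real Y) powr (3/4)" .
      have pos: "(1 + W) * real Z ^ 4 ^ t > 0" using Z by (simp add: add_pos_nonneg)
      have "ln (((1 + W) * real Z ^ 4 ^ t) ^ (50 * W * t)) = (50 * W * t) * (ln (1 + U) + 4 ^ t * V)"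
        using pos Z by (simp add: ln_realpow ln_mult U_def V_def)
      also have "\<dots> \<le> (25 * U * l) * (ln (1 + U) + ln (real Y) powr (3/4) * V)"
        using t t4 UV l by (intro mult_mono add_mono) (auto simp: U_def)
      also have "\<dots> \<le> ln (real Y) / 2" using elim(1) by (simp add: l_def)
      also have "\<dots> = ln (real Y powr (1/2))" using elim by (simp add: ln_powr)
      finally show ?thesis using pos elim by (subst (asm) ln_le_cancel_iff) auto
    qed
    have "real (card (C \<inter> {..<Y})) \<le> real Y / ln (real Y) powr (real k) / 2 + real Y / ln (real Y) powr (real k) / 2"
      using count[of Y t] A B elim(3) by linarith
    also have "\<dots> = real Y / ln (real Y) ^ k" using lnY by (simp add: powr_realpow)
    finally show ?case .
  qed
qed

section \<open>Exceptional characters\<close>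

lemma Legendre_mult:
  assumes "prime p" "2 < p"
  shows "Legendre (a * b) (int p) = Legendre a (int p) * Legendre b (int p)"
proof -
  have "[Legendre (a * b) (int p) = (a * b) ^ ((p - 1) div 2)] (mod int p)"
    using euler_criterion[OF assms] .
  moreover have "[Legendre a (int p) * Legendre b (int p) = a ^ ((p - 1) div 2) * b ^ ((p - 1) div 2)] (mod int p)"
    using euler_criterion[OF assms] by (intro cong_mult)
  ultimately have "[Legendre (a * b) (int p) = Legendre a (int p) * Legendre b (int p)] (mod int p)"
    by (metis cong_sym cong_trans power_mult_distrib)
  \<comment> \<open>Both sides lie in \<open>{-1, 0, 1}\<close>, so a difference divisible by
    \<open>p > 2\<close> has to vanish.\<close>
  then have d: "int p dvd Legendre (a * b) (int p) - Legendre a (int p) * Legendre b (int p)"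
    by (simp add: cong_iff_dvd_diff)
  have L: "Legendre x (int p) \<in> {-1, 0, 1}" for x by (simp add: Legendre_def)
  have "\<bar>Legendre (a * b) (int p) - Legendre a (int p) * Legendre b (int p)\<bar> \<le> 2"
    using L[of "a * b"] L[of a] L[of b] by auto
  then show ?thesis using d assms(2) zdvd_imp_le[of "int p" "\<bar>Legendre (a * b) (int p) - Legendre a (int p) * Legendre b (int p)\<bar>"]
    by (cases "Legendre (a * b) (int p) - Legendre a (int p) * Legendre b (int p) = 0") auto
qed

lemma qchar_mult:
  assumes "prime p" "2 < p"
  shows "qchar (a * b) p = qchar a p * qchar b p"
  using Legendre_mult[OF assms, of "int a" "int b"] by (simp add: qchar_def)

lemma qchar_1:
  assumes "prime p"
  shows "qchar 1 p = 1"
proof -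
  have "\<not> int p dvd 1" using assms prime_gt_1_nat[OF assms] by auto
  moreover have "QuadRes (int p) 1" unfolding QuadRes_def by (rule exI[of _ 1]) simp
  ultimately show ?thesis by (simp add: qchar_def Legendre_def cong_0_iff)
qed

lemma qchar_cong:
  assumes "[a = b] (mod p)"
  shows "qchar a p = qchar b p"
proof -
  have *: "[int a = int b] (mod int p)" using assms by (simp add: cong_int_iff)
  have "[int a = 0] (mod int p) \<longleftrightarrow> [int b = 0] (mod int p)" using * cong_sym cong_trans by metis
  moreover have "QuadRes (int p) (int a) \<longleftrightarrow> QuadRes (int p) (int b)"
    unfolding QuadRes_def using * cong_sym cong_trans by metis
  ultimately show ?thesis by (simp add: qchar_def Legendre_def)
qed

text \<open>The reciprocity sign for odd \<open>d\<close>. It depends on \<open>d\<close> only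
  through \<open>d mod 4\<close>; once this class is fixed, the sign is a coefficient depending on
  \<open>p\<close> alone.\<close>

definition qsign :: "nat \<Rightarrow> nat \<Rightarrow> real" where
  "qsign d p = (if d mod 4 = 3 \<and> p mod 4 = 3 then -1 else 1)"

lemma qsign_mult:
  assumes "odd a" "odd b"
  shows "qsign (a * b) p = qsign a p * qsign b p"
proof -
  have "a mod 4 = 1 \<or> a mod 4 = 3" "b mod 4 = 1 \<or> b mod 4 = 3" using assms by presburger+
  moreover have "(a * b) mod 4 = ((a mod 4) * (b mod 4)) mod 4" by (simp add: mod_mult_eq)
  ultimately show ?thesis by (auto simp: qsign_def)
qed

lemma qchar_reciprocity:
  assumes "prime p" "2 < p" "prime q" "2 < q"
  shows "qchar q p = qsign q p * qchar p q"
proof (cases "p = q")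
  case True
  then show ?thesis using qchar_eq_0_iff[of p p] by simp
next
  case False
  have "odd p" "odd q" using assms prime_odd_nat by auto
  then have par: "odd ((p - 1) div 2) \<longleftrightarrow> p mod 4 = 3" "odd ((q - 1) div 2) \<longleftrightarrow> q mod 4 = 3" by presburger+
  have "real_of_int (Legendre (int p) (int q) * Legendre (int q) (int p)) = real_of_int ((- 1) ^ ((p - 1) div 2 * ((q - 1) div 2)))"
    using Quadratic_Reciprocity[OF assms False] by simp
  also have "\<dots> = qsign q p"
    using par by (cases "odd ((p - 1) div 2 * ((q - 1) div 2))") (auto simp: qsign_def)
  finally have "qchar p q * qchar q p = qsign q p" by (simp add: qchar_def)
  moreover have "qsign q p \<in> {-1, 1}" by (simp add: qsign_def)
  ultimately show ?thesis using qchar_range[of p q] qchar_range[of q p] by auto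
qed

lemma prod_prime_factors_squarefree:
  fixes d :: nat
  assumes "squarefree d"
  shows "\<Prod>(prime_factors d) = d"
proof -
  have d: "d \<noteq> 0" using assms by (metis not_squarefree_0)
  have "(\<Prod>p\<in>prime_factors d. p) = (\<Prod>p\<in>prime_factors d. p ^ multiplicity p d)"
  proof (intro prod.cong refl)
    fix p assume p: "p \<in> prime_factors d"
    then have "multiplicity p d \<le> 1" using assms d by (auto simp: squarefree_factorial_semiring'')
    moreover have "multiplicity p d \<ge> 1" using p d by (simp add: prime_factors_multiplicity)
    ultimately have "multiplicity p d = 1" by simp
    then show "p = p ^ multiplicity p d" by simp
  qed
  then show ?thesis using prod_prime_factors[OF d] by simp
qed

text \<open>The character is written with the moving variable on top: this makes it periodic in \<open>n\<close>,
  and quadratic reciprocity relates it to \<open>qchar d p\<close> at primes.\<close>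

definition jac :: "nat \<Rightarrow> nat \<Rightarrow> real" where
  "jac d n = (\<Prod>q\<in>prime_factors d. qchar n q)"

lemma odd_prime_factor:
  fixes d q :: nat
  assumes "odd d" "q \<in> prime_factors d"
  shows "prime q" "2 < q" "q dvd d"
proof -
  show "prime q" "q dvd d" using assms(2) by auto
  then show "2 < q" using assms(1) prime_ge_2_nat[of q] by (cases "q = 2") auto
qed

lemma jac_mult: "odd d \<Longrightarrow> jac d (a * b) = jac d a * jac d b"
  unfolding jac_def prod.distrib[symmetric] by (intro prod.cong refl qchar_mult) (auto dest: odd_prime_factor)

lemma jac_1: "jac d 1 = 1"
  unfolding jac_def by (intro prod.neutral ballI qchar_1) auto

lemma jac_cong: "[a = b] (mod d) \<Longrightarrow> jac d a = jac d b"
  unfolding jac_def by (intro prod.cong refl qchar_cong) (auto intro: cong_dvd_modulus_nat)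

lemma jac_bound: "\<bar>jac d n\<bar> \<le> 1"
  unfolding jac_def abs_prod using qchar_bounds by (intro prod_le_1) (auto simp: abs_le_iff minus_le_iff)

text \<open>Reciprocity, one prime factor of \<open>d\<close> at a time. Oddness of the partial
  product is carried along because \<open>qsign\<close> is multiplicative on odd numbers.\<close>

lemma qchar_eq_jac:
  assumes "prime p" "2 < p" "odd d" "squarefree d"
  shows "qchar d p = qsign d p * jac d p"
proof -
  have "qchar (\<Prod>F) p = qsign (\<Prod>F) p * (\<Prod>q\<in>F. qchar p q) \<and> odd (\<Prod>F)" if "finite F" "\<forall>q\<in>F. prime q \<and> 2 < q" for F
    using that
  proof (induction F)
    case empty
    then show ?case using qchar_1[OF assms(1)] by (simp add: qsign_def)
  next
    case (insert q F)
    then have q: "prime q" "2 < q" "odd q" using prime_odd_nat[of q] by auto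
    then show ?case using insert qchar_mult[OF assms(1,2), of q "\<Prod>F"] qsign_mult[of q "\<Prod>F" p]
        qchar_reciprocity[OF assms(1,2) q(1,2)] by simp
  qed
  from this[of "prime_factors d"] show ?thesis
    using prod_prime_factors_squarefree[OF assms(4)] odd_prime_factor[OF assms(3)] by (simp add: jac_def)
qed

text \<open>Squaring identifies \<open>1\<close> and \<open>q - 1\<close>, so it is not injective on
  the residues modulo \<open>q\<close>, hence not surjective.\<close>

lemma exists_nonresidue:
  assumes "prime q" "2 < q"
  obtains b where "qchar b q = -1"
proof -
  have "\<exists>b<q. \<not> (\<exists>x<q. (x * x) mod q = b)"
  proof (rule ccontr)
    assume "\<not> ?thesis"
    then have "{..<q} \<subseteq> (\<lambda>x. (x * x) mod q) ` {..<q}" by force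
    moreover have "(\<lambda>x. (x * x) mod q) ` {..<q} \<subseteq> {..<q}" using assms by auto
    ultimately have "(\<lambda>x. (x * x) mod q) ` {..<q} = {..<q}" by blast
    then have inj: "inj_on (\<lambda>x. (x * x) mod q) {..<q}" by (intro eq_card_imp_inj_on) auto
    have sq: "(1 * 1) mod q = ((q - 1) * (q - 1)) mod q"
    proof -
      obtain k where "q = k + 2" using assms(2) by (metis add.commute le_add_diff_inverse less_imp_le)
      then have "(q - 1) * (q - 1) = 1 + q * (q - 2)" by (simp add: algebra_simps)
      then show ?thesis by (simp only: mod_mult_self2 mult_1)
    qed
    have "1 \<in> {..<q}" "q - 1 \<in> {..<q}" using assms(2) by auto
    then have "1 = q - 1" by (rule inj_onD[OF inj sq])
    then show False using assms(2) by simp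
  qed
  then obtain b where b: "b < q" "\<And>x. x < q \<Longrightarrow> (x * x) mod q \<noteq> b" by blast
  have "\<not> q dvd b"
  proof
    assume "q dvd b"
    then have "b = 0" using b(1) by (auto dest: dvd_imp_le)
    then show False using b(2)[of 0] assms(2) by simp
  qed
  moreover have "\<not> QuadRes (int q) (int b)"
  proof
    assume "QuadRes (int q) (int b)"
    then obtain y where y: "[y\<^sup>2 = int b] (mod int q)" by (auto simp: QuadRes_def)
    define x where "x = nat (y mod int q)"
    have q0: "int q > 0" using assms(2) by simp
    have x: "int x = y mod int q" using q0 by (simp add: x_def)
    have "int ((x * x) mod q) = (y mod int q * (y mod int q)) mod int q" by (simp add: x zmod_int)
    also have "\<dots> = int b mod int q" using y by (simp add: cong_def power2_eq_square mod_mult_eq)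
    also have "\<dots> = int b" using b(1) by simp
    finally have "(x * x) mod q = b" by (simp only: of_nat_eq_iff)
    moreover have "int x < int q" unfolding x using q0 by (rule pos_mod_bound)
    ultimately show False using b(2)[of x] by simp
  qed
  ultimately have "qchar b q = -1" by (simp add: qchar_def Legendre_def cong_0_iff)
  then show ?thesis by (rule that)
qed

section \<open>Orthogonality of characters and large values of prime sums\<close>

lemma sum_periodic_le:
  fixes f :: "nat \<Rightarrow> real"
  assumes e: "e > 0" and per: "\<And>n. f (n mod e) = f n" and zero: "(\<Sum>n<e. f n) = 0" and bd: "\<And>n. \<bar>f n\<bar> \<le> 1"
  shows "\<bar>\<Sum>n<M. f n\<bar> \<le> real e"
proof -
  have full: "(\<Sum>n<k * e. f n) = 0" for k
  proof (induction k)
    case (Suc k)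
    have "(\<Sum>n<Suc k * e. f n) = (\<Sum>n<k * e. f n) + (\<Sum>n=k*e..<k*e+e. f n)"
      by (simp add: lessThan_atLeast0 sum.atLeastLessThan_concat add.commute[of e])
    also have "(\<Sum>n=k*e..<k*e+e. f n) = (\<Sum>n<e. f (n + k * e))"
      using sum.shift_bounds_nat_ivl[of f 0 "k * e" e] by (simp add: lessThan_atLeast0 add.commute)
    also have "\<dots> = (\<Sum>n<e. f n)"
    proof (intro sum.cong refl)
      fix n show "f (n + k * e) = f n" using per[of "n + k * e"] per[of n] by simp
    qed
    finally show ?case using Suc zero by simp
  qed auto
  have M: "M = (M div e) * e + M mod e" by simp
  have "(\<Sum>n<M. f n) = (\<Sum>n<(M div e) * e. f n) + (\<Sum>n=(M div e)*e..<M. f n)"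
    by (simp add: lessThan_atLeast0 sum.atLeastLessThan_concat)
  also have "\<bar>\<dots>\<bar> \<le> (\<Sum>n=(M div e)*e..<M. 1)"
    unfolding full add_0 by (rule order_trans[OF sum_abs]) (intro sum_mono bd)
  also have "\<dots> = real (M mod e)" by (simp add: minus_div_mult_eq_mod)
  also have "\<dots> \<le> real e" using e by (simp add: less_imp_le)
  finally show ?thesis .
qed

text \<open>Partial summation. The induction bounds the difference from
  \<open>(\<Sum>n=a..<b. f n) * u b\<close>, whose increments telescope because the weights
  decrease.\<close>

lemma abel_bound:
  fixes f u :: "nat \<Rightarrow> real"
  assumes ab: "a \<le> b" and dec: "\<And>n. a \<le> n \<Longrightarrow> u (Suc n) \<le> u n" and nn: "\<And>n. 0 \<le> u n"
    and B: "\<And>k. \<bar>\<Sum>n=a..<k. f n\<bar> \<le> B"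
  shows "\<bar>\<Sum>n=a..<b. f n * u n\<bar> \<le> B * u a"
proof -
  have "\<bar>(\<Sum>n=a..<b. f n * u n) - (\<Sum>n=a..<b. f n) * u b\<bar> \<le> B * (u a - u b)"
    using ab
  proof (induction b rule: dec_induct)
    case (step b)
    have "(\<Sum>n=a..<Suc b. f n * u n) - (\<Sum>n=a..<Suc b. f n) * u (Suc b)
       = ((\<Sum>n=a..<b. f n * u n) - (\<Sum>n=a..<b. f n) * u b) + (\<Sum>n=a..<Suc b. f n) * (u b - u (Suc b))"
      using step by (simp add: algebra_simps)
    also have "\<bar>\<dots>\<bar> \<le> B * (u a - u b) + B * (u b - u (Suc b))"
    proof (rule order_trans[OF abs_triangle_ineq], rule add_mono)
      show "\<bar>(\<Sum>n=a..<Suc b. f n) * (u b - u (Suc b))\<bar> \<le> B * (u b - u (Suc b))"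
        unfolding abs_mult using B[of "Suc b"] dec[OF step(1)] by (intro mult_mono) auto
    qed (rule step)
    finally show ?case by (simp add: algebra_simps)
  qed auto
  moreover have "\<bar>(\<Sum>n=a..<b. f n) * u b\<bar> \<le> B * u b"
    unfolding abs_mult using B[of b] nn[of b] by (intro mult_mono) auto
  moreover have "B * (u a - u b) + B * u b = B * u a" by (simp add: algebra_simps)
  ultimately show ?thesis by linarith
qed

text \<open>The product of the two characters is multiplicative with period \<open>d * d'\<close>. A
  prime \<open>q\<close> dividing exactly one of \<open>d\<close> and \<open>d'\<close> allows the
  Chinese remainder theorem to produce a unit \<open>a\<close> at which the product is -1;
  multiplication by \<open>a\<close> permutes a period, so the sum over it equals its own
  negative.\<close>

lemma jac_orthogonal:
  assumes d: "odd d" "squarefree d" "odd d'" "squarefree d'" "d \<noteq> d'"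
  shows "\<bar>\<Sum>n<M. jac d n * jac d' n\<bar> \<le> real (d * d')"
proof -
  define e where "e = d * d'"
  define f where "f = (\<lambda>n. jac d n * jac d' n)"
  have e: "e > 0" using d by (auto simp: e_def odd_pos)
  have fcong: "f a = f b" if "[a = b] (mod e)" for a b
  proof -
    have "[a = b] (mod d)" "[a = b] (mod d')" using that unfolding e_def
      by (auto intro: cong_dvd_modulus_nat)
    then show ?thesis by (simp add: f_def jac_cong[of a b])
  qed
  have fmult: "f (a * b) = f a * f b" for a b using d by (simp add: f_def jac_mult)
  have bd: "\<bar>f n\<bar> \<le> 1" for n
    unfolding f_def abs_mult using jac_bound[of d n] jac_bound[of d' n] by (simp add: mult_le_one)
  have "prime_factors d \<noteq> prime_factors d'"
    using prod_prime_factors_squarefree[OF d(2)] prod_prime_factors_squarefree[OF d(4)] d(5) by metis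
  then obtain q where q: "q \<in> (prime_factors d - prime_factors d') \<union> (prime_factors d' - prime_factors d)" by blast
  have qp: "prime q" "2 < q" using q odd_prime_factor d by blast+
  obtain b where b: "qchar b q = -1" using exists_nonresidue[OF qp] by blast
  \<comment> \<open>The primes common to \<open>d\<close> and \<open>d'\<close> are included, so
    that \<open>a\<close> becomes coprime to the whole period.\<close>
  define F where "F = (prime_factors d \<union> prime_factors d') - {q}"
  have "coprime q (\<Prod>F)" using qp by (intro prod_coprime_right primes_coprime) (auto simp: F_def)
  then obtain a where a: "[a = b] (mod q)" "[a = 1] (mod \<Prod>F)"
    using binary_chinese_remainder_nat by blast
  have aq: "qchar a q = -1" using qchar_cong[OF a(1)] b by simp
  have aF: "qchar a r = 1" if "r \<in> F" for r
  proof -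
    have "r dvd \<Prod>F" using that by (intro dvd_prodI) (auto simp: F_def)
    then have "[a = 1] (mod r)" using a(2) by (rule cong_dvd_modulus_nat[rotated])
    moreover have "prime r" using that by (auto simp: F_def)
    ultimately show ?thesis using qchar_cong[of a 1 r] qchar_1 by simp
  qed
  have jac_in: "jac D a = -1" if "q \<in> prime_factors D" "prime_factors D - {q} \<subseteq> F" for D
    using that aq aF unfolding jac_def by (subst prod.remove[of _ q]) (auto intro!: prod.neutral)
  have jac_out: "jac D a = 1" if "prime_factors D \<subseteq> F" for D
    using that aF unfolding jac_def by (auto intro!: prod.neutral)
  have fa: "f a = -1"
    using q
  proof
    assume "q \<in> prime_factors d - prime_factors d'"
    then have "jac d a = -1" "jac d' a = 1" by (intro jac_in jac_out; auto simp: F_def)+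
    then show ?thesis by (simp add: f_def)
  next
    assume "q \<in> prime_factors d' - prime_factors d"
    then have "jac d' a = -1" "jac d a = 1" by (intro jac_in jac_out; auto simp: F_def)+
    then show ?thesis by (simp add: f_def)
  qed
  have cop: "coprime a e"
  proof (rule ccontr)
    assume "\<not> coprime a e"
    then have "gcd a e \<noteq> 1" by (simp only: coprime_iff_gcd_eq_1 not_False_eq_True)
    then obtain r where "prime r" "r dvd gcd a e" using prime_factor_nat by blast
    then have r: "prime r" "r dvd a" "r dvd e" by (simp_all only: gcd_greatest_iff)
    then have "r dvd d \<or> r dvd d'" by (simp add: e_def prime_dvd_mult_iff)
    then have "r \<in> prime_factors d \<or> r \<in> prime_factors d'" using r(1) d by (auto simp: in_prime_factors_iff dest: odd_pos)
    then have "r \<in> F \<or> r = q" by (auto simp: F_def)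
    then have "qchar a r \<noteq> 0" using aF aq by auto
    then show False using r(2) qchar_eq_0_iff by blast
  qed
  have "bij_betw (\<lambda>n. (a * n) mod e) {..<e} {..<e}"
  proof (rule bij_betw_imageI)
    show inj: "inj_on (\<lambda>n. (a * n) mod e) {..<e}"
    proof (rule inj_onI)
      fix x y assume xy: "x \<in> {..<e}" "y \<in> {..<e}" "(a * x) mod e = (a * y) mod e"
      then have "[a * x = a * y] (mod e)" by (simp add: cong_def)
      then have "[x = y] (mod e)" using cop by (simp add: cong_mult_lcancel_nat)
      then show "x = y" using xy by (simp add: cong_def)
    qed
    have "(\<lambda>n. (a * n) mod e) ` {..<e} \<subseteq> {..<e}" using e by auto
    then show "(\<lambda>n. (a * n) mod e) ` {..<e} = {..<e}" using inj by (intro card_subset_eq) (auto simp: card_image)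
  qed
  then have "(\<Sum>n<e. f n) = (\<Sum>n<e. f ((a * n) mod e))" by (rule sum.reindex_bij_betw[symmetric])
  also have "\<dots> = (\<Sum>n<e. f a * f n)"
    by (intro sum.cong refl) (simp add: fcong[of "(a * _) mod e" "a * _"] fmult[symmetric])
  also have "\<dots> = - (\<Sum>n<e. f n)" by (simp add: fa sum_negf)
  finally have "(\<Sum>n<e. f n) = 0" by simp
  then have "\<bar>\<Sum>n<M. f n\<bar> \<le> real e"
    using e bd by (intro sum_periodic_le) (auto intro: fcong)
  then show ?thesis by (simp add: f_def e_def)
qed

lemma jac_orthogonal_weighted:
  assumes d: "odd d" "squarefree d" "odd d'" "squarefree d'" "d \<noteq> d'" and s: "1 \<le> s" "s \<le> t"
  shows "(\<Sum>n=s..<t. jac d n * jac d' n * (1 / real n)) \<le> 2 * real (d * d') / real s"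
proof -
  have "\<bar>\<Sum>n=s..<t. jac d n * jac d' n * (1 / real n)\<bar> \<le> (2 * real (d * d')) * (1 / real s)"
  proof (rule abel_bound[OF s(2)])
    fix n assume "s \<le> n"
    then show "1 / real (Suc n) \<le> 1 / real n" using s by (intro divide_left_mono) auto
  next
    fix k
    show "\<bar>\<Sum>n=s..<k. jac d n * jac d' n\<bar> \<le> 2 * real (d * d')"
    proof (cases "s \<le> k")
      case True
      then have "(\<Sum>n=s..<k. jac d n * jac d' n) = (\<Sum>n<k. jac d n * jac d' n) - (\<Sum>n<s. jac d n * jac d' n)"
        by (simp add: lessThan_atLeast0 sum_diff_nat_ivl)
      then show ?thesis using jac_orthogonal[OF d, of k] jac_orthogonal[OF d, of s] by linarith
    qed auto
  qed auto
  then show ?thesis by (simp add: abs_le_iff)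
qed

text \<open>A power of the prime sum runs over integers in a range so far out that orthogonality is
  effective there. The coefficients are chosen before \<open>g\<close>, so one choice serves all
  characters. In the induction the primes dividing \<open>n\<close> contribute \<open>ln p\<close>
  each, in all at most \<open>ln n \<le> (j + 1) * L\<close>; this is the origin of the
  factorial.\<close>

lemma prime_sum_power:
  fixes c :: "nat \<Rightarrow> real"
  assumes I: "finite I" "\<And>p. p \<in> I \<Longrightarrow> prime p \<and> a \<le> p \<and> p \<le> Q" and a: "a \<ge> 1"
    and c: "\<And>p. p \<in> I \<Longrightarrow> \<bar>c p\<bar> \<le> lw p" and L: "ln (real Q) \<le> L" "0 \<le> L"
  shows "\<exists>b. (\<forall>n. \<bar>b n\<bar> \<le> fact j * L ^ j / real n) \<and>
     (\<forall>g::nat\<Rightarrow>real. g 1 = 1 \<longrightarrow> (\<forall>x y. g (x * y) = g x * g y) \<longrightarrow>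
        (\<Sum>p\<in>I. c p * g p) ^ j = (\<Sum>n\<in>{a ^ j..Q ^ j}. b n * g n))"
proof (induction j)
  case 0
  show ?case by (rule exI[of _ "\<lambda>n. if n = 1 then 1 else 0"]) auto
next
  case (Suc j)
  then obtain b where b: "\<And>n. \<bar>b n\<bar> \<le> fact j * L ^ j / real n"
    and bs: "\<And>g::nat\<Rightarrow>real. g 1 = 1 \<Longrightarrow> (\<And>x y. g (x * y) = g x * g y) \<Longrightarrow>
        (\<Sum>p\<in>I. c p * g p) ^ j = (\<Sum>n\<in>{a ^ j..Q ^ j}. b n * g n)" by blast
  define R where "R = {a ^ j..Q ^ j}"
  define B where "B = fact j * L ^ j"
  have B0: "B \<ge> 0" using L by (simp add: B_def)
  define S where "S = (\<lambda>n. {x\<in>I \<times> R. fst x * snd x = n})"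
  define b' where "b' = (\<lambda>n. \<Sum>x\<in>S n. c (fst x) * b (snd x))"
  have range: "fst x * snd x \<in> {a ^ Suc j..Q ^ Suc j}" if "x \<in> I \<times> R" for x
    using that I(2) by (auto simp: R_def intro!: mult_le_mono)
  have "\<bar>b' n\<bar> \<le> fact (Suc j) * L ^ Suc j / real n" for n
  proof (cases "S n = {}")
    case True
    then show ?thesis using L by (simp add: b'_def)
  next
    case False
    then obtain x where x: "x \<in> S n" by blast
    then have nr: "n \<in> {a ^ Suc j..Q ^ Suc j}" using range by (auto simp: S_def)
    have "1 \<le> a ^ Suc j" using a by (intro one_le_power)
    then have n1: "n \<ge> 1" using nr by (meson atLeastAtMost_iff le_trans)
    have Q1: "Q \<ge> 1" using I(2)[of "fst x"] x a by (auto simp: S_def)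
    \<comment> \<open>For given \<open>n\<close> the prime determines its cofactor, so the terms are
      indexed by primes dividing \<open>n\<close>.\<close>
    have inj: "inj_on fst (S n)"
    proof (rule inj_onI)
      fix x y assume xy: "x \<in> S n" "y \<in> S n" "fst x = fst y"
      then have "fst x * snd x = fst x * snd y" "fst x > 0" using I(2) n1 by (auto simp: S_def intro: prime_gt_0_nat)
      then show "x = y" using xy by (auto intro: prod_eqI)
    qed
    have "\<bar>b' n\<bar> \<le> (\<Sum>x\<in>S n. \<bar>c (fst x) * b (snd x)\<bar>)" unfolding b'_def by (rule sum_abs)
    also have "\<dots> \<le> (\<Sum>x\<in>S n. ln (real (fst x)) * (B / real n))"
    proof (intro sum_mono)
      fix x assume x: "x \<in> S n"
      have "\<bar>c (fst x) * b (snd x)\<bar> \<le> (ln (real (fst x)) / real (fst x)) * (B / real (snd x))"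
      proof -
        have xI: "fst x \<in> I" using x by (auto simp: S_def)
        then have "0 \<le> ln (real (fst x)) / real (fst x)" using I(2)[OF xI] a by simp
        then show ?thesis unfolding abs_mult B_def by (intro mult_mono c[OF xI] b) auto
      qed
      also have "\<dots> = ln (real (fst x)) * (B / real (fst x * snd x))" by simp
      also have "fst x * snd x = n" using x by (simp add: S_def)
      finally show "\<bar>c (fst x) * b (snd x)\<bar> \<le> ln (real (fst x)) * (B / real n)" .
    qed
    also have "\<dots> = (\<Sum>p\<in>fst ` S n. ln (real p)) * (B / real n)"
      by (simp add: sum.reindex[OF inj] sum_distrib_right sum_divide_distrib)
    also have "\<dots> \<le> ln (real n) * (B / real n)"
    proof (intro mult_right_mono sum_ln_primes_le)
      show "finite (fst ` S n)" using I(1) by (auto simp: S_def R_def)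
    qed (use I(2) n1 B0 in \<open>auto simp: S_def\<close>)
    also have "\<dots> \<le> (real (Suc j) * L) * (B / real n)"
    proof (intro mult_right_mono)
      have "ln (real n) \<le> ln (real (Q ^ Suc j))" using nr n1 Q1 by (subst ln_le_cancel_iff) (auto simp del: of_nat_power power_Suc)
      also have "\<dots> = real (Suc j) * ln (real Q)" using Q1 by (subst of_nat_power, subst ln_realpow) auto
      also have "\<dots> \<le> real (Suc j) * L" using L by (intro mult_left_mono) auto
      finally show "ln (real n) \<le> real (Suc j) * L" .
    qed (use B0 in auto)
    also have "\<dots> = fact (Suc j) * L ^ Suc j / real n" by (simp add: B_def)
    finally show ?thesis .
  qed
  moreover have "(\<Sum>p\<in>I. c p * g p) ^ Suc j = (\<Sum>n\<in>{a ^ Suc j..Q ^ Suc j}. b' n * g n)"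
    if g: "g 1 = 1" "\<And>x y. g (x * y) = g x * g y" for g :: "nat \<Rightarrow> real"
  proof -
    have "(\<Sum>p\<in>I. c p * g p) ^ Suc j = (\<Sum>p\<in>I. c p * g p) * (\<Sum>n\<in>R. b n * g n)"
      using bs[OF g] by (simp add: R_def)
    also have "\<dots> = (\<Sum>x\<in>I \<times> R. (c (fst x) * b (snd x)) * g (fst x * snd x))"
      unfolding sum_product sum.cartesian_product by (intro sum.cong) (auto simp: g(2))
    also have "\<dots> = (\<Sum>n\<in>{a ^ Suc j..Q ^ Suc j}. \<Sum>x\<in>S n. (c (fst x) * b (snd x)) * g (fst x * snd x))"
      unfolding S_def using I(1) range by (intro sum.group[symmetric]) (auto simp: R_def)
    also have "\<dots> = (\<Sum>n\<in>{a ^ Suc j..Q ^ Suc j}. b' n * g n)"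
      unfolding b'_def sum_distrib_right by (intro sum.cong refl) (auto simp: S_def)
    finally show ?thesis .
  qed
  ultimately show ?case by blast
qed

lemma sum_inverse_le: "(\<Sum>n\<in>{s..t}. 1 / real n) \<le> 1 + ln (real t)" if "s \<ge> 1" "t \<ge> 1"
proof -
  have "(\<Sum>n\<in>{s..t}. 1 / real n) \<le> (\<Sum>n\<in>{1..t}. 1 / real n)"
    using that by (intro sum_mono2) auto
  also have "\<dots> \<le> 1 + ln (real t)"
    using that(2)
  proof (induction t rule: nat_induct_at_least)
    case (Suc n)
    have "ln (real n / real (Suc n)) \<le> real n / real (Suc n) - 1"
      using Suc by (intro ln_le_minus_one) auto
    also have "\<dots> = - (1 / real (Suc n))" by (simp add: field_simps)
    finally have "1 / real (Suc n) \<le> ln (real (Suc n)) - ln (real n)" using Suc by (simp add: ln_div)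
    then show ?case using Suc by simp
  qed simp
  finally show ?thesis .
qed

text \<open>Adding up \<open>j\<close>-th powers over \<open>D\<close>, exchanging sums and applying
  Cauchy-Schwarz leads to the mean square of \<open>\<Sum>d\<in>D. jac d n\<close> with weight
  \<open>1 / n\<close>. The diagonal gives \<open>1 + j * L\<close> for each \<open>d\<close>; by
  orthogonality a pair of distinct members costs \<open>2 * M\<^sup>2 / a ^ j\<close>, which a large
  \<open>j\<close> makes negligible.\<close>

lemma large_values_bound:
  fixes c :: "nat \<Rightarrow> real" and V L :: real
  assumes D: "finite D" "\<And>d. d \<in> D \<Longrightarrow> odd d \<and> squarefree d \<and> d \<le> M"
    and I: "finite I" "\<And>p. p \<in> I \<Longrightarrow> prime p \<and> a \<le> p \<and> p \<le> Q" and a: "a \<ge> 1" "a \<le> Q"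
    and c: "\<And>p. p \<in> I \<Longrightarrow> \<bar>c p\<bar> \<le> lw p" and L: "ln (real Q) \<le> L"
    and V: "V \<ge> 0" "\<And>d. d \<in> D \<Longrightarrow> V \<le> (\<Sum>p\<in>I. c p * jac d p)"
  shows "real (card D) * V ^ (2 * j) \<le> (fact j * L ^ j)\<^sup>2 * (1 + j * L) * ((1 + j * L) + card D * (2 * (real M)\<^sup>2 / real (a ^ j)))"
proof (cases "D = {}")
  case True
  have "1 \<le> real Q" using a by simp
  then have "0 \<le> L" using L ln_ge_zero[of "real Q"] by linarith
  then show ?thesis using True by simp
next
  case False
  have Q1: "Q \<ge> 1" using a by simp
  then have "0 \<le> ln (real Q)" by simp
  then have L0: "0 \<le> L" using L by linarith
  obtain b where b: "\<And>n. \<bar>b n\<bar> \<le> fact j * L ^ j / real n"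
    and bs: "\<And>g::nat\<Rightarrow>real. g 1 = 1 \<Longrightarrow> (\<And>x y. g (x * y) = g x * g y) \<Longrightarrow>
        (\<Sum>p\<in>I. c p * g p) ^ j = (\<Sum>n\<in>{a ^ j..Q ^ j}. b n * g n)"
    using prime_sum_power[OF I a(1) c L L0, of j] by blast
  define R where "R = {a ^ j..Q ^ j}"
  define B where "B = fact j * L ^ j"
  define T where "T = (\<lambda>n. \<Sum>d\<in>D. jac d n)"
  have aj: "1 \<le> a ^ j" "1 \<le> Q ^ j" "a ^ j \<le> Q ^ j" using a Q1 by (auto intro: one_le_power power_mono)
  have "real (card D) * V ^ j = (\<Sum>d\<in>D. V ^ j)" by simp
  also have "\<dots> \<le> (\<Sum>d\<in>D. (\<Sum>p\<in>I. c p * jac d p) ^ j)"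
    using V by (intro sum_mono power_mono) auto
  also have "\<dots> = (\<Sum>d\<in>D. \<Sum>n\<in>R. b n * jac d n)"
    unfolding R_def using D(2) by (intro sum.cong refl bs jac_1 jac_mult) auto
  also have "\<dots> = (\<Sum>n\<in>R. b n * T n)"
    by (subst sum.swap) (simp add: T_def sum_distrib_left)
  also have "\<dots> \<le> (\<Sum>n\<in>R. (B / real n) * \<bar>T n\<bar>)"
  proof (intro sum_mono)
    fix n
    have "b n * T n \<le> \<bar>b n\<bar> * \<bar>T n\<bar>" by (metis abs_ge_self abs_mult)
    also have "\<dots> \<le> (B / real n) * \<bar>T n\<bar>" unfolding B_def using b by (intro mult_right_mono) auto
    finally show "b n * T n \<le> (B / real n) * \<bar>T n\<bar>" .
  qed
  \<comment> \<open>Splitting \<open>1 / n\<close> evenly keeps the weight \<open>1 / n\<close> in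
    both sums of squares, so that both are logarithmic in the length of the range.\<close>
  also have "\<dots> = B * (\<Sum>n\<in>R. (1 / sqrt (real n)) * (\<bar>T n\<bar> / sqrt (real n)))"
    by (simp add: sum_distrib_left)
  finally have "(real (card D) * V ^ j)\<^sup>2 \<le> (B * (\<Sum>n\<in>R. (1 / sqrt (real n)) * (\<bar>T n\<bar> / sqrt (real n))))\<^sup>2"
    using V by (intro power_mono) auto
  also have "\<dots> = B\<^sup>2 * (\<Sum>n\<in>R. (1 / sqrt (real n)) * (\<bar>T n\<bar> / sqrt (real n)))\<^sup>2" by (simp add: power_mult_distrib)
  also have "\<dots> \<le> B\<^sup>2 * ((\<Sum>n\<in>R. (1 / sqrt (real n))\<^sup>2) * (\<Sum>n\<in>R. (\<bar>T n\<bar> / sqrt (real n))\<^sup>2))"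
    by (intro mult_left_mono Cauchy_Schwarz_ineq_sum) auto
  also have "\<dots> = B\<^sup>2 * ((\<Sum>n\<in>R. 1 / real n) * (\<Sum>n\<in>R. (T n)\<^sup>2 / real n))"
    by (simp add: power_divide)
  also have "\<dots> \<le> B\<^sup>2 * ((1 + j * L) * (card D * ((1 + j * L) + card D * (2 * (real M)\<^sup>2 / real (a ^ j)))))"
  proof (intro mult_left_mono mult_mono)
    have lnQ: "ln (real (Q ^ j)) \<le> j * L"
      using Q1 L by (subst of_nat_power, subst ln_realpow) (auto intro: mult_left_mono)
    have "(\<Sum>n\<in>R. 1 / real n) \<le> 1 + ln (real (Q ^ j))" unfolding R_def by (rule sum_inverse_le) (use aj in auto)
    then show inv: "(\<Sum>n\<in>R. 1 / real n) \<le> 1 + j * L" using lnQ by linarith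
    have "(\<Sum>n\<in>R. (T n)\<^sup>2 / real n) = (\<Sum>n\<in>R. \<Sum>d\<in>D. \<Sum>d'\<in>D. jac d n * jac d' n * (1 / real n))"
      by (simp add: T_def power2_eq_square sum_product sum_divide_distrib)
    also have "\<dots> = (\<Sum>d\<in>D. \<Sum>d'\<in>D. \<Sum>n\<in>R. jac d n * jac d' n * (1 / real n))"
      by (subst sum.swap, intro sum.cong refl sum.swap)
    also have "\<dots> \<le> (\<Sum>d\<in>D. \<Sum>d'\<in>D. (if d = d' then 1 + j * L else 0) + 2 * (real M)\<^sup>2 / real (a ^ j))"
    proof (intro sum_mono)
      fix d d' assume dd: "d \<in> D" "d' \<in> D"
      show "(\<Sum>n\<in>R. jac d n * jac d' n * (1 / real n)) \<le> (if d = d' then 1 + j * L else 0) + 2 * (real M)\<^sup>2 / real (a ^ j)"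
      proof (cases "d = d'")
        case True
        have "(\<Sum>n\<in>R. jac d n * jac d' n * (1 / real n)) \<le> (\<Sum>n\<in>R. 1 / real n)"
        proof (intro sum_mono)
          fix n
          have "jac d n * jac d' n \<le> 1" using True jac_bound[of d n] by (simp add: abs_square_le_1 flip: power2_eq_square)
          then have "jac d n * jac d' n * (1 / real n) \<le> 1 * (1 / real n)" by (intro mult_right_mono) auto
          then show "jac d n * jac d' n * (1 / real n) \<le> 1 / real n" by simp
        qed
        moreover have "0 \<le> 2 * (real M)\<^sup>2 / real (a ^ j)" by simp
        ultimately show ?thesis unfolding if_P[OF True] using inv by linarith
      next
        case False
        have "R = {a ^ j..<Suc (Q ^ j)}" by (auto simp: R_def)
        then have "(\<Sum>n\<in>R. jac d n * jac d' n * (1 / real n)) \<le> 2 * real (d * d') / real (a ^ j)"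
          using jac_orthogonal_weighted[of d d' "a ^ j" "Suc (Q ^ j)"] D(2)[OF dd(1)] D(2)[OF dd(2)] False aj by simp
        also have "\<dots> \<le> 2 * (real M)\<^sup>2 / real (a ^ j)"
        proof -
          have "d * d' \<le> M * M" using D(2)[OF dd(1)] D(2)[OF dd(2)] by (intro mult_le_mono) auto
          then have "real (d * d') \<le> (real M)\<^sup>2" by (metis of_nat_le_iff of_nat_mult power2_eq_square)
          then show ?thesis by (intro divide_right_mono mult_left_mono) auto
        qed
        finally show ?thesis using False by simp
      qed
    qed
    also have "\<dots> = card D * ((1 + j * L) + card D * (2 * (real M)\<^sup>2 / real (a ^ j)))"
      using D(1) by (simp add: sum.distrib algebra_simps)
    finally show "(\<Sum>n\<in>R. (T n)\<^sup>2 / real n) \<le> card D * ((1 + j * L) + card D * (2 * (real M)\<^sup>2 / real (a ^ j)))" .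
  qed (use L0 in \<open>auto intro: sum_nonneg\<close>)
  finally have "real (card D) * (real (card D) * V ^ (2 * j))
      \<le> real (card D) * (B\<^sup>2 * (1 + j * L) * ((1 + j * L) + card D * (2 * (real M)\<^sup>2 / real (a ^ j))))"
    by (simp add: power_mult_distrib power2_eq_square mult_ac flip: power_add mult_2)
  moreover have "real (card D) > 0" using False D(1) by (simp add: card_gt_0_iff)
  ultimately show ?thesis by (simp add: mult_le_cancel_left_pos B_def)
qed

text \<open>Reciprocity in the form \<open>qchar_eq_jac\<close> concerns odd \<open>d\<close>.
  Splitting off the factor 2 and fixing the class modulo 4 leaves four families, in each of which
  the factor \<open>qchar h p\<close> and the sign do not depend on \<open>d1\<close>.\<close>

lemma odd_squarefree_decomposition:
  fixes d :: nat
  assumes "squarefree d"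
  obtains h d1 s where "h \<in> {1, 2}" "s \<in> {1, 3}" "d = h * d1" "odd d1" "squarefree d1" "d1 mod 4 = s"
proof -
  have 1: "\<exists>s\<in>{1, 3}. d1 mod 4 = s" if "odd d1" for d1 :: nat
  proof -
    have "d1 mod 4 = 1 \<or> d1 mod 4 = 3" using that by presburger
    then show ?thesis by blast
  qed
  show ?thesis
  proof (cases "odd d")
    case True
    then show ?thesis using that[of 1 _ d] 1[of d] assms by auto
  next
    case False
    then obtain d1 where d1: "d = 2 * d1" by (auto elim: evenE)
    have sq: "squarefree d1" using assms d1 squarefree_mono[of d1 d] by simp
    have "odd d1"
    proof
      assume "even d1"
      then have "2\<^sup>2 dvd d" using d1 by (auto elim!: evenE)
      then show False using assms squarefreeD[of d 2] by simp
    qed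
    then show ?thesis using that[of 2 _ d1] 1[of d1] d1 sq by auto
  qed
qed

text \<open>The threshold is a fixed fraction of \<open>ln X\<close>, the order of the trivial
  bound, so a power \<open>j\<close> depending on \<open>c\<close> only suffices: for
  \<open>j > 3 / c\<close> the lower end \<open>a ^ j\<close> is at least
  \<open>X ^ 3 / 2 ^ j\<close> and beats the \<open>(D * X)\<^sup>2\<close> of the off-diagonal
  terms. What remains is a power of \<open>ln X\<close>, hence at most
  \<open>X powr \<epsilon>\<close>.\<close>

lemma few_exceptional_characters:
  fixes \<tau> c \<epsilon> :: real and D :: nat
  assumes "\<tau> > 0" "0 < c" "c \<le> 1" "\<epsilon> > 0"
  shows "\<forall>\<^sub>F X in sequentially. \<forall>Q\<le>X. real (card {d. squarefree d \<and> d \<le> D * X \<and>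
     \<tau> * ln (real X) \<le> qsum d (nat \<lfloor>real X powr c\<rfloor>) Q}) \<le> real X powr \<epsilon>"
proof -
  obtain j :: nat where j: "real j > 3 / c" using reals_Archimedean2 by blast
  have j0: "real j > 0" using j assms by (meson divide_pos_pos less_trans zero_less_numeral)
  have cj: "c * real j \<ge> 3" using j assms(2) by (simp add: field_simps)
  define J where "J = real j"
  define K where "K = (fact j)\<^sup>2 * (2 * (real D)\<^sup>2 * 2 ^ j)"
  \<comment> \<open>Half of \<open>\<tau> ^ (2 * j)\<close>: the off-diagonal terms will be absorbed
    into the left-hand side.\<close>
  define t where "t = \<tau> ^ (2 * j) / 2"
  define K' where "K' = 4 * (fact j)\<^sup>2 / t"
  have pos: "J > 0" "K \<ge> 0" "t > 0" "K' > 0" using j0 assms(1) by (auto simp: J_def K_def t_def K'_def)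
  have "\<forall>\<^sub>F X::nat in sequentially. K * ((1 + J * ln (real X)) / real X) < t"
  proof -
    have "(\<lambda>X::nat. (1 + J * ln (real X)) / real X) \<longlonglongrightarrow> 0" using pos(1) by real_asymp
    from tendsto_mult_left[OF this, of K] show ?thesis using pos(3) by (auto dest: order_tendstoD)
  qed
  moreover have "\<forall>\<^sub>F X::nat in sequentially. K' * (1 + J * ln (real X))\<^sup>2 \<le> real X powr \<epsilon>"
    using pos assms(4) by real_asymp
  moreover have "\<forall>\<^sub>F X::nat in sequentially. real X powr c > 4" using assms(2) by real_asymp
  moreover have "\<forall>\<^sub>F X::nat in sequentially. X \<ge> 3" by (rule eventually_ge_at_top)
  ultimately show ?thesis
  proof eventually_elim
    case (elim X)
    define L where "L = ln (real X)"
    define a where "a = nat \<lfloor>real X powr c\<rfloor>"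
    have X0: "real X \<ge> 3" "real X > 0" using elim by auto
    have L0: "L > 0" using X0 by (simp add: L_def)
    have a_real: "real a \<ge> real X powr c / 2" "real a \<le> real X powr c" "a \<ge> 2" using elim(3) unfolding a_def by linarith+
    have "real X powr c \<le> real X powr 1" using assms X0 by (intro powr_mono) auto
    then have aX: "a \<le> X" using a_real X0 by simp
    have "real X ^ 3 = real X powr 3" using X0 by (simp add: powr_numeral)
    also have "\<dots> \<le> real X powr (c * real j)" using X0 cj by (intro powr_mono) auto
    also have "\<dots> = (real X powr c) ^ j" using X0 by (simp add: powr_powr powr_realpow[symmetric])
    also have "\<dots> \<le> (2 * real a) ^ j" using a_real by (intro power_mono) auto
    finally have aj: "real X ^ 3 \<le> 2 ^ j * real (a ^ j)" by (simp add: power_mult_distrib)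
    show ?case
    proof (intro allI impI)
      fix Q assume Q: "Q \<le> X"
      define I where "I = primes_in a Q"
      define Bad where "Bad = {d. squarefree d \<and> d \<le> D * X \<and> \<tau> * L \<le> (\<Sum>p\<in>I. qchar d p * lw p)}"
      define E where "E = (\<lambda>(h, s). {d1. odd d1 \<and> squarefree d1 \<and> d1 mod 4 = s \<and> h * d1 \<in> Bad})"
      have Ip: "prime p" "a \<le> p" "p \<le> X" "2 < p" if "p \<in> I" for p
        using that Q a_real(3) by (auto simp: I_def primes_in_def)
      have cardE: "finite (E (h, s)) \<and> real (card (E (h, s))) \<le> real X powr \<epsilon> / 4" if hs: "h \<in> {1, 2}" "s \<in> {1, 3}" for h s
      proof -
        have d1le: "d1 \<le> D * X" if "d1 \<in> E (h, s)" for d1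
        proof -
          have "h * d1 \<le> D * X" using that by (auto simp: E_def Bad_def)
          moreover have "d1 \<le> h * d1" using hs by auto
          ultimately show ?thesis by (rule le_trans[rotated])
        qed
        have "E (h, s) \<subseteq> {..D * X}" using d1le by blast
        then have fin: "finite (E (h, s))" by (rule finite_subset) simp
        \<comment> \<open>The coefficient depends on the family \<open>(h, s)\<close> and on
          \<open>p\<close>, but not on \<open>d1\<close>, as \<open>large_values_bound\<close>
          demands.\<close>
        define w where "w = (\<lambda>p. qchar h p * qsign s p * lw p)"
        define R where "R = real (card (E (h, s)))"
        have "R * (\<tau> * L) ^ (2 * j) \<le> (fact j * L ^ j)\<^sup>2 * (1 + j * L) * ((1 + j * L) + card (E (h, s)) * (2 * (real (D * X))\<^sup>2 / real (a ^ j)))"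
          unfolding R_def
        proof (rule large_values_bound[where I = I and Q = X and c = w])
          show "finite (E (h, s))" by (rule fin)
          show "finite I" by (simp add: I_def)
          show "1 \<le> a" using a_real by simp
          show "a \<le> X" by (rule aX)
          show "ln (real X) \<le> L" by (simp add: L_def)
          show "0 \<le> \<tau> * L" using assms L0 by simp
          fix p assume p: "p \<in> I"
          show "prime p \<and> a \<le> p \<and> p \<le> X" using Ip[OF p] by simp
          have l: "0 \<le> lw p" using Ip(4)[OF p] by simp
          have "\<bar>qchar h p * qsign s p\<bar> \<le> 1"
            using qchar_bounds[of h p] by (auto simp: qsign_def abs_le_iff abs_mult)
          then have le: "\<bar>qchar h p * qsign s p\<bar> * lw p \<le> 1 * lw p"
            using l by (rule mult_right_mono)
          have "\<bar>w p\<bar> = \<bar>qchar h p * qsign s p\<bar> * \<bar>lw p\<bar>"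
            unfolding w_def by (rule abs_mult)
          also have "\<bar>lw p\<bar> = lw p" using l by (rule abs_of_nonneg)
          finally show "\<bar>w p\<bar> \<le> lw p" using le by linarith
        next
          fix d1 assume d1: "d1 \<in> E (h, s)"
          then show "odd d1 \<and> squarefree d1 \<and> d1 \<le> D * X" using d1le by (auto simp: E_def)
          have "\<tau> * L \<le> (\<Sum>p\<in>I. qchar (h * d1) p * lw p)" using d1 by (auto simp: E_def Bad_def)
          also have "\<dots> = (\<Sum>p\<in>I. w p * jac d1 p)"
          proof (intro sum.cong refl)
            fix p assume p: "p \<in> I"
            have "qsign d1 p = qsign s p" using d1 hs by (auto simp: qsign_def E_def)
            then have "qchar (h * d1) p = qchar h p * (qsign s p * jac d1 p)"
              using qchar_mult[OF Ip(1)[OF p] Ip(4)[OF p], of h d1] qchar_eq_jac[OF Ip(1)[OF p] Ip(4)[OF p], of d1] d1 by (simp add: E_def)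
            then show "qchar (h * d1) p * lw p = w p * jac d1 p" by (simp add: w_def)
          qed
          finally show "\<tau> * L \<le> (\<Sum>p\<in>I. w p * jac d1 p)" .
        qed
        also have "(fact j * L ^ j)\<^sup>2 * (1 + j * L) * ((1 + j * L) + card (E (h, s)) * (2 * (real (D * X))\<^sup>2 / real (a ^ j)))
          = L ^ (2 * j) * ((fact j)\<^sup>2 * (1 + J * L)\<^sup>2 + R * ((fact j)\<^sup>2 * (1 + J * L) * (2 * (real D)\<^sup>2 * (real X)\<^sup>2 / real (a ^ j))))"
          unfolding J_def R_def by (simp add: power_mult_distrib power_mult algebra_simps power2_eq_square add_divide_distrib)
        finally have "L ^ (2 * j) * (R * \<tau> ^ (2 * j)) \<le> L ^ (2 * j) * ((fact j)\<^sup>2 * (1 + J * L)\<^sup>2 + R * ((fact j)\<^sup>2 * (1 + J * L) * (2 * (real D)\<^sup>2 * (real X)\<^sup>2 / real (a ^ j))))"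
          by (simp add: power_mult_distrib mult_ac)
        then have main: "R * (2 * t) \<le> (fact j)\<^sup>2 * (1 + J * L)\<^sup>2 + R * ((fact j)\<^sup>2 * (1 + J * L) * (2 * (real D)\<^sup>2 * (real X)\<^sup>2 / real (a ^ j)))"
          using L0 by (simp add: t_def)
        have JL: "1 + J * L \<ge> 0" using pos L0 by simp
        have "(real X)\<^sup>2 / real (a ^ j) \<le> 2 ^ j / real X"
          using aj a_real X0 by (simp add: divide_simps power3_eq_cube power2_eq_square mult_ac)
        then have "(fact j)\<^sup>2 * (1 + J * L) * (2 * (real D)\<^sup>2) * ((real X)\<^sup>2 / real (a ^ j)) \<le> (fact j)\<^sup>2 * (1 + J * L) * (2 * (real D)\<^sup>2) * (2 ^ j / real X)"
          using JL by (intro mult_left_mono) auto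
        also have "\<dots> = K * ((1 + J * L) / real X)" by (simp add: K_def)
        also have "\<dots> \<le> t" using elim(1) by (simp add: L_def)
        finally have "R * ((fact j)\<^sup>2 * (1 + J * L) * (2 * (real D)\<^sup>2 * (real X)\<^sup>2 / real (a ^ j))) \<le> R * t"
          by (intro mult_left_mono) (auto simp: R_def)
        then have "R * t \<le> (fact j)\<^sup>2 * (1 + J * L)\<^sup>2" using main by simp
        then have "R \<le> K' * (1 + J * L)\<^sup>2 / 4" using pos by (simp add: K'_def field_simps)
        then show ?thesis using elim(2) fin by (simp add: R_def L_def)
      qed
      have "Bad \<subseteq> (\<Union>(h, s)\<in>{1, 2} \<times> {1, 3}. (\<lambda>x. h * x) ` E (h, s))"
      proof
        fix d assume d: "d \<in> Bad"
        then have "squarefree d" by (simp add: Bad_def)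
        then obtain h d1 s where "h \<in> {1, 2}" "s \<in> {1, 3}" "d = h * d1" "odd d1" "squarefree d1" "d1 mod 4 = s"
          by (rule odd_squarefree_decomposition)
        then show "d \<in> (\<Union>(h, s)\<in>{1, 2} \<times> {1, 3}. (\<lambda>x. h * x) ` E (h, s))"
          using d by (auto simp: E_def)
      qed
      then have "card Bad \<le> card (\<Union>x\<in>{1, 2} \<times> {1, 3}. (\<lambda>y. fst x * y) ` E x)"
        using cardE by (intro card_mono) (auto simp: case_prod_beta)
      also have "\<dots> \<le> (\<Sum>x\<in>{1, 2} \<times> {1, 3}. card ((\<lambda>y. fst x * y) ` E x))"
        by (intro card_UN_le) auto
      also have "\<dots> \<le> (\<Sum>x\<in>{1, 2} \<times> {1, 3}. card (E x))"
        using cardE by (intro sum_mono card_image_le) auto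
      finally have "real (card Bad) \<le> (\<Sum>x\<in>{1, 2} \<times> {1, 3}. real (card (E x)))" by (simp flip: of_nat_sum)
      also have "\<dots> \<le> (\<Sum>x\<in>{1, 2::nat} \<times> {1, 3::nat}. real X powr \<epsilon> / 4)"
        using cardE by (intro sum_mono) auto
      also have "\<dots> = real X powr \<epsilon>" by simp
      finally show "real (card {d. squarefree d \<and> d \<le> D * X \<and>
         \<tau> * ln (real X) \<le> qsum d (nat \<lfloor>real X powr c\<rfloor>) Q}) \<le> real X powr \<epsilon>"
        by (simp add: Bad_def I_def L_def a_def)
    qed
  qed
qed

section \<open>Squares in a sieved set\<close>

lemma residue_classes_mono: "B \<subseteq> B' \<Longrightarrow> residue_classes B p \<subseteq> residue_classes B' p"
  by (auto simp: residue_classes_def)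

lemma residue_classes_subset: "p > 0 \<Longrightarrow> residue_classes B p \<subseteq> {..<p}"
  by (auto simp: residue_classes_def)

lemma finite_residue_classes: "p > 0 \<Longrightarrow> finite (residue_classes B p)"
  using residue_classes_subset finite_subset by blast

lemma card_square_roots_mod_le:
  fixes m p :: nat
  assumes "prime p"
  shows "card {c\<in>{..<p}. [c\<^sup>2 = m] (mod p)} \<le> 2"
proof (cases "{c\<in>{..<p}. [c\<^sup>2 = m] (mod p)} = {}")
  case False
  then obtain b where b: "b < p" "[b\<^sup>2 = m] (mod p)" by auto
  have "{c\<in>{..<p}. [c\<^sup>2 = m] (mod p)} \<subseteq> {b, p - b}"
  proof
    fix c assume "c \<in> {c\<in>{..<p}. [c\<^sup>2 = m] (mod p)}"
    then have c: "c < p" "[c\<^sup>2 = b\<^sup>2] (mod p)" using b by (auto intro: cong_trans cong_sym)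
    then have "[int c ^ 2 = int b ^ 2] (mod int p)" using cong_int_iff[of "c\<^sup>2" "b\<^sup>2" p] by simp
    then have "int p dvd int c ^ 2 - int b ^ 2" by (simp add: cong_iff_dvd_diff)
    also have "int c ^ 2 - int b ^ 2 = (int c - int b) * (int c + int b)" by (simp add: algebra_simps power2_eq_square)
    finally have "int p dvd int c - int b \<or> int p dvd int c + int b"
      using assms by (simp add: prime_dvd_mult_iff)
    then show "c \<in> {b, p - b}"
    proof
      assume "int p dvd int c - int b"
      then have "[c = b] (mod p)" by (simp add: cong_int_iff[symmetric] cong_iff_dvd_diff)
      then show ?thesis using b c by (simp add: cong_def)
    next
      assume "int p dvd int c + int b"
      then have "p dvd c + b" by (metis int_dvd_int_iff of_nat_add)
      then obtain k where k: "c + b = p * k" by (elim dvdE)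
      have "p * k < p * 2" using k b c by linarith
      then have "k = 0 \<or> k = 1" using b by auto
      then show ?thesis using k by auto
    qed
  qed
  then have "card {c\<in>{..<p}. [c\<^sup>2 = m] (mod p)} \<le> card {b, p - b}" by (intro card_mono) auto
  also have "\<dots> \<le> 2" by (simp add: card_insert_if)
  finally show ?thesis .
next
  case True
  show ?thesis unfolding True by simp
qed

text \<open>The set attached to one quadratic, after removal of the finitely many elements at which
  \<open>\<alpha> * n + \<beta>\<close> could fail to be positive. The bounds on \<open>p0\<close>
  ensure that the primes in use are odd and do not divide \<open>\<alpha>\<close>.\<close>

locale sieved_set =
  fixes A :: "nat set" and \<alpha> p0 :: nat and \<beta> :: int
  assumes pos: "\<And>n. n \<in> A \<Longrightarrow> 0 < n \<and> 0 < int \<alpha> * int n + \<beta>"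
    and sieve: "\<And>p. prime p \<Longrightarrow> p > p0 \<Longrightarrow> 2 * real (card (residue_classes A p)) \<le> real p + 1"
    and \<alpha>: "0 < \<alpha>" "\<alpha> \<le> p0" "2 \<le> p0"
begin

definition val :: "nat \<Rightarrow> nat" where "val n = nat (int \<alpha> * int n + \<beta>)"

definition Sq :: "nat set" where "Sq = {n\<in>A. \<exists>c. val n = c\<^sup>2}"

definition NS :: "nat set" where "NS = A - Sq"

abbreviation Sq_upto :: "nat \<Rightarrow> nat set" where "Sq_upto X \<equiv> Sq \<inter> {1..X}"

abbreviation NS_upto :: "nat \<Rightarrow> nat set" where "NS_upto X \<equiv> NS \<inter> {1..X}"

definition D :: nat where "D = \<alpha> + nat \<bar>\<beta>\<bar>"

definition rt :: "nat \<Rightarrow> nat" where "rt n = (SOME c. val n = c\<^sup>2)"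

lemma int_val: "n \<in> A \<Longrightarrow> int (val n) = int \<alpha> * int n + \<beta>"
  using pos[of n] by (simp add: val_def)

lemma val_pos: "n \<in> A \<Longrightarrow> 0 < val n"
  using pos[of n] by (simp add: val_def)

lemma D_pos: "D > 0"
  using \<alpha> by (simp add: D_def)

lemma val_le:
  assumes "n \<in> A" "n \<le> X"
  shows "val n \<le> D * X"
proof -
  have "1 \<le> int X" using pos[OF assms(1)] assms(2) by simp
  have "int (val n) = int \<alpha> * int n + \<beta>" using assms by (rule_tac int_val)
  also have "\<dots> \<le> int \<alpha> * int X + \<bar>\<beta>\<bar> * int X"
    using assms \<open>1 \<le> int X\<close> mult_left_mono[of 1 "int X" "\<bar>\<beta>\<bar>"] by (intro add_mono mult_left_mono) auto
  also have "\<dots> = int (D * X)" by (simp add: D_def algebra_simps)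
  finally show ?thesis by (simp only: of_nat_le_iff)
qed

lemma val_inj: "inj_on val A"
proof (rule inj_onI)
  fix x y assume "x \<in> A" "y \<in> A" "val x = val y"
  then have "int \<alpha> * int x = int \<alpha> * int y" using int_val[of x] int_val[of y] by linarith
  then show "x = y" using \<alpha> by auto
qed

lemma large_prime:
  assumes "prime p" "p > p0"
  shows "2 < p" "\<not> p dvd \<alpha>" "0 < p"
  using assms \<alpha> by (auto dest: dvd_imp_le)

lemma val_cong:
  assumes "n \<in> A" "n' \<in> A" "n mod p = n' mod p"
  shows "[val n = val n'] (mod p)"
proof -
  have "[n = n'] (mod p)" using assms(3) by (simp add: cong_def)
  then have "[int n = int n'] (mod int p)" by (simp only: cong_int_iff)
  then have "[int \<alpha> * int n + \<beta> = int \<alpha> * int n' + \<beta>] (mod int p)" by (intro cong_add cong_mult) auto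
  then show ?thesis using int_val assms by (simp add: cong_int_iff[symmetric])
qed

lemma SqD: "n \<in> Sq \<Longrightarrow> n \<in> A" "n \<in> Sq \<Longrightarrow> val n = (rt n)\<^sup>2"
  unfolding Sq_def rt_def by (auto intro: someI)

lemma NSD: "n \<in> NS \<Longrightarrow> n \<in> A" "n \<in> NS \<Longrightarrow> val n \<noteq> c\<^sup>2"
  by (auto simp: NS_def Sq_def)

lemma rt_inj: "inj_on rt Sq"
  by (rule inj_onI) (metis SqD inj_on_eq_iff[OF val_inj])

text \<open>The symbol of \<open>val n\<close> depends only on \<open>n mod p\<close> and is never
  -1 at a square, so \<open>B\<close> and \<open>F\<close> occupy disjoint classes and compete for
  the at most \<open>(p + 1) / 2\<close> available ones. Both main estimates rest on this
  competition.\<close>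

lemma card_residue_classes_split:
  assumes p: "prime p" "p > p0" and B: "B \<subseteq> Sq" and F: "F \<subseteq> A" "\<And>n. n \<in> F \<Longrightarrow> qchar (val n) p = -1"
  shows "2 * (real (card (residue_classes B p)) + real (card (residue_classes F p))) \<le> real p + 1"
proof -
  note lp = large_prime[OF p]
  have disj: "residue_classes B p \<inter> residue_classes F p = {}"
  proof (rule ccontr)
    assume "\<not> ?thesis"
    then obtain b f where bf: "b \<in> B" "f \<in> F" "b mod p = f mod p" by (auto simp: residue_classes_def)
    then have bS: "b \<in> Sq" using B by auto
    have "[val b = val f] (mod p)" using bf SqD(1)[OF bS] F(1) by (intro val_cong) auto
    then have "qchar (val b) p = -1" using qchar_cong F(2)[OF bf(2)] by metis
    moreover have "qchar (val b) p = qchar (rt b) p * qchar (rt b) p"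
      using SqD(2)[OF bS] qchar_mult[OF p(1) lp(1)] by (simp add: power2_eq_square)
    ultimately show False using qchar_range[of "rt b" p] by auto
  qed
  have "card (residue_classes B p) + card (residue_classes F p) = card (residue_classes B p \<union> residue_classes F p)"
    using disj lp(3) by (intro card_Un_disjoint[symmetric] finite_residue_classes) auto
  also have "\<dots> \<le> card (residue_classes A p)"
    using B F(1) SqD(1) lp(3) residue_classes_mono by (intro card_mono finite_residue_classes) (auto simp: residue_classes_def)
  finally have "real (card (residue_classes B p) + card (residue_classes F p)) \<le> real (card (residue_classes A p))"
    by (simp only: of_nat_le_iff)
  then show ?thesis using sieve[OF p] by simp
qed

text \<open>A class of \<open>n\<close> fixes \<open>val n\<close> modulo \<open>p\<close> and
  leaves at most two classes for its root. Passing to roots thus at most doubles the number of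
  classes, while the interval shrinks to its square root.\<close>

lemma card_rt_mod_le:
  assumes p: "prime p" "p > p0" and B: "B \<subseteq> Sq"
  shows "card ((\<lambda>n. rt n mod p) ` B) \<le> 2 * card (residue_classes B p)"
proof -
  note lp = large_prime[OF p]
  define rep where "rep = (\<lambda>v. SOME n. n \<in> B \<and> n mod p = v)"
  have rep: "rep v \<in> B" "rep v mod p = v" if "v \<in> residue_classes B p" for v
    using someI_ex[of "\<lambda>n. n \<in> B \<and> n mod p = v"] that unfolding rep_def residue_classes_def by auto
  have "(\<lambda>n. rt n mod p) ` B \<subseteq> (\<Union>v\<in>residue_classes B p. {c\<in>{..<p}. [c\<^sup>2 = val (rep v)] (mod p)})"
  proof safe
    fix n assume n: "n \<in> B"
    have v: "n mod p \<in> residue_classes B p" using n by (auto simp: residue_classes_def)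
    have nS: "n \<in> Sq" "rep (n mod p) \<in> Sq" using n B rep[OF v] by auto
    have "[(rt n mod p)\<^sup>2 = (rt n)\<^sup>2] (mod p)" by (intro cong_pow) (simp add: cong_def)
    also have "(rt n)\<^sup>2 = val n" using SqD(2)[OF nS(1)] by simp
    also have "[val n = val (rep (n mod p))] (mod p)"
      using rep[OF v] SqD(1)[OF nS(1)] SqD(1)[OF nS(2)] by (intro val_cong) auto
    finally have "[(rt n mod p)\<^sup>2 = val (rep (n mod p))] (mod p)" .
    then have "rt n mod p \<in> {c\<in>{..<p}. [c\<^sup>2 = val (rep (n mod p))] (mod p)}" using lp(3) by simp
    then show "rt n mod p \<in> (\<Union>v\<in>residue_classes B p. {c\<in>{..<p}. [c\<^sup>2 = val (rep v)] (mod p)})"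
      by (rule UN_I[OF v])
  qed
  then have "card ((\<lambda>n. rt n mod p) ` B) \<le> card (\<Union>v\<in>residue_classes B p. {c\<in>{..<p}. [c\<^sup>2 = val (rep v)] (mod p)})"
    using finite_residue_classes[OF lp(3)] by (intro card_mono) auto
  also have "\<dots> \<le> (\<Sum>v\<in>residue_classes B p. card {c\<in>{..<p}. [c\<^sup>2 = val (rep v)] (mod p)})"
    using finite_residue_classes[OF lp(3)] by (intro card_UN_le) auto
  also have "\<dots> \<le> (\<Sum>v\<in>residue_classes B p. 2)"
    by (intro sum_mono card_square_roots_mod_le p)
  finally show ?thesis by (simp add: mult.commute)
qed

text \<open>The sieve acts on the roots. If \<open>u > 0\<close> members of a fixed finite set
  \<open>F\<close> of non-squares are non-residues modulo a large \<open>p\<close>, the squares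
  occupy at most \<open>(p + 1) / 2 - u\<close> classes and the roots at most
  \<open>p + 1 - 2 * u\<close>, so at least \<open>2 * u - 1 \<ge> u\<close> classes contain no
  root.\<close>

lemma Sq_upper_bound:
  assumes inf: "infinite NS"
  shows "\<forall>\<^sub>F X in sequentially. real (card (Sq_upto X)) \<le> real X powr (1/2) / ln (real X) ^ k"
proof -
  \<comment> \<open>Each member of \<open>F\<close> contributes 1/8 to the density of every far
    window, and \<open>K / 8 = 2 * (k + 1) + 2\<close> is what \<open>sieve_log_power\<close> needs
    for the exponent \<open>k + 1\<close>.\<close>
  define K where "K = 16 * (k + 2)"
  obtain F where F: "F \<subseteq> NS" "finite F" "card F = K"
    using infinite_arbitrarily_large[OF inf] by metis
  \<comment> \<open>Beyond all elements of \<open>F\<close>, so that these stay distinct modulo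
    \<open>p\<close>.\<close>
  define p1 where "p1 = Max (insert p0 F)"
  have p1: "p1 \<ge> p0" "\<And>n. n \<in> F \<Longrightarrow> n \<le> p1" using F(2) by (auto simp: p1_def)
  define U where "U = (\<lambda>p. {n\<in>F. qchar (val n) p = -1})"
  define \<Theta> where "\<Theta> = (\<lambda>p. {..<p} - (\<lambda>n. rt n mod p) ` Sq)"
  have big: "card (U p) \<le> card (\<Theta> p)" if p: "prime p" "p > p1" for p
  proof (cases "U p = {}")
    case False
    have pp: "p > p0" using p p1 by simp
    note lp = large_prime[OF p(1) pp]
    have "inj_on (\<lambda>n. n mod p) (U p)"
    proof (rule inj_onI)
      fix x y assume xy: "x \<in> U p" "y \<in> U p" "x mod p = y mod p"
      then have "x < p" "y < p" using p1(2)[of x] p1(2)[of y] p(2) by (auto simp: U_def)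
      then show "x = y" using xy by simp
    qed
    then have cU: "card (residue_classes (U p) p) = card (U p)" unfolding residue_classes_def by (rule card_image)
    have "2 * (real (card (residue_classes Sq p)) + real (card (residue_classes (U p) p))) \<le> real p + 1"
      using F(1) NSD(1) by (intro card_residue_classes_split p pp) (auto simp: U_def)
    then have "real (2 * card (residue_classes Sq p) + 2 * card (U p)) \<le> real (p + 1)" unfolding cU by simp
    then have "2 * card (residue_classes Sq p) + 2 * card (U p) \<le> p + 1" by (simp only: of_nat_le_iff)
    moreover have "card (U p) \<ge> 1" using False F(2) by (simp add: U_def Suc_le_eq card_gt_0_iff)
    moreover have "card ((\<lambda>n. rt n mod p) ` Sq) \<le> 2 * card (residue_classes Sq p)"
      by (intro card_rt_mod_le p pp) auto
    moreover have "card (\<Theta> p) = p - card ((\<lambda>n. rt n mod p) ` Sq)"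
      unfolding \<Theta>_def using lp(3) by (subst card_Diff_subset) (auto intro: finite_subset[of _ "{..<p}"])
    ultimately show ?thesis by linarith
  qed simp
  \<comment> \<open>Exactly \<open>card (U p)\<close> of the free classes are kept: this number is
    at most \<open>K\<close>, and the sieve works with a bounded number of classes.\<close>
  have "\<exists>T. prime p \<and> p > p1 \<longrightarrow> T \<subseteq> \<Theta> p \<and> card T = card (U p)" for p
    using big[of p] obtain_subset_with_card_n[of "card (U p)" "\<Theta> p"] by metis
  then obtain \<Omega> where \<Omega>: "\<And>p. prime p \<Longrightarrow> p > p1 \<Longrightarrow> \<Omega> p \<subseteq> \<Theta> p \<and> card (\<Omega> p) = card (U p)" by metis
  have "\<forall>\<^sub>F z in sequentially. \<forall>n\<in>F. 1/8 \<le> (\<Sum>p\<in>{p\<in>primes_in z (z^4). qchar (val n) p = -1}. 1 / real p)"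
    using F(1,2) NSD val_pos by (intro eventually_ball_finite ballI sum_nonresidues_window) blast+
  moreover have "\<forall>\<^sub>F z in sequentially. z \<ge> p1" by (rule eventually_ge_at_top)
  ultimately have win: "\<forall>\<^sub>F z in sequentially. real (2 * (k + 1) + 2) \<le> (\<Sum>p\<in>primes_in z (z ^ 4). real (card (\<Omega> p)) / real p)"
  proof eventually_elim
    case (elim z)
    have "real (2 * (k + 1) + 2) = (\<Sum>n\<in>F. 1/8)" using F by (simp add: K_def)
    also have "\<dots> \<le> (\<Sum>n\<in>F. \<Sum>p\<in>{p\<in>primes_in z (z^4). qchar (val n) p = -1}. 1 / real p)"
      using elim(1) by (intro sum_mono) auto
    also have "\<dots> = (\<Sum>n\<in>F. \<Sum>p\<in>primes_in z (z^4). if qchar (val n) p = -1 then 1 / real p else 0)"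
      by (simp only: sum.inter_filter[OF finite_primes_in])
    also have "\<dots> = (\<Sum>p\<in>primes_in z (z^4). \<Sum>n\<in>F. if qchar (val n) p = -1 then 1 / real p else 0)"
      by (rule sum.swap)
    also have "\<dots> = (\<Sum>p\<in>primes_in z (z^4). real (card (U p)) / real p)"
      using F(2) by (intro sum.cong refl) (simp add: U_def sum.If_cases Int_def)
    also have "\<dots> = (\<Sum>p\<in>primes_in z (z ^ 4). real (card (\<Omega> p)) / real p)"
      using \<Omega> elim(2) by (intro sum.cong refl) (auto simp: primes_in_def)
    finally show ?case .
  qed
  \<comment> \<open>The additional logarithm absorbs the factor \<open>sqrt D\<close> and the
    passage from \<open>ln (sqrt (D * X))\<close> to \<open>ln X\<close>.\<close>
  have ev: "\<forall>\<^sub>F Y in sequentially. real (card (rt ` Sq \<inter> {..<Y})) \<le> real Y / ln (real Y) ^ (k + 1)"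
  proof (rule sieve_log_power[OF _ win, of p1 K])
    fix p assume p: "prime p" "p > p1"
    have "card (U p) \<le> K" using F card_mono[of F "U p"] by (auto simp: U_def)
    moreover have "\<Theta> p \<subseteq> {..<p}" "\<forall>c\<in>rt ` Sq. c mod p \<notin> \<Theta> p" by (auto simp: \<Theta>_def)
    ultimately show "\<Omega> p \<subseteq> {..<p} \<and> card (\<Omega> p) \<le> K \<and> (\<forall>c\<in>rt ` Sq. c mod p \<notin> \<Omega> p)"
      using \<Omega>[OF p] by auto
  qed (auto simp: K_def)
  define Y where "Y = (\<lambda>X. nat \<lfloor>sqrt (real (D * X))\<rfloor> + 1)"
  have "filterlim (\<lambda>X. real D * real X) at_top sequentially"
    using D_pos by real_asymp
  then have "filterlim (\<lambda>X. sqrt (real (D * X))) at_top sequentially"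
    by (auto intro: filterlim_compose[OF sqrt_at_top])
  then have "filterlim Y at_top sequentially"
    unfolding Y_def by (intro filterlim_at_top_mono[OF filterlim_compose[OF filterlim_nat_sequentially filterlim_compose[OF filterlim_floor_sequentially]]]) auto
  from eventually_compose_filterlim[OF ev this]
  have "\<forall>\<^sub>F X in sequentially. real (card (rt ` Sq \<inter> {..<Y X})) \<le> real (Y X) / ln (real (Y X)) ^ (k + 1)" .
  moreover have "\<forall>\<^sub>F X::nat in sequentially. (sqrt (real D * real X) + 1) / ln (sqrt (real D * real X)) ^ (k + 1) \<le> real X powr (1/2) / ln (real X) ^ k"
  proof -
    have "\<forall>\<^sub>F X::nat in sequentially. (sqrt (real D * real X) + 1) / ln (sqrt (real D * real X)) powr (real k + 1) \<le> real X powr (1/2) / ln (real X) powr real k"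
      using D_pos by real_asymp
    moreover have "\<forall>\<^sub>F X::nat in sequentially. ln (real X) > 0" by real_asymp
    moreover have "\<forall>\<^sub>F X::nat in sequentially. ln (sqrt (real D * real X)) > 0" using D_pos by real_asymp
    ultimately show ?thesis
    proof eventually_elim
      case (elim X)
      have "ln (sqrt (real D * real X)) powr (real k + 1) = ln (sqrt (real D * real X)) ^ (k + 1)"
        using powr_realpow[OF elim(3), of "k + 1"] by (simp add: add.commute)
      then show ?case using elim(1) powr_realpow[OF elim(2), of k] by simp
    qed
  qed
  moreover have "\<forall>\<^sub>F X::nat in sequentially. sqrt (real D * real X) > 2"
    using D_pos by real_asymp
  ultimately show ?thesis
  proof eventually_elim
    case (elim X)
    have rtY: "rt n \<in> rt ` Sq \<inter> {..<Y X}" if "n \<in> Sq_upto X" for n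
    proof -
      have "(rt n)\<^sup>2 \<le> D * X" using that SqD[of n] val_le[of n X] by auto
      then have "(real (rt n))\<^sup>2 \<le> real (D * X)" by (metis of_nat_le_iff of_nat_power)
      then have "real (rt n) \<le> sqrt (real (D * X))" by (rule real_le_rsqrt)
      then have "rt n < Y X" unfolding Y_def by linarith
      then show ?thesis using that by auto
    qed
    have "card (Sq_upto X) \<le> card (rt ` Sq \<inter> {..<Y X})"
      using rtY rt_inj by (intro card_inj_on_le[of rt]) (auto intro: inj_on_subset)
    then have "real (card (Sq_upto X)) \<le> real (Y X) / ln (real (Y X)) ^ (k + 1)" using elim(1) by linarith
    also have "\<dots> \<le> (sqrt (real D * real X) + 1) / ln (sqrt (real D * real X)) ^ (k + 1)"
    proof (rule frac_le)
      define s where "s = sqrt (real D * real X)"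
      have s: "s > 2" "real (Y X) \<ge> s" "real (Y X) \<le> s + 1"
        unfolding Y_def s_def using elim(3) by (simp_all, linarith+)
      then have l: "0 < ln s" "ln s \<le> ln (real (Y X))" by auto
      show "real (Y X) \<le> sqrt (real D * real X) + 1" using s by (simp add: s_def)
      show "ln (sqrt (real D * real X)) ^ (k + 1) \<le> ln (real (Y X)) ^ (k + 1)"
        unfolding s_def[symmetric] using l by (intro power_mono) auto
      show "0 < ln (sqrt (real D * real X)) ^ (k + 1)"
        unfolding s_def[symmetric] using l by simp
      show "0 \<le> sqrt (real D * real X) + 1" using s by (simp add: s_def)
    qed
    finally show ?case using elim(2) by linarith
  qed
qed

text \<open>The guess of \<open>2 * M / p\<close> roots per class would be exact if the squares
  filled \<open>p / 4\<close> classes evenly; it makes the bound linear in the number of classes.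
  The roots lie below \<open>sqrt (D * X)\<close>, so the larger sieve allows only
  \<open>ln X / 2 + O(1)\<close>. At \<open>Q = X powr (1/4 + \<eta>)\<close> the left-hand side is
  about \<open>2 * \<eta> * ln X\<close>: on weighted average the squares occupy more than
  \<open>p / 4\<close> classes.\<close>

lemma Sq_sieve:
  obtains C where "\<And>X Q. X \<ge> 1 \<Longrightarrow> Q \<ge> 1 \<Longrightarrow> Q \<le> card (Sq_upto X) \<Longrightarrow>
     2 * ln (real Q) - ln (real X) / 2 - C \<le>
     (\<Sum>p\<in>primes_in p0 Q. lw p * (8 * real (card (residue_classes (Sq_upto X) p)) / real p - 2))"
proof -
  obtain C1 where C1: "\<And>n. n \<ge> 1 \<Longrightarrow> ln (real n) - C1 \<le> lw_sum p0 n"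
    using mertens_lower_from by blast
  define C where "C = ln (real D) / 2 + ln 4 + 2 * C1"
  have "2 * ln (real Q) - ln (real X) / 2 - C \<le>
     (\<Sum>p\<in>primes_in p0 Q. lw p * (8 * real (card (residue_classes (Sq_upto X) p)) / real p - 2))"
    if XQ: "X \<ge> 1" "Q \<ge> 1" "Q \<le> card (Sq_upto X)" for X Q
  proof -
    define S where "S = Sq_upto X"
    define M where "M = real (card S)"
    have M: "M \<ge> real Q" "M > 0" using XQ by (auto simp: M_def S_def)
    have finS: "finite S" by (simp add: S_def)
    define Z where "Z = sqrt (real (D * X))"
    have Z1: "Z \<ge> 1" using D_pos XQ by (simp add: Z_def Suc_le_eq flip: of_nat_mult)
    have rtZ: "real (rt n) \<le> Z" if "n \<in> S" for n
    proof -
      have "(rt n)\<^sup>2 \<le> D * X" using that SqD[of n] val_le[of n X] by (auto simp: S_def)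
      then have "(real (rt n))\<^sup>2 \<le> real (D * X)" by (metis of_nat_le_iff of_nat_power)
      then show ?thesis unfolding Z_def by (rule real_le_rsqrt)
    qed
    have up: "(\<Sum>p\<in>primes_in p0 Q. ln (real p) * collisions (\<lambda>n. rt n mod p) S) \<le> M\<^sup>2 * (ln Z + ln 4)"
      unfolding M_def using rtZ Z1 finS XQ(3) rt_inj
      by (intro larger_sieve_primes) (auto simp: S_def intro: inj_on_subset)
    define s where "s = (\<lambda>p. real (card (residue_classes S p)))"
    have coll: "M\<^sup>2 * (1 / real p * (4 - 8 * s p / real p)) \<le> collisions (\<lambda>n. rt n mod p) S" if p: "p \<in> primes_in p0 Q" for p
    proof -
      note pD = primes_inD[OF p]
      define V where "V = (\<lambda>n. rt n mod p) ` S"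
      have V: "real (card V) \<le> 2 * s p"
        using card_rt_mod_le[OF pD(1,2), of S] by (simp add: V_def s_def S_def flip: of_nat_mult)
      have "(\<Sum>i\<in>S. 2 * (2 * M / real p)) - (\<Sum>v\<in>V. (2 * M / real p)\<^sup>2) \<le> collisions (\<lambda>n. rt n mod p) S"
        using finS by (intro collisions_ge[where l = "\<lambda>_. 2 * M / real p"]) (auto simp: V_def)
      moreover have "(\<Sum>i\<in>S. 2 * (2 * M / real p)) = 4 * M\<^sup>2 / real p"
        by (simp add: M_def power2_eq_square)
      moreover have "(\<Sum>v\<in>V. (2 * M / real p)\<^sup>2) \<le> 2 * s p * (2 * M / real p)\<^sup>2"
        using V by (simp add: mult_right_mono)
      moreover have "4 * M\<^sup>2 / real p - 2 * s p * (2 * M / real p)\<^sup>2 = M\<^sup>2 * (1 / real p * (4 - 8 * s p / real p))"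
        by (simp add: algebra_simps power2_eq_square diff_divide_distrib)
      ultimately show ?thesis by linarith
    qed
    have "M\<^sup>2 * (\<Sum>p\<in>primes_in p0 Q. lw p * (4 - 8 * s p / real p))
      = (\<Sum>p\<in>primes_in p0 Q. ln (real p) * (M\<^sup>2 * (1 / real p * (4 - 8 * s p / real p))))"
      by (simp add: sum_distrib_left mult_ac)
    also have "\<dots> \<le> (\<Sum>p\<in>primes_in p0 Q. ln (real p) * collisions (\<lambda>n. rt n mod p) S)"
      using coll by (intro sum_mono mult_left_mono) (auto dest: primes_inD)
    also note up
    finally have "(\<Sum>p\<in>primes_in p0 Q. lw p * (4 - 8 * s p / real p)) \<le> ln Z + ln 4"
      using M(2) by (simp add: mult_le_cancel_left_pos)
    moreover have "(\<Sum>p\<in>primes_in p0 Q. lw p * (4 - 8 * s p / real p))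
       = 2 * lw_sum p0 Q - (\<Sum>p\<in>primes_in p0 Q. lw p * (8 * s p / real p - 2))"
      by (simp add: sum_distrib_left algebra_simps sum.distrib sum_subtractf add_divide_distrib diff_divide_distrib)
    moreover have "ln Z = ln (real D) / 2 + ln (real X) / 2"
      using D_pos XQ by (simp add: Z_def ln_sqrt ln_mult)
    moreover have "ln (real Q) - C1 \<le> lw_sum p0 Q" by (rule C1[OF XQ(2)])
    ultimately show ?thesis unfolding C_def s_def S_def by argo
  qed
  then show ?thesis by (rule that)
qed

end

section \<open>Non-squares in a sieved set\<close>

lemma sum_ln_over_square_bounded:
  obtains T where "\<And>a n. (\<Sum>p\<in>primes_in a n. lw p * (1 / real p)) \<le> T"
proof -
  have "(\<Sum>p\<in>primes_in a n. lw p * (1 / real p)) \<le> (\<Sum>k. ln (real k) / (real k * (real k - 1)))" for a n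
  proof -
    have "(\<Sum>p\<in>primes_in a n. lw p * (1 / real p)) \<le> (\<Sum>p\<in>primes_in a n. ln (real p) / (real p * (real p - 1)))"
    proof (intro sum_mono)
      fix p assume "p \<in> primes_in a n"
      then have "2 \<le> p" "ln (real p) > 0" by (auto dest: primes_inD)
      then have "ln (real p) / (real p * real p) \<le> ln (real p) / (real p * (real p - 1))"
        by (intro divide_left_mono mult_left_mono) auto
      then show "lw p * (1 / real p) \<le> ln (real p) / (real p * (real p - 1))" by simp
    qed
    also have "\<dots> \<le> (\<Sum>k. ln (real k) / (real k * (real k - 1)))"
    proof (rule sum_le_suminf[OF summable_ln_over_mult])
      show "0 \<le> ln (real k) / (real k * (real k - 1))" for k by (cases "k = 0") auto
    qed auto
    finally show ?thesis .
  qed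
  then show ?thesis by (rule that)
qed

lemma ln_le_powr:
  assumes "0 < y" "y \<le> x powr c" "0 < (x::real)"
  shows "ln y \<le> c * ln x"
proof -
  have "ln y \<le> ln (x powr c)" using assms by (subst ln_le_cancel_iff) auto
  then show ?thesis using assms by (simp add: ln_powr)
qed

text \<open>By \<open>sum_qchar_le\<close> and Mertens the sum over all primes up to
  \<open>Q\<close> is at most \<open>2 * ln d + O(1)\<close>, and discarding the primes up to
  \<open>X powr c\<close> costs at most \<open>c * ln X + O(1)\<close>; hence the condition
  \<open>2 * \<delta> + c < \<theta>\<close>.\<close>

lemma small_characters:
  fixes c \<delta> \<theta> :: real
  assumes "0 < c" "0 < \<delta>" "2 * \<delta> + c < \<theta>"
  shows "\<forall>\<^sub>F X in sequentially. \<forall>d Q. 0 < d \<longrightarrow> (\<forall>b. d \<noteq> b\<^sup>2) \<longrightarrow> real d \<le> real X powr \<delta> \<longrightarrow>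
     nat \<lfloor>real X powr c\<rfloor> \<le> Q \<longrightarrow>
     qsum d (nat \<lfloor>real X powr c\<rfloor>) Q < \<theta> * ln (real X)"
proof -
  obtain C where C: "C > 0" "\<And>n. n \<ge> 1 \<Longrightarrow> ln (real n) - C \<le> lw_sum 0 n"
    using mertens_lower by blast
  define r where "r = \<theta> - (2 * \<delta> + c)"
  have r: "r > 0" using assms by (simp add: r_def)
  have "\<forall>\<^sub>F X::nat in sequentially. r * ln (real X) > 5 * ln 4 + C" using r by real_asymp
  moreover have "\<forall>\<^sub>F X::nat in sequentially. real X powr c > 2" using assms by real_asymp
  moreover have "\<forall>\<^sub>F X::nat in sequentially. X > 1" by (rule eventually_gt_at_top)
  ultimately show ?thesis
  proof eventually_elim
    case (elim X)
    define a where "a = nat \<lfloor>real X powr c\<rfloor>"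
    have a: "a \<ge> 1" "real a \<le> real X powr c" using elim(2) unfolding a_def by linarith+
    show ?case
    proof (intro allI impI)
      fix d Q :: nat
      assume d: "0 < d" "\<forall>b. d \<noteq> b\<^sup>2" "real d \<le> real X powr \<delta>" and Q: "nat \<lfloor>real X powr c\<rfloor> \<le> Q"
      have Q1: "Q \<ge> 1" "a \<le> Q" using Q a by (simp_all add: a_def)
      have lnd: "ln (real d) \<le> \<delta> * ln (real X)" using d elim by (intro ln_le_powr) auto
      have lna: "ln (real a) \<le> c * ln (real X)" using a elim by (intro ln_le_powr) auto
      define S1 S2 S3 S4 where "S1 = qsum d 0 Q" and "S2 = lw_sum 0 Q"
        and "S3 = qsum d 0 a" and "S4 = qsum d a Q"
      have "S2 + S1 \<le> ln (real Q) + 2 * ln (real d) + 4 * ln 4"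
        using sum_qchar_le[of d Q] d Q1 by (simp add: S1_def S2_def algebra_simps sum.distrib add_divide_distrib)
      moreover have "ln (real Q) - C \<le> S2" using C(2)[OF Q1(1)] by (simp add: S2_def)
      moreover have "S1 = S3 + S4" unfolding S1_def S3_def S4_def using Q1 by (intro sum_primes_in_split) auto
      moreover have "- S3 \<le> ln (real a) + ln 4"
      proof -
        have "- S3 = (\<Sum>p\<in>primes_in 0 a. - qchar d p * lw p)" by (simp add: S3_def sum_negf)
        also have "\<dots> \<le> (\<Sum>p\<in>primes_in 0 a. 1 * lw p)"
        proof (intro sum_mono mult_right_mono)
          fix p assume "p \<in> primes_in 0 a"
          then show "0 \<le> lw p" by (auto dest: primes_inD)
          show "- qchar d p \<le> 1" using qchar_bounds(1)[of d p] by simp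
        qed
        finally show ?thesis using mertens_upper[OF a(1), of 0] by simp
      qed
      moreover have "r * ln (real X) = \<theta> * ln (real X) - 2 * (\<delta> * ln (real X)) - c * ln (real X)"
        by (simp add: r_def algebra_simps)
      ultimately have "S4 < \<theta> * ln (real X)" using lnd lna elim(1) by argo
      then show "qsum d (nat \<lfloor>real X powr c\<rfloor>) Q < \<theta> * ln (real X)"
        by (simp only: S4_def a_def)
    qed
  qed
qed

context sieved_set
begin

text \<open>The symbol of \<open>val n\<close>, but with value 1 where \<open>p\<close> divides
  \<open>val n\<close>, so that \<open>2 - \<epsilon> * nr n p\<close> takes just the two values
  \<open>2 - \<epsilon>\<close> and \<open>2 + \<epsilon>\<close>.\<close>

definition nr :: "nat \<Rightarrow> nat \<Rightarrow> real" where
  "nr n p = (if qchar (val n) p = -1 then -1 else 1)"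

lemma nr_bounds: "nr n p \<le> 1" "-1 \<le> nr n p"
  by (auto simp: nr_def)

text \<open>Away from the divisors of \<open>val n\<close> the symbol is that of the squarefree
  part, so many \<open>n\<close> share one character. A prime dividing \<open>val n\<close> is
  charged 2, which covers the worst case of 1 against -1.\<close>

lemma nr_le:
  assumes "n \<in> A" "prime p" "2 < p"
  shows "nr n p \<le> qchar (squarefree_part (val n)) p + (if p dvd val n then 2 else 0)"
proof (cases "p dvd val n")
  case True
  then show ?thesis using nr_bounds(1)[of n p] qchar_bounds(1)[of "squarefree_part (val n)" p] by simp
next
  case False
  have eq: "val n = squarefree_part (val n) * (square_part (val n) * square_part (val n))"
    using squarefree_decompose[of "val n"] by (simp add: power2_eq_square)
  define d t where "d = squarefree_part (val n)" and "t = square_part (val n)"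
  have "\<not> p dvd t" using False eq unfolding t_def by (metis dvd_mult)
  then have "qchar t p * qchar t p = 1" using qchar_range[of t p] qchar_eq_0_iff[of t p] by auto
  moreover have "qchar (val n) p = qchar d p * (qchar t p * qchar t p)"
    using qchar_mult[OF assms(2,3)] eq unfolding d_def t_def by metis
  ultimately have "qchar (val n) p = qchar d p" by simp
  moreover have "qchar (val n) p \<noteq> 0" using False qchar_eq_0_iff by blast
  ultimately show ?thesis using False qchar_range[of "val n" p] by (auto simp: nr_def d_def)
qed

text \<open>Classes of residues and of non-residues get different weights \<open>2 - \<epsilon>\<close> and \<open>2 + \<epsilon>\<close>.
  As \<open>s\<close> residue classes are occupied by squares, at most \<open>(p + 1)/2 - s\<close> classes
  of non-residues are available.\<close>

lemma collisions_two_weights: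
  assumes p: "prime p" "p > p0" and B: "B \<subseteq> Sq" and N: "N \<subseteq> A" "finite N" and \<epsilon>: "0 \<le> \<epsilon>" "\<epsilon> \<le> 1"
  defines "M \<equiv> real (card N)" and "s \<equiv> real (card (residue_classes B p))"
  shows "M\<^sup>2 / real p * (2 - 5 / real p + \<epsilon> * (8 * s / real p - 2) - \<epsilon>\<^sup>2 / 2) - 2 * \<epsilon> * (M / real p) * (\<Sum>n\<in>N. nr n p)
     \<le> collisions (\<lambda>n. n mod p) N"
proof -
  note lp = large_prime[OF p]
  define F where "F = {n\<in>N. qchar (val n) p = -1}"
  define V where "V = residue_classes N p"
  define W where "W = residue_classes F p"
  define t where "t = M / real p"
  define l where "l = (\<lambda>v. if v \<in> W then t * (2 + \<epsilon>) else t * (2 - \<epsilon>))"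
  have fin: "finite V" "finite W" using lp(3) finite_residue_classes by (auto simp: V_def W_def)
  have WV: "W \<subseteq> V" unfolding V_def W_def by (rule residue_classes_mono) (auto simp: F_def)
  have V: "real (card V) \<le> (real p + 1) / 2"
  proof -
    have "card V \<le> card (residue_classes A p)" unfolding V_def
      using N lp(3) by (intro card_mono finite_residue_classes residue_classes_mono)
    then have "real (card V) \<le> real (card (residue_classes A p))" by simp
    then show ?thesis using sieve[OF p] by simp
  qed
  have W: "real (card W) \<le> (real p + 1) / 2 - s"
  proof -
    have "F \<subseteq> A" "\<And>n. n \<in> F \<Longrightarrow> qchar (val n) p = -1" using N by (auto simp: F_def)
    from card_residue_classes_split[OF p B this] show ?thesis by (simp add: W_def s_def field_simps)
  qed
  have "(\<Sum>n\<in>N. 2 * l (n mod p)) - (\<Sum>v\<in>V. (l v)\<^sup>2) \<le> collisions (\<lambda>n. n mod p) N"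
    by (rule collisions_ge) (use N fin in \<open>auto simp: V_def residue_classes_def\<close>)
  moreover have "(\<Sum>n\<in>N. 2 * l (n mod p)) = t * (4 * M - 2 * \<epsilon> * (\<Sum>n\<in>N. nr n p))"
  proof -
    have lval: "l (n mod p) = t * (2 - \<epsilon> * nr n p)" if n: "n \<in> N" for n
    proof -
      have "n mod p \<in> W \<longleftrightarrow> qchar (val n) p = -1"
      proof
        assume "n mod p \<in> W"
        then obtain f where f: "f \<in> F" "n mod p = f mod p" by (auto simp: W_def residue_classes_def)
        then have "[val n = val f] (mod p)" using n N by (intro val_cong) (auto simp: F_def)
        then show "qchar (val n) p = -1" using qchar_cong f by (auto simp: F_def)
      qed (use n in \<open>auto simp: W_def F_def residue_classes_def\<close>)
      then show ?thesis by (simp add: l_def nr_def)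
    qed
    have "(\<Sum>n\<in>N. 2 * l (n mod p)) = (\<Sum>n\<in>N. t * (4 - 2 * \<epsilon> * nr n p))"
    proof (intro sum.cong refl)
      fix n assume "n \<in> N"
      then show "2 * l (n mod p) = t * (4 - 2 * \<epsilon> * nr n p)" by (simp only: lval) (simp add: algebra_simps)
    qed
    also have "\<dots> = t * (\<Sum>n\<in>N. 4 - 2 * \<epsilon> * nr n p)" by (rule sum_distrib_left[symmetric])
    also have "(\<Sum>n\<in>N. 4 - 2 * \<epsilon> * nr n p) = 4 * M - 2 * \<epsilon> * (\<Sum>n\<in>N. nr n p)"
      by (simp add: sum_subtractf M_def sum_distrib_left)
    finally show ?thesis .
  qed
  moreover have "(\<Sum>v\<in>V. (l v)\<^sup>2) \<le> t\<^sup>2 * ((2 - \<epsilon>)\<^sup>2 * ((real p + 1) / 2) + 8 * \<epsilon> * ((real p + 1) / 2 - s))"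
  proof -
    \<comment> \<open>\<open>8 * \<epsilon>\<close> is
      \<open>(2 + \<epsilon>)\<^sup>2 - (2 - \<epsilon>)\<^sup>2\<close>: the surplus is paid only
      on the classes of \<open>W\<close>, whose number decreases with \<open>s\<close>.\<close>
    have "(\<Sum>v\<in>V. (l v)\<^sup>2) = (\<Sum>v\<in>V. t\<^sup>2 * ((2 - \<epsilon>)\<^sup>2 + (if v \<in> W then 8 * \<epsilon> else 0)))"
      by (intro sum.cong refl) (auto simp: l_def power_mult_distrib power2_eq_square algebra_simps)
    also have "\<dots> = t\<^sup>2 * ((2 - \<epsilon>)\<^sup>2 * real (card V) + 8 * \<epsilon> * real (card W))"
      using fin WV by (simp add: sum_distrib_left[symmetric] sum.distrib sum.If_cases Int_absorb1 mult.commute)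
    also have "\<dots> \<le> t\<^sup>2 * ((2 - \<epsilon>)\<^sup>2 * ((real p + 1) / 2) + 8 * \<epsilon> * ((real p + 1) / 2 - s))"
      using V W \<epsilon> by (intro mult_left_mono add_mono) auto
    finally show ?thesis .
  qed
  moreover have "M\<^sup>2 / real p * (2 - 5 / real p + \<epsilon> * (8 * s / real p - 2) - \<epsilon>\<^sup>2 / 2) - 2 * \<epsilon> * (M / real p) * (\<Sum>n\<in>N. nr n p)
     \<le> t * (4 * M - 2 * \<epsilon> * (\<Sum>n\<in>N. nr n p)) - t\<^sup>2 * ((2 - \<epsilon>)\<^sup>2 * ((real p + 1) / 2) + 8 * \<epsilon> * ((real p + 1) / 2 - s))"
  proof -
    have p0: "real p > 0" using lp(3) by simp
    have "t * (4 * M - 2 * \<epsilon> * (\<Sum>n\<in>N. nr n p)) - t\<^sup>2 * ((2 - \<epsilon>)\<^sup>2 * ((real p + 1) / 2) + 8 * \<epsilon> * ((real p + 1) / 2 - s))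
       = M\<^sup>2 / real p * (2 - (2 + 2 * \<epsilon> + \<epsilon>\<^sup>2 / 2) / real p + \<epsilon> * (8 * s / real p - 2) - \<epsilon>\<^sup>2 / 2) - 2 * \<epsilon> * (M / real p) * (\<Sum>n\<in>N. nr n p)"
      unfolding t_def using p0 by (simp add: field_simps power2_eq_square)
    \<comment> \<open>The inner terms over \<open>p\<close> stem from the \<open>+ 1\<close> in
      \<open>(p + 1) / 2\<close>. A crude coefficient suffices, since their sum over primes with
      weight \<open>lw p\<close> is bounded.\<close>
    moreover have "M\<^sup>2 / real p * (2 - 5 / real p + \<epsilon> * (8 * s / real p - 2) - \<epsilon>\<^sup>2 / 2)
       \<le> M\<^sup>2 / real p * (2 - (2 + 2 * \<epsilon> + \<epsilon>\<^sup>2 / 2) / real p + \<epsilon> * (8 * s / real p - 2) - \<epsilon>\<^sup>2 / 2)"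
    proof (intro mult_left_mono diff_right_mono add_right_mono diff_left_mono divide_right_mono)
      have "\<epsilon>\<^sup>2 \<le> 1" using \<epsilon> by (simp add: abs_square_le_1)
      then show "2 + 2 * \<epsilon> + \<epsilon>\<^sup>2 / 2 \<le> 5" using \<epsilon> by simp
    qed (use p0 in auto)
    ultimately show ?thesis by linarith
  qed
  ultimately show ?thesis by linarith
qed

abbreviation nr_sum :: "nat \<Rightarrow> nat \<Rightarrow> nat \<Rightarrow> real" where
  "nr_sum n a b \<equiv> \<Sum>p\<in>primes_in a b. lw p * nr n p"

text \<open>An element is bad if its squarefree part is exceptional. There are at most
  \<open>X powr (\<delta> / 8)\<close> such parts; those that occur exceed
  \<open>X powr \<delta>\<close> by \<open>small_characters\<close>, so the square factor of
  \<open>val n\<close> has at most \<open>sqrt (D * X powr (1 - \<delta>))\<close> possible roots.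
  This makes the bad elements a small fraction of a set of the assumed size. A good element costs
  \<open>3 * \<tau> * L\<close>, all bad ones together \<open>\<tau> * M * L\<close>, and
  \<open>4 * \<tau> = \<eta> / 8\<close>.\<close>

lemma NS_character_average:
  fixes \<eta> :: real
  assumes \<eta>: "0 < \<eta>" "\<eta> \<le> 1/8"
  shows "\<forall>\<^sub>F X in sequentially. real X powr (1/2 - \<eta>\<^sup>2/1024) \<le> real (card (NS_upto X)) \<longrightarrow>
    (\<Sum>n\<in>NS_upto X. nr_sum n (nat \<lfloor>real X powr (\<eta>/128)\<rfloor>) (nat \<lfloor>real X powr (1/4 + \<eta>)\<rfloor>))
      \<le> real (card (NS_upto X)) * (\<eta> / 8 * ln (real X))"
proof -
  define c \<delta> \<tau> where "c = \<eta> / 128" and "\<delta> = \<eta> / 256" and "\<tau> = \<eta> / 32"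
  \<comment> \<open>The bad elements have exponent
    \<open>\<delta> / 8 + (1 - \<delta>) / 2 = 1/2 - 3 * \<delta> / 8\<close>; \<open>r\<close> is
    the amount by which this lies below \<open>1/2 - \<eta>\<^sup>2/1024\<close>.\<close>
  define r where "r = 3 * \<eta> / 2048 - \<eta>\<^sup>2 / 1024"
  have \<eta>2: "\<eta>\<^sup>2 \<le> \<eta> / 8" using \<eta> mult_left_mono[of \<eta> "1/8" \<eta>] by (simp add: power2_eq_square)
  have r: "r > 0" using \<eta> \<eta>2 by (simp add: r_def)
  have cs: "0 < c" "c \<le> 1" "0 < \<delta>" "2 * \<delta> + c < \<tau>" "\<tau> > 0" using \<eta> by (auto simp: c_def \<delta>_def \<tau>_def)
  define D' where "D' = real D"
  have D': "D' > 0" using D_pos by (simp add: D'_def)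
  have \<delta>8: "\<delta> / 8 > 0" using cs by simp
  note ev1 = few_exceptional_characters[OF cs(5) cs(1,2) \<delta>8, of D]
  note ev2 = small_characters[OF cs(1,3,4)]
  have ev3: "\<forall>\<^sub>F X::nat in sequentially. sqrt D' * real X powr (- r) \<le> \<tau>" using r cs D' by real_asymp
  have ev4: "\<forall>\<^sub>F X::nat in sequentially. 2 * ln (D' * real X) \<le> (real X powr c / 2) * (2 * \<tau> * ln (real X))" using cs D' by real_asymp
  have ev5: "\<forall>\<^sub>F X::nat in sequentially. real X powr c > real p0 + 2" using cs by real_asymp
  have ev6: "\<forall>\<^sub>F X::nat in sequentially. X > 16" by (rule eventually_gt_at_top)
  from ev1 ev2 ev3 ev4 ev5 ev6 show ?thesis
  proof eventually_elim
    case (elim X)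
    define L where "L = ln (real X)"
    define a where "a = nat \<lfloor>real X powr c\<rfloor>"
    define Q where "Q = nat \<lfloor>real X powr (1/4 + \<eta>)\<rfloor>"
    let ?J = "primes_in a Q"
    define N where "N = NS_upto X"
    define M where "M = real (card N)"
    have X: "real X > 16" "L > 0" using elim by (auto simp: L_def)
    have a: "real a \<ge> real X powr c / 2" "a \<ge> p0" "a \<ge> 2" "real a > 0" using elim(5) unfolding a_def by linarith+
    have powmono: "real X powr x \<le> real X powr y" if "x \<le> y" for x y using that X by (intro powr_mono) auto
    have aQ: "a \<le> Q" unfolding a_def Q_def using \<eta> by (intro nat_mono floor_mono powmono) (auto simp: c_def)
    have "real X powr (1/4 + \<eta>) \<le> real X powr (1/2)" using \<eta> by (intro powmono) auto
    also have "\<dots> = sqrt (real X)" by (simp add: powr_half_sqrt)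
    finally have "real X powr (1/4 + \<eta>) \<le> sqrt (real X)" .
    moreover have "real Q \<le> real X powr (1/4 + \<eta>)" unfolding Q_def by (simp add: of_nat_floor)
    ultimately have Qs: "real Q \<le> sqrt (real X)" by linarith
    have sX: "4 * sqrt (real X) \<le> real X"
    proof -
      have "sqrt 16 \<le> sqrt (real X)" using X by (intro real_sqrt_le_mono) auto
      then have "4 \<le> sqrt (real X)" by simp
      then have "4 * sqrt (real X) \<le> sqrt (real X) * sqrt (real X)" by (intro mult_right_mono) auto
      then show ?thesis by simp
    qed
    have Q4: "4 * real Q \<le> real X" using Qs sX by linarith
    have QX: "Q \<le> X" using Q4 by simp
    have Q1: "Q \<ge> 1" using aQ a by simp
    have finN: "finite N" by (simp add: N_def)
    have NA: "n \<in> A" "n \<in> NS" "n \<le> X" if "n \<in> N" for n using that NSD(1) by (auto simp: N_def)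
    have lpos: "0 \<le> lw p" "prime p" "2 < p" "p0 < p" "a < p" if "p \<in> ?J" for p
      using primes_inD[OF that] a by auto
    define Bad where "Bad = {d. squarefree d \<and> d \<le> D * X \<and> \<tau> * L \<le> qsum d a Q}"
    have finBad: "finite Bad" by (rule finite_subset[of _ "{..D * X}"]) (auto simp: Bad_def)
    have cardBad: "real (card Bad) \<le> real X powr (\<delta> / 8)"
      using elim(1) QX by (simp add: Bad_def L_def a_def)
    define sf where "sf = (\<lambda>n. squarefree_part (val n))"
    define sp where "sp = (\<lambda>n. square_part (val n))"
    have dec: "val n = sf n * (sp n)\<^sup>2" for n unfolding sf_def sp_def by (rule squarefree_decompose)
    have sfD: "squarefree (sf n)" "sf n > 0" for n by (auto simp: sf_def intro!: Nat.gr0I)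
    have sf_le: "sf n \<le> D * X" "sp n > 0" "val n \<le> D * X" if "n \<in> N" for n
    proof -
      have v: "0 < val n" "val n \<le> D * X" using val_pos val_le NA[OF that] by auto
      then show "sp n > 0" using dec[of n] by (cases "sp n = 0") auto
      then have "sf n * 1 \<le> sf n * (sp n)\<^sup>2" by (intro mult_left_mono) auto
      also have "sf n * (sp n)\<^sup>2 = val n" by (rule dec[symmetric])
      also note v(2)
      finally show "sf n \<le> D * X" by simp
      show "val n \<le> D * X" by (rule v)
    qed
    define badN where "badN = {n\<in>N. sf n \<in> Bad}"
    have bad_sp: "real (sp n) \<le> sqrt (D' * real X powr (1 - \<delta>))" if n: "n \<in> badN" for n
    proof -
      have nN: "n \<in> N" using n by (simp add: badN_def)
      \<comment> \<open>The point at which non-squares are needed: the trivial character, to which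
        no such bound applies, is excluded.\<close>
      have "sf n \<noteq> b\<^sup>2" for b
      proof
        assume "sf n = b\<^sup>2"
        then have "val n = (b * sp n)\<^sup>2" using dec[of n] by (simp add: power_mult_distrib)
        then show False using NSD(2)[OF NA(2)[OF nN]] by blast
      qed
      then have "real (sf n) \<le> real X powr \<delta> \<Longrightarrow> qsum (sf n) a Q < \<tau> * L"
        using elim(2) aQ sfD(2)[of n] unfolding a_def L_def by blast
      moreover have "\<tau> * L \<le> qsum (sf n) a Q" using n by (simp add: badN_def Bad_def)
      ultimately have "real (sf n) > real X powr \<delta>" by linarith
      moreover have "real (sf n) * (real (sp n))\<^sup>2 \<le> D' * real X"
        using sf_le(3)[OF nN] dec[of n] by (simp add: D'_def flip: of_nat_power of_nat_mult)
      ultimately have "real X powr \<delta> * (real (sp n))\<^sup>2 \<le> D' * real X"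
        by (meson less_imp_le mult_right_mono order_trans zero_le_power2)
      then have "(real (sp n))\<^sup>2 \<le> D' * (real X / real X powr \<delta>)"
        using X by (simp add: field_simps)
      also have "real X / real X powr \<delta> = real X powr (1 - \<delta>)" using X by (simp add: powr_diff)
      finally show ?thesis by (rule real_le_rsqrt)
    qed
    have card_bad: "real (card badN) \<le> \<tau> * real X powr (1/2 - \<eta>\<^sup>2/1024)"
    proof -
      define B where "B = nat \<lfloor>sqrt (D' * real X powr (1 - \<delta>))\<rfloor>"
      have "inj_on (\<lambda>n. (sf n, sp n)) badN"
      proof (rule inj_onI)
        fix x y assume xy: "x \<in> badN" "y \<in> badN" "(sf x, sp x) = (sf y, sp y)"
        then have "val x = val y" using dec[of x] dec[of y] by simp
        then show "x = y" using val_inj NA xy by (auto simp: badN_def inj_on_def)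
      qed
      moreover have "(\<lambda>n. (sf n, sp n)) ` badN \<subseteq> Bad \<times> {1..B}"
      proof safe
        fix n assume n: "n \<in> badN"
        then show "sf n \<in> Bad" by (simp add: badN_def)
        have "sp n \<le> B" unfolding B_def using bad_sp[OF n] by linarith
        moreover have "sp n > 0" using n sf_le(2) by (auto simp: badN_def)
        ultimately show "sp n \<in> {1..B}" by simp
      qed
      ultimately have "card badN \<le> card (Bad \<times> {1..B})" using finBad by (intro card_inj_on_le) auto
      then have "real (card badN) \<le> real (card Bad) * real B" by (simp add: card_cartesian_product flip: of_nat_mult)
      also have "\<dots> \<le> real X powr (\<delta> / 8) * sqrt (D' * real X powr (1 - \<delta>))"
        using cardBad D' by (intro mult_mono) (auto simp: B_def)
      also have "sqrt (D' * real X powr (1 - \<delta>)) = sqrt D' * real X powr ((1 - \<delta>) / 2)"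
        by (simp add: real_sqrt_mult powr_half_sqrt[symmetric] powr_powr)
      also have "real X powr (\<delta> / 8) * (sqrt D' * real X powr ((1 - \<delta>) / 2)) = sqrt D' * real X powr (\<delta> / 8 + (1 - \<delta>) / 2)"
        by (simp add: powr_add)
      also have "\<delta> / 8 + (1 - \<delta>) / 2 = - r + (1/2 - \<eta>\<^sup>2/1024)" by (simp add: \<delta>_def r_def field_simps)
      also have "sqrt D' * real X powr (- r + (1/2 - \<eta>\<^sup>2/1024)) = (sqrt D' * real X powr (- r)) * real X powr (1/2 - \<eta>\<^sup>2/1024)"
        by (simp only: powr_add mult.assoc)
      also have "\<dots> \<le> \<tau> * real X powr (1/2 - \<eta>\<^sup>2/1024)" using elim(3) by (intro mult_right_mono) auto
      finally show ?thesis .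
    qed
    have suml: "lw_sum a Q \<le> L"
    proof -
      have "lw_sum a Q \<le> ln (real Q) + ln 4" by (rule mertens_upper[OF Q1])
      also have "\<dots> = ln (4 * real Q)" using Q1 by (simp add: ln_mult)
      also have "\<dots> \<le> L" unfolding L_def using Q4 Q1 X by (subst ln_le_cancel_iff) auto
      finally show ?thesis .
    qed
    have trivial: "nr_sum n a Q \<le> L" for n
    proof -
      have "nr_sum n a Q \<le> (\<Sum>p\<in>?J. lw p * 1)"
        using lpos nr_bounds by (intro sum_mono mult_left_mono) auto
      then show ?thesis using suml by simp
    qed
    have good: "nr_sum n a Q \<le> 3 * \<tau> * L" if n: "n \<in> N" "n \<notin> badN" for n
    proof -
      have v0: "val n > 0" using val_pos NA(1)[OF n(1)] by simp
      \<comment> \<open>Primes of the window exceed \<open>a\<close>, a power of \<open>X\<close>,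
        so those dividing \<open>val n\<close> contribute at most \<open>2 * ln (val n) / a\<close>,
        which is negligible.\<close>
      have "nr_sum n a Q \<le> (\<Sum>p\<in>?J. qchar (sf n) p * lw p + (if p dvd val n then 2 * ln (real p) / real a else 0))"
      proof (intro sum_mono)
        fix p assume p: "p \<in> ?J"
        have "lw p * nr n p \<le> lw p * (qchar (sf n) p + (if p dvd val n then 2 else 0))"
          unfolding sf_def using lpos[OF p] NA[OF n(1)] by (intro mult_left_mono nr_le) auto
        also have "\<dots> = qchar (sf n) p * lw p + (if p dvd val n then 2 * lw p else 0)" by (simp add: algebra_simps)
        also have "lw p \<le> ln (real p) / real a" using lpos[OF p] a by (intro divide_left_mono) auto
        then have "qchar (sf n) p * lw p + (if p dvd val n then 2 * lw p else 0) \<le> qchar (sf n) p * lw p + (if p dvd val n then 2 * ln (real p) / real a else 0)"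
          by simp
        finally show "lw p * nr n p \<le> qchar (sf n) p * lw p + (if p dvd val n then 2 * ln (real p) / real a else 0)" .
      qed
      also have "\<dots> = qsum (sf n) a Q + (\<Sum>p\<in>{p\<in>?J. p dvd val n}. 2 * ln (real p) / real a)"
        by (simp only: sum.distrib sum.inter_filter[OF finite_primes_in])
      also have "qsum (sf n) a Q \<le> \<tau> * L"
        using n sf_le(1)[OF n(1)] sfD by (auto simp: badN_def Bad_def)
      also have "(\<Sum>p\<in>{p\<in>?J. p dvd val n}. 2 * ln (real p) / real a) = 2 / real a * (\<Sum>p\<in>{p\<in>?J. p dvd val n}. ln (real p))"
        by (simp add: sum_distrib_left)
      also have "\<dots> \<le> 2 / real a * ln (real (val n))"
        using v0 lpos by (intro mult_left_mono sum_ln_primes_le) auto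
      also have "\<dots> \<le> 2 / real a * ln (D' * real X)"
      proof (intro mult_left_mono)
        have "real (val n) \<le> D' * real X" using sf_le(3)[OF n(1)] by (simp add: D'_def flip: of_nat_mult)
        then show "ln (real (val n)) \<le> ln (D' * real X)" using v0 D' X by (subst ln_le_cancel_iff) auto
      qed auto
      also have "\<dots> \<le> 2 * \<tau> * L"
      proof -
        have "(real X powr c / 2) * (2 * \<tau> * L) \<le> real a * (2 * \<tau> * L)" using a cs X by (intro mult_right_mono) auto
        then have "2 * ln (D' * real X) \<le> real a * (2 * \<tau> * L)" using elim(4) by (simp add: L_def)
        then show ?thesis using a by (simp add: field_simps)
      qed
      finally have "nr_sum n a Q \<le> \<tau> * L + 2 * \<tau> * L" by simp
      then show ?thesis by (simp only: distrib_right[symmetric]) (simp add: mult_ac)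
    qed
    have "(\<Sum>n\<in>N. nr_sum n a Q) \<le> M * (\<eta> / 8 * L)" if big: "real X powr (1/2 - \<eta>\<^sup>2/1024) \<le> M"
    proof -
      have "(\<Sum>n\<in>N. nr_sum n a Q) \<le> (\<Sum>n\<in>N. 3 * \<tau> * L + (if n \<in> badN then L else 0))"
      proof (intro sum_mono)
        fix n assume n: "n \<in> N"
        have nonneg: "0 \<le> 3 * \<tau> * L" using cs X by simp
        show "nr_sum n a Q \<le> 3 * \<tau> * L + (if n \<in> badN then L else 0)"
        proof (cases "n \<in> badN")
          case True
          then show ?thesis unfolding if_P[OF True] using trivial[of n] nonneg by argo
        next
          case False
          then show ?thesis unfolding if_not_P[OF False] using good[OF n] by argo
        qed
      qed
      also have "\<dots> = M * (3 * \<tau> * L) + real (card badN) * L"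
      proof -
        have "N \<inter> badN = badN" by (auto simp: badN_def)
        then show ?thesis using finN by (simp add: sum.distrib sum.If_cases M_def)
      qed
      also have "real (card badN) * L \<le> (\<tau> * M) * L"
      proof (intro mult_right_mono)
        have "\<tau> * real X powr (1/2 - \<eta>\<^sup>2/1024) \<le> \<tau> * M" using big cs by (intro mult_left_mono) auto
        then show "real (card badN) \<le> \<tau> * M" using card_bad by linarith
      qed (use X in auto)
      also have "M * (3 * \<tau> * L) + \<tau> * M * L = M * (\<eta> / 8 * L)" by (simp add: \<tau>_def)
      finally show ?thesis by simp
    qed
    then show ?case by (simp add: M_def N_def a_def Q_def L_def c_def)
  qed
qed

text \<open>With equal weights a set of \<open>X powr (1/2 - \<rho>)\<close> non-squares only gives
  \<open>(1 - 2 * \<rho>) * L \<le> L + O(1)\<close>, which is no contradiction. Tilting the weights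
  by \<open>\<epsilon> = \<eta>\<close> adds \<open>\<eta> * (2 * \<eta> - 4 * c) * L\<close>
  through \<open>Sq_sieve\<close>, and costs \<open>\<eta>\<^sup>2 / 4 * L\<close> for the term
  quadratic in \<open>\<epsilon>\<close> and \<open>\<eta>\<^sup>2 / 4 * L\<close> for the character
  averages. A tilt proportional to \<open>\<eta>\<close> lets the gain win.\<close>

lemma NS_upper_bound:
  fixes \<eta> :: real
  assumes \<eta>: "0 < \<eta>" "\<eta> \<le> 1/8"
  shows "\<forall>\<^sub>F X in sequentially. real X powr (1/4 + \<eta>) \<le> real (card (Sq_upto X)) \<longrightarrow>
     real (card (NS_upto X)) < real X powr (1/2 - \<eta>\<^sup>2/1024)"
proof -
  obtain C1 where C1: "\<And>n. n \<ge> 1 \<Longrightarrow> ln (real n) - C1 \<le> lw_sum p0 n"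
    using mertens_lower_from by blast
  obtain C2 where C2: "\<And>X Q. X \<ge> 1 \<Longrightarrow> Q \<ge> 1 \<Longrightarrow> Q \<le> card (Sq_upto X) \<Longrightarrow>
     2 * ln (real Q) - ln (real X) / 2 - C2 \<le>
     (\<Sum>p\<in>primes_in p0 Q. lw p * (8 * real (card (residue_classes (Sq_upto X) p)) / real p - 2))"
    using Sq_sieve by blast
  obtain T where T: "\<And>a n. (\<Sum>p\<in>primes_in a n. lw p * (1 / real p)) \<le> T"
    using sum_ln_over_square_bounded by blast
  define \<rho> c where "\<rho> = \<eta>\<^sup>2 / 1024" and "c = \<eta> / 128"
  have \<eta>2: "\<eta>\<^sup>2 \<le> \<eta> / 8" using \<eta> mult_left_mono[of \<eta> "1/8" \<eta>] by (simp add: power2_eq_square)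
  have \<eta>2': "\<eta>\<^sup>2 > 0" using \<eta> by simp
  define K where "K = ln 4 + 5 * T + 2 * (C1 + ln 2) + \<bar>C2\<bar> + 2 * ln 2 + 4 * ln 4 + ln 4"
  have "\<forall>\<^sub>F X::nat in sequentially. \<eta>\<^sup>2 / 2 * ln (real X) > K" using \<eta>2' by real_asymp
  moreover have "\<forall>\<^sub>F X::nat in sequentially. real X powr c > real p0 + 2" using \<eta> unfolding c_def by real_asymp
  moreover have "\<forall>\<^sub>F X::nat in sequentially. X > 16" by (rule eventually_gt_at_top)
  moreover note NS_character_average[OF \<eta>]
  ultimately show ?thesis
  proof eventually_elim
    case (elim X)
    define L where "L = ln (real X)"
    define a where "a = nat \<lfloor>real X powr c\<rfloor>"
    define Q where "Q = nat \<lfloor>real X powr (1/4 + \<eta>)\<rfloor>"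
    define Q2 where "Q2 = nat \<lfloor>real X powr (1/2 - \<rho>)\<rfloor>"
    let ?J = "primes_in a Q" and ?P = "primes_in p0 Q2"
    define N where "N = NS_upto X"
    define S where "S = Sq_upto X"
    define M where "M = real (card N)"
    define s where "s = (\<lambda>p. real (card (residue_classes S p)))"
    let ?u = "\<lambda>p. lw p * (8 * s p / real p - 2)"
    have X: "real X > 16" "L > 0" using elim by (auto simp: L_def)
    have powmono: "real X powr x \<le> real X powr y" if "x \<le> y" for x y using that X by (intro powr_mono) auto
    have a: "a \<ge> p0" "a \<ge> 2" "real a \<le> real X powr c" using elim(2) unfolding a_def by linarith+
    have aQ: "a \<le> Q" unfolding a_def Q_def using \<eta> by (intro nat_mono floor_mono powmono) (auto simp: c_def)
    have QQ2: "Q \<le> Q2" unfolding Q_def Q2_def using \<eta> \<eta>2 by (intro nat_mono floor_mono powmono) (auto simp: \<rho>_def)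
    have lower: "x * L - ln 2 \<le> ln (real (nat \<lfloor>real X powr x\<rfloor>))" if "c \<le> x" for x
    proof -
      have "real X powr x > 2" using powmono[OF that] elim(2) by linarith
      then have "real X powr x / 2 \<le> real (nat \<lfloor>real X powr x\<rfloor>)" "0 < real X powr x / 2" by linarith+
      then have "ln (real X powr x / 2) \<le> ln (real (nat \<lfloor>real X powr x\<rfloor>))" by (rule ln_mono)
      moreover have "ln (real X powr x / 2) = x * L - ln 2" using X by (simp add: ln_div ln_powr L_def)
      ultimately show ?thesis by simp
    qed
    have lnQ: "ln (real Q) \<ge> (1/4 + \<eta>) * L - ln 2" unfolding Q_def by (rule lower) (use \<eta> in \<open>auto simp: c_def\<close>)
    have lnQ2: "ln (real Q2) \<ge> (1/2 - \<rho>) * L - ln 2" unfolding Q2_def by (rule lower) (use \<eta> \<eta>2 in \<open>auto simp: c_def \<rho>_def\<close>)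
    have lna: "ln (real a) \<le> c * L" unfolding L_def using a X by (intro ln_le_powr) auto
    have Q_le: "real Q \<le> real X powr (1/4 + \<eta>)" unfolding Q_def by (simp add: of_nat_floor)
    also have "\<dots> \<le> real X powr (1/2)" using \<eta> by (intro powmono) auto
    finally have "ln (real Q) \<le> (1/2) * ln (real X)" using aQ a X by (intro ln_le_powr) auto
    then have lnQ_up: "ln (real Q) \<le> L / 2" by (simp add: L_def)
    have Q1: "Q \<ge> 1" "Q2 \<ge> 1" "a \<ge> 1" "p0 \<ge> 1" using aQ a QQ2 \<alpha> by auto
    show ?case
    proof (intro impI, rule ccontr)
      assume Sbig: "real X powr (1/4 + \<eta>) \<le> real (card (Sq_upto X))"
        and "\<not> real (card (NS_upto X)) < real X powr (1/2 - \<eta>\<^sup>2/1024)"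
      then have Nbig: "real X powr (1/2 - \<rho>) \<le> M" by (simp add: M_def N_def \<rho>_def)
      have "real Q2 \<le> real X powr (1/2 - \<rho>)" unfolding Q2_def by (simp add: of_nat_floor)
      then have Q2M: "real Q2 \<le> M" using Nbig by linarith
      have M0: "M > 0" using Q2M Q1 by linarith
      have finN: "finite N" by (simp add: N_def)
      have NA: "N \<subseteq> A" using NSD(1) by (auto simp: N_def)
      have avg: "(\<Sum>n\<in>N. nr_sum n a Q) \<le> M * (\<eta> / 8 * L)"
        using elim(4) Nbig by (simp add: M_def N_def a_def Q_def L_def c_def \<rho>_def)
      have "real Q \<le> real (card (Sq_upto X))" using Q_le Sbig by linarith
      then have QS: "Q \<le> card (Sq_upto X)" by (simp only: of_nat_le_iff)
      have sq: "2 * ln (real Q) - L / 2 - C2 \<le> (\<Sum>p\<in>primes_in p0 Q. ?u p)"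
        using C2[OF _ Q1(1) QS] X by (simp add: L_def s_def S_def)
      have up: "(\<Sum>p\<in>?P. ln (real p) * collisions (\<lambda>n. n mod p) N) \<le> M\<^sup>2 * (L + ln 4)"
        unfolding M_def L_def using finN X Q2M
        by (intro larger_sieve_primes) (auto simp: N_def M_def)
      \<comment> \<open>The weights are tilted only up to \<open>Q\<close>, the range of
        \<open>Sq_sieve\<close>, and above \<open>a\<close>, where the character averages are known;
        other primes get equal weights.\<close>
      define e where "e = (\<lambda>p. if p \<in> ?J then \<eta> else 0)"
      define h where "h = (\<lambda>p. if p \<in> ?J then lw p * (\<eta> * (8 * s p / real p - 2) - \<eta>\<^sup>2 / 2) - 2 * \<eta> / M * (lw p * (\<Sum>n\<in>N. nr n p)) else 0)"
      have "M\<^sup>2 * (\<Sum>p\<in>?P. 2 * lw p - 5 * (lw p * (1 / real p)) + h p)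
         \<le> (\<Sum>p\<in>?P. ln (real p) * collisions (\<lambda>n. n mod p) N)"
        unfolding sum_distrib_left
      proof (intro sum_mono)
        fix p assume p: "p \<in> ?P"
        note pD = primes_inD[OF p]
        have "M\<^sup>2 / real p * (2 - 5 / real p + e p * (8 * s p / real p - 2) - (e p)\<^sup>2 / 2) - 2 * e p * (M / real p) * (\<Sum>n\<in>N. nr n p)
            \<le> collisions (\<lambda>n. n mod p) N"
          unfolding M_def s_def using pD NA finN \<eta> by (intro collisions_two_weights) (auto simp: S_def e_def)
        then have "ln (real p) * (M\<^sup>2 / real p * (2 - 5 / real p + e p * (8 * s p / real p - 2) - (e p)\<^sup>2 / 2) - 2 * e p * (M / real p) * (\<Sum>n\<in>N. nr n p))
            \<le> ln (real p) * collisions (\<lambda>n. n mod p) N" using pD by (intro mult_left_mono) auto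
        moreover have "ln (real p) * (M\<^sup>2 / real p * (2 - 5 / real p + e p * (8 * s p / real p - 2) - (e p)\<^sup>2 / 2) - 2 * e p * (M / real p) * (\<Sum>n\<in>N. nr n p))
           = M\<^sup>2 * (2 * lw p - 5 * (lw p * (1 / real p)) + h p)"
          using M0 pD by (simp add: e_def h_def field_simps power2_eq_square)
        ultimately show "M\<^sup>2 * (2 * lw p - 5 * (lw p * (1 / real p)) + h p) \<le> ln (real p) * collisions (\<lambda>n. n mod p) N" by simp
      qed
      with up have "M\<^sup>2 * (\<Sum>p\<in>?P. 2 * lw p - 5 * (lw p * (1 / real p)) + h p) \<le> M\<^sup>2 * (L + ln 4)" by linarith
      then have "(\<Sum>p\<in>?P. 2 * lw p - 5 * (lw p * (1 / real p)) + h p) \<le> L + ln 4"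
        using M0 by (simp add: mult_le_cancel_left_pos)
      moreover have "(\<Sum>p\<in>?P. 2 * lw p - 5 * (lw p * (1 / real p)) + h p)
        = 2 * lw_sum p0 Q2 - 5 * (\<Sum>p\<in>?P. lw p * (1 / real p)) + (\<Sum>p\<in>?P. h p)"
        by (simp only: sum.distrib sum_subtractf sum_distrib_left)
      moreover have "(\<Sum>p\<in>?P. h p) = \<eta> * (\<Sum>p\<in>?J. ?u p)
          - \<eta>\<^sup>2 / 2 * lw_sum a Q - 2 * \<eta> / M * (\<Sum>n\<in>N. nr_sum n a Q)"
      proof -
        have sub: "?J \<subseteq> ?P" using a QQ2 by (auto simp: primes_in_def)
        have "(\<Sum>p\<in>?P. h p) = (\<Sum>p\<in>?J. h p)"
          using sub by (intro sum.mono_neutral_right) (auto simp: h_def)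
        also have "\<dots> = (\<Sum>p\<in>?J. \<eta> * (?u p) - \<eta>\<^sup>2 / 2 * lw p - 2 * \<eta> / M * (lw p * (\<Sum>n\<in>N. nr n p)))"
          by (intro sum.cong refl) (simp add: h_def algebra_simps)
        also have "\<dots> = \<eta> * (\<Sum>p\<in>?J. ?u p)
          - \<eta>\<^sup>2 / 2 * lw_sum a Q - 2 * \<eta> / M * (\<Sum>p\<in>?J. lw p * (\<Sum>n\<in>N. nr n p))"
          by (simp only: sum_subtractf sum_distrib_left)
        also have "(\<Sum>p\<in>?J. lw p * (\<Sum>n\<in>N. nr n p)) = (\<Sum>n\<in>N. nr_sum n a Q)"
          by (subst sum.swap) (simp only: sum_distrib_left)
        finally show ?thesis .
      qed
      moreover have "2 * \<eta> / M * (\<Sum>n\<in>N. nr_sum n a Q) \<le> \<eta>\<^sup>2 / 4 * L"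
      proof -
        have "2 * \<eta> / M * (\<Sum>n\<in>N. nr_sum n a Q) \<le> 2 * \<eta> / M * (M * (\<eta> / 8 * L))"
          using avg \<eta> M0 by (intro mult_left_mono) auto
        also have "\<dots> = \<eta>\<^sup>2 / 4 * L" using M0 by (simp add: power2_eq_square)
        finally show ?thesis .
      qed
      moreover have "\<eta>\<^sup>2 / 2 * lw_sum a Q \<le> \<eta>\<^sup>2 / 4 * L + ln 4"
      proof -
        have "\<eta>\<^sup>2 / 2 * lw_sum a Q \<le> \<eta>\<^sup>2 / 2 * (L / 2 + ln 4)"
          using mertens_upper[OF Q1(1), of a] lnQ_up by (intro mult_left_mono) auto
        also have "\<dots> = \<eta>\<^sup>2 / 4 * L + \<eta>\<^sup>2 / 2 * ln 4" by (simp add: algebra_simps)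
        also have "\<eta>\<^sup>2 / 2 * ln 4 \<le> 1 * ln (4::real)" using \<eta> \<eta>2 by (intro mult_right_mono) auto
        finally show ?thesis by simp
      qed
      moreover have "\<eta> * ((2 * \<eta> - 4 * c) * L) - (\<bar>C2\<bar> + 2 * ln 2 + 4 * ln 4) \<le> \<eta> * (\<Sum>p\<in>?J. ?u p)"
      proof -
        have split: "(\<Sum>p\<in>primes_in p0 Q. ?u p)
            = (\<Sum>p\<in>primes_in p0 a. ?u p) + (\<Sum>p\<in>?J. ?u p)"
          by (rule sum_primes_in_split[OF a(1) aQ])
        \<comment> \<open>Here \<open>s p \<le> (p + 1) / 2 \<le> 3/4 * p\<close> bounds the factor
          by 4, so the primes up to \<open>a\<close> take at most \<open>4 * c * L + O(1)\<close> of
          what \<open>Sq_sieve\<close> provides.\<close>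
        have "(\<Sum>p\<in>primes_in p0 a. ?u p) \<le> (\<Sum>p\<in>primes_in p0 a. lw p * 4)"
        proof (intro sum_mono mult_left_mono)
          fix p assume p: "p \<in> primes_in p0 a"
          note pD = primes_inD[OF p]
          have "2 * (s p + 0) \<le> real p + 1"
            using card_residue_classes_split[OF pD(1,2), of S "{}"] by (simp add: s_def S_def residue_classes_def)
          then have "8 * s p \<le> 6 * real p" using pD(5) by simp
          then show "8 * s p / real p - 2 \<le> 4" using pD(4) by (simp add: field_simps)
          show "0 \<le> lw p" using pD by simp
        qed
        also have "\<dots> = 4 * lw_sum p0 a" by (simp add: sum_distrib_left mult.commute)
        also have "\<dots> \<le> 4 * (c * L + ln 4)" using mertens_upper[OF Q1(3), of p0] lna by simp
        finally have "2 * ((1/4 + \<eta>) * L - ln 2) - L / 2 - C2 - 4 * (c * L + ln 4) \<le> (\<Sum>p\<in>?J. ?u p)"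
          using sq split lnQ by argo
        moreover have "2 * ((1/4 + \<eta>) * L - ln 2) - L / 2 - C2 - 4 * (c * L + ln 4) = (2 * \<eta> - 4 * c) * L - (C2 + 2 * ln 2 + 4 * ln 4)"
          by (simp add: algebra_simps)
        ultimately have "\<eta> * ((2 * \<eta> - 4 * c) * L - (C2 + 2 * ln 2 + 4 * ln 4)) \<le> \<eta> * (\<Sum>p\<in>?J. ?u p)"
          using \<eta> by (intro mult_left_mono) auto
        moreover have "\<eta> * (C2 + 2 * ln 2 + 4 * ln 4) \<le> \<eta> * (\<bar>C2\<bar> + 2 * ln 2 + 4 * ln 4)"
          using \<eta> by (intro mult_left_mono) auto
        moreover have "\<dots> \<le> 1 * (\<bar>C2\<bar> + 2 * ln 2 + 4 * ln 4)"
          using \<eta> by (intro mult_right_mono) auto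
        ultimately show ?thesis unfolding right_diff_distrib[of \<eta> _ "C2 + 2 * ln 2 + 4 * ln 4"] by argo
      qed
      moreover have "ln (real Q2) - C1 \<le> lw_sum p0 Q2" by (rule C1[OF Q1(2)])
      moreover note T[of p0 Q2] lnQ2
      \<comment> \<open>Balance in units of \<open>\<eta>\<^sup>2 * L\<close>: 2 is the gain, 1/32
        and 1/512 come from \<open>c\<close> and \<open>\<rho>\<close>, one 1/2 collects the
        quadratic and the character terms, the other is the surplus that yields the
        contradiction.\<close>
      moreover have "\<eta> * ((2 * \<eta> - 4 * c) * L) + 2 * ((1/2 - \<rho>) * L) - \<eta>\<^sup>2 / 4 * L - \<eta>\<^sup>2 / 4 * L \<ge> L + \<eta>\<^sup>2 / 2 * L"
      proof -
        have "\<eta> * ((2 * \<eta> - 4 * c) * L) + 2 * ((1/2 - \<rho>) * L) - \<eta>\<^sup>2 / 4 * L - \<eta>\<^sup>2 / 4 * L - (L + \<eta>\<^sup>2 / 2 * L)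
           = (2 - 1/32 - 1/512 - 1/2 - 1/2) * (\<eta>\<^sup>2 * L)"
          by (simp add: c_def \<rho>_def algebra_simps power2_eq_square)
        moreover have "0 \<le> \<eta>\<^sup>2 * L" using X by simp
        ultimately show ?thesis by argo
      qed
      ultimately have "\<eta>\<^sup>2 / 2 * L \<le> K" unfolding K_def by argo
      then show False using elim(1) by (simp add: L_def)
    qed
  qed
qed

end

section \<open>Rational quadratics\<close>

lemma rat_square_eq_int:
  fixes y :: rat
  assumes "y\<^sup>2 = of_int k"
  obtains z where "y = of_int z"
proof -
  obtain p q where pq: "y = Rat.Fract p q" "q > 0" "coprime p q" by (cases y)
  then have y: "y = of_int p / of_int q" by (simp add: Fract_of_int_quotient)
  have "(of_int (p\<^sup>2) :: rat) = of_int (k * q\<^sup>2)"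
    using assms pq(2) by (simp add: y power_divide field_simps)
  then have "p\<^sup>2 = k * q\<^sup>2" by (simp only: of_int_eq_iff)
  then have "q\<^sup>2 dvd p\<^sup>2" by simp
  then have "q dvd p" by simp
  then have "q = 1" using pq by (metis coprime_common_divisor dvd_refl zdvd1_eq abs_of_pos)
  then show ?thesis using y that by simp
qed

text \<open>\<open>n\<close> is a value when the discriminant of \<open>\<psi> - n\<close> is a
  rational square. Multiplied by \<open>E\<^sup>2\<close>, with \<open>E\<close> a common
  denominator, the discriminant becomes an integer linear in \<open>n\<close>, and an integer that
  is a rational square is the square of an integer.\<close>

lemma rational_values_quadratic:
  assumes "rational_quadratic \<psi>"
  obtains \<alpha> \<beta> :: int where "\<alpha> \<noteq> 0" "\<And>n. n \<in> rational_values \<psi> \<longleftrightarrow> (\<exists>z. \<alpha> * int n + \<beta> = z\<^sup>2)"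
proof -
  define a b c where "a = Polynomial.coeff \<psi> 2" and "b = Polynomial.coeff \<psi> 1" and "c = Polynomial.coeff \<psi> 0"
  have deg: "degree \<psi> = 2" using assms by (simp add: rational_quadratic_def)
  have a0: "a \<noteq> 0" unfolding a_def using deg by (metis leading_coeff_0_iff degree_0 zero_neq_numeral)
  have poly: "poly \<psi> x = a * x\<^sup>2 + b * x + c" for x
    unfolding poly_altdef deg by (simp add: a_def b_def c_def numeral_2_eq_2 algebra_simps)
  obtain a1 a2 where a12: "a2 > 0" "a = of_int a1 / of_int a2" by (cases a) (simp add: Fract_of_int_quotient)
  obtain b1 b2 where b12: "b2 > 0" "b = of_int b1 / of_int b2" by (cases b) (simp add: Fract_of_int_quotient)
  obtain c1 c2 where c12: "c2 > 0" "c = of_int c1 / of_int c2" by (cases c) (simp add: Fract_of_int_quotient)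
  define E where "E = a2 * b2 * c2"
  define A B C where "A = a1 * b2 * c2" and "B = b1 * a2 * c2" and "C = c1 * a2 * b2"
  have E0: "E > 0" using a12 b12 c12 by (simp add: E_def)
  have ABC: "a * of_int E = of_int A" "b * of_int E = of_int B" "c * of_int E = of_int C"
    using a12 b12 c12 by (simp_all add: E_def A_def B_def C_def)
  have A0: "A \<noteq> 0" using ABC(1) a0 E0 by auto
  define \<alpha> \<beta> where "\<alpha> = 4 * A * E" and "\<beta> = B\<^sup>2 - 4 * A * C"
  have key: "(of_int (\<alpha> * int n + \<beta>) :: rat) = (of_int E)\<^sup>2 * (b\<^sup>2 - 4 * a * (c - of_nat n))" for n
    unfolding \<alpha>_def \<beta>_def of_int_add of_int_diff of_int_mult of_int_power ABC[symmetric]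
    by (simp add: algebra_simps power2_eq_square)
  have "n \<in> rational_values \<psi> \<longleftrightarrow> (\<exists>z. \<alpha> * int n + \<beta> = z\<^sup>2)" for n
  proof
    assume "n \<in> rational_values \<psi>"
    then obtain x where x: "of_nat n = a * x\<^sup>2 + b * x + c" by (auto simp: rational_values_def poly)
    have "(of_int E * (2 * a * x + b))\<^sup>2 = of_int (\<alpha> * int n + \<beta>)"
      unfolding key x by (simp add: algebra_simps power2_eq_square)
    moreover from this obtain z where "of_int E * (2 * a * x + b) = of_int z" by (rule rat_square_eq_int)
    ultimately have "(of_int (z\<^sup>2) :: rat) = of_int (\<alpha> * int n + \<beta>)" by simp
    then show "\<exists>z. \<alpha> * int n + \<beta> = z\<^sup>2" by (metis of_int_eq_iff)
  next
    assume "\<exists>z. \<alpha> * int n + \<beta> = z\<^sup>2"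
    then obtain z where z: "\<alpha> * int n + \<beta> = z\<^sup>2" by blast
    define w :: rat where "w = of_int z / of_int E"
    have "(of_int z :: rat)\<^sup>2 = (of_int E)\<^sup>2 * (b\<^sup>2 - 4 * a * (c - of_nat n))"
      using key[of n] z by simp
    then have w: "w\<^sup>2 = b\<^sup>2 - 4 * a * (c - of_nat n)" using E0 by (simp add: w_def power_divide)
    have "poly \<psi> ((w - b) / (2 * a)) = (w\<^sup>2 - b\<^sup>2) / (4 * a) + c"
      using a0 unfolding poly by (simp add: field_simps power2_eq_square)
    also have "\<dots> = of_nat n" using a0 by (simp add: w field_simps)
    finally show "n \<in> rational_values \<psi>" unfolding rational_values_def by (metis (mono_tags) mem_Collect_eq rangeI)
  qed
  then show ?thesis using that[of \<alpha> \<beta>] A0 E0 by (simp add: \<alpha>_def)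
qed

theorem theorem1p6:
  fixes A :: "nat set"
  assumes "\<forall>a\<in>A. 0 < a"
    and "\<forall>\<^sub>F p in sequentially. prime p \<longrightarrow>
           real (card (residue_classes A p)) \<le> 1/2 * (real p + 1)"
  shows "(\<exists>\<psi>. rational_quadratic \<psi> \<and> finite (A - rational_values \<psi>))
       \<or> (\<forall>k::int. \<exists>\<^sub>F X in sequentially.
            real (card (truncation A X)) < real X powr (1/2) / ln (real X) powi k)
       \<or> (\<forall>\<psi>. rational_quadratic \<psi> \<longrightarrow>
            (\<forall>\<eta>>0. \<forall>\<^sub>F X in sequentially.
               real (card (truncation A X \<inter> rational_values \<psi>)) \<le> real X powr (1/4 + \<eta>)))"
proof (rule ccontr)
  assume contra: "\<not> ?thesis"
  then have no_quadratic: "\<And>\<psi>. rational_quadratic \<psi> \<Longrightarrow> infinite (A - rational_values \<psi>)" by blast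
  from contra obtain \<psi> \<eta> where \<psi>: "rational_quadratic \<psi>" and \<eta>: "\<eta> > 0"
    and many: "\<exists>\<^sub>F X in sequentially. real X powr (1/4 + \<eta>) < real (card (truncation A X \<inter> rational_values \<psi>))"
    by (auto simp: not_eventually not_le)
  from contra obtain k :: int where k: "\<not> (\<exists>\<^sub>F X in sequentially.
            real (card (truncation A X)) < real X powr (1/2) / ln (real X) powi k)" by blast
  obtain \<alpha> \<beta> :: int where \<alpha>: "\<alpha> \<noteq> 0" and vals: "\<And>n. n \<in> rational_values \<psi> \<longleftrightarrow> (\<exists>z. \<alpha> * int n + \<beta> = z\<^sup>2)"
    using rational_values_quadratic[OF \<psi>] by blast
  define b where "b = nat \<bar>\<beta>\<bar>"
  \<comment> \<open>For negative \<open>\<alpha>\<close> only finitely many natural numbers are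
    values, contrary to \<open>many\<close>.\<close>
  have "\<alpha> > 0"
  proof (rule ccontr)
    assume "\<not> \<alpha> > 0"
    then have neg: "\<alpha> \<le> -1" using \<alpha> by simp
    have "rational_values \<psi> \<subseteq> {..b}"
    proof
      fix n assume "n \<in> rational_values \<psi>"
      then obtain z where "\<alpha> * int n + \<beta> = z\<^sup>2" using vals by blast
      then have "0 \<le> \<alpha> * int n + \<beta>" by simp
      moreover have "\<alpha> * int n \<le> -1 * int n" using neg by (intro mult_right_mono) auto
      ultimately show "n \<in> {..b}" by (simp add: b_def)
    qed
    then have le: "card (truncation A X \<inter> rational_values \<psi>) \<le> b + 1" for X
      using card_mono[of "{..b}" "truncation A X \<inter> rational_values \<psi>"] by auto
    have "\<forall>\<^sub>F X::nat in sequentially. real X powr (1/4 + \<eta>) \<ge> real b + 1" using \<eta> by real_asymp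
    then have "\<forall>\<^sub>F X in sequentially. \<not> real X powr (1/4 + \<eta>) < real (card (truncation A X \<inter> rational_values \<psi>))"
    proof eventually_elim
      case (elim X)
      have "real (card (truncation A X \<inter> rational_values \<psi>)) \<le> real b + 1"
        using le[of X] by linarith
      then show ?case using elim by linarith
    qed
    then show False using many by (simp add: frequently_def)
  qed
  obtain P0 where P0: "\<And>p. p \<ge> P0 \<Longrightarrow> prime p \<Longrightarrow> real (card (residue_classes A p)) \<le> 1/2 * (real p + 1)"
    using assms(2) by (auto simp: eventually_sequentially)
  define p0 where "p0 = max P0 (max (nat \<alpha>) 2)"
  \<comment> \<open>For \<open>n > \<bar>\<beta>\<bar>\<close> the form
    \<open>\<alpha> * n + \<beta>\<close> is positive; at most \<open>b\<close> elements are lost,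
    which later appear as the additive constant \<open>B\<close>.\<close>
  define A' where "A' = {n\<in>A. n > b}"
  have sub: "A' \<subseteq> A" "A - A' \<subseteq> {1..b}" using assms(1) by (auto simp: A'_def not_less Suc_le_eq)
  interpret sieved_set A' "nat \<alpha>" p0 \<beta>
  proof
    fix n assume n: "n \<in> A'"
    have "1 * int n \<le> \<alpha> * int n" using \<open>\<alpha> > 0\<close> by (intro mult_right_mono) auto
    moreover have "\<bar>\<beta>\<bar> < int n" using n by (auto simp: A'_def b_def)
    ultimately have "0 < \<alpha> * int n + \<beta>" by linarith
    then show "0 < n \<and> 0 < int (nat \<alpha>) * int n + \<beta>" using n \<open>\<alpha> > 0\<close> by (auto simp: A'_def)
  next
    fix p assume p: "prime p" "p > p0"
    have "card (residue_classes A' p) \<le> card (residue_classes A p)"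
      using p sub(1) by (intro card_mono finite_residue_classes residue_classes_mono) (auto simp: p0_def)
    then have "real (card (residue_classes A' p)) \<le> real (card (residue_classes A p))" by simp
    then show "2 * real (card (residue_classes A' p)) \<le> real p + 1"
      using P0[of p] p by (simp add: p0_def)
  qed (use \<open>\<alpha> > 0\<close> in \<open>auto simp: p0_def\<close>)
  have Sq_eq: "Sq = A' \<inter> rational_values \<psi>"
  proof -
    have "(\<exists>c. val n = c\<^sup>2) \<longleftrightarrow> (\<exists>z. \<alpha> * int n + \<beta> = z\<^sup>2)" if n: "n \<in> A'" for n
    proof -
      have v: "int (val n) = \<alpha> * int n + \<beta>" using int_val[OF n] \<open>\<alpha> > 0\<close> by simp
      show ?thesis
      proof
        assume "\<exists>c. val n = c\<^sup>2"
        then obtain c where "val n = c\<^sup>2" by blast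
        then have "int (val n) = (int c)\<^sup>2" by simp
        then show "\<exists>z. \<alpha> * int n + \<beta> = z\<^sup>2" using v by metis
      next
        assume "\<exists>z. \<alpha> * int n + \<beta> = z\<^sup>2"
        then obtain z where "int (val n) = z\<^sup>2" using v by metis
        then have "int (val n) = int ((nat \<bar>z\<bar>)\<^sup>2)" by simp
        then have "val n = (nat \<bar>z\<bar>)\<^sup>2" by (simp only: of_nat_eq_iff)
        then show "\<exists>c. val n = c\<^sup>2" by blast
      qed
    qed
    then show ?thesis unfolding Sq_def using vals by blast
  qed
  have "A - rational_values \<psi> \<subseteq> NS \<union> {1..b}" using sub by (auto simp: NS_def Sq_eq)
  then have infNS: "infinite NS" using no_quadratic[OF \<psi>] by (meson finite_UnI finite_atLeastAtMost finite_subset)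
  \<comment> \<open>Strictly below \<open>\<eta>\<close>, so that
    \<open>X powr (1/4 + \<eta>)\<close> absorbs the lost elements, and at most 1/8 as
    \<open>NS_upper_bound\<close> requires.\<close>
  define \<eta>' where "\<eta>' = min (\<eta> / 2) (1/8)"
  have \<eta>': "0 < \<eta>'" "\<eta>' \<le> 1/8" "\<eta>' < \<eta>" using \<eta> by (auto simp: \<eta>'_def)
  define \<rho> where "\<rho> = \<eta>'\<^sup>2 / 1024"
  have \<rho>: "\<rho> > 0" using \<eta>' by (simp add: \<rho>_def)
  define B where "B = real b"
  \<comment> \<open>For negative \<open>k\<close> the exponent 0 is enough, because
    \<open>ln X > 1\<close>.\<close>
  define K where "K = nat k"
  have "\<forall>\<^sub>F X::nat in sequentially. real X powr (1/4 + \<eta>') + B \<le> real X powr (1/4 + \<eta>)"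
    using \<eta>' by real_asymp
  moreover have "\<forall>\<^sub>F X::nat in sequentially. B + real X powr (1/2) / ln (real X) powr (real K + 1) + real X powr (1/2 - \<rho>) < real X powr (1/2) / ln (real X) powr real K"
    using \<rho> by real_asymp
  moreover have "\<forall>\<^sub>F X::nat in sequentially. ln (real X) > 1" by real_asymp
  \<comment> \<open>The exponent \<open>K + 1\<close> for the squares leaves one logarithm of room
    for the non-squares and the lost elements.\<close>
  moreover note NS_upper_bound[OF \<eta>'(1,2)] Sq_upper_bound[OF infNS, of "K + 1"]
  ultimately have "\<forall>\<^sub>F X in sequentially. real X powr (1/4 + \<eta>) < real (card (truncation A X \<inter> rational_values \<psi>)) \<longrightarrow>
     real (card (truncation A X)) < real X powr (1/2) / ln (real X) powi k"
  proof eventually_elim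
    case (elim X)
    show ?case
    proof
      assume big: "real X powr (1/4 + \<eta>) < real (card (truncation A X \<inter> rational_values \<psi>))"
      have "truncation A X \<inter> rational_values \<psi> \<subseteq> (Sq_upto X) \<union> {1..b}"
        using sub by (auto simp: truncation_def Sq_eq)
      then have "card (truncation A X \<inter> rational_values \<psi>) \<le> card ((Sq_upto X) \<union> {1..b})"
        by (intro card_mono) auto
      also have "\<dots> \<le> card (Sq_upto X) + b" using card_Un_le[of "Sq_upto X" "{1..b}"] by simp
      finally have "real (card (truncation A X \<inter> rational_values \<psi>)) \<le> real (card (Sq_upto X)) + B"
        by (simp add: B_def flip: of_nat_add)
      then have "real X powr (1/4 + \<eta>') \<le> real (card (Sq_upto X))" using big elim(1) by linarith
      then have NS: "real (card (NS_upto X)) < real X powr (1/2 - \<rho>)" using elim(4) by (simp add: \<rho>_def)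
      have "truncation A X \<subseteq> (Sq_upto X) \<union> (NS_upto X) \<union> {1..b}"
        using sub by (auto simp: truncation_def NS_def)
      then have "card (truncation A X) \<le> card ((Sq_upto X) \<union> (NS_upto X) \<union> {1..b})"
        by (intro card_mono) auto
      also have "\<dots> \<le> card (Sq_upto X) + card (NS_upto X) + b"
        using card_Un_le[of "(Sq_upto X) \<union> (NS_upto X)" "{1..b}"] card_Un_le[of "Sq_upto X" "NS_upto X"] by simp
      finally have "real (card (truncation A X)) \<le> real (card (Sq_upto X)) + real (card (NS_upto X)) + B"
        by (simp add: B_def flip: of_nat_add)
      moreover have "real (card (Sq_upto X)) \<le> real X powr (1/2) / ln (real X) powr (real K + 1)"
        using elim(5) powr_realpow[of "ln (real X)" "K + 1"] elim(3) by (simp add: add.commute)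
      ultimately have "real (card (truncation A X)) < real X powr (1/2) / ln (real X) powr real K"
        using NS elim(2) by linarith
      also have "\<dots> \<le> real X powr (1/2) / ln (real X) powi k"
      proof (rule divide_left_mono)
        have "ln (real X) powi k \<le> ln (real X) powi int K"
          using elim(3) by (intro power_int_increasing) (auto simp: K_def)
        then show "ln (real X) powi k \<le> ln (real X) powr real K" using elim(3) by (simp add: powr_realpow)
        show "0 < ln (real X) powr real K * ln (real X) powi k" using elim(3) by simp
      qed simp
      finally show "real (card (truncation A X)) < real X powr (1/2) / ln (real X) powi k" .
    qed
  qed
  from frequently_rev_mp[OF many this] k show False by blast
qed

end
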